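(* Let $n\geq 3$ and let $f\in\mathbb{Z}[t_1,\dots,t_n]$ be a nondegenerate $n$-ary quadratic form. Then $\delta(f)>0$.
   Context: $D_f\coloneqq f(\mathbb{Z}^n)\setminus\{0\}$. For $S\subset\mathbb{Z}$: $S$ is positive if it contains no negative integers, negative if it contains no positive integers, indefinite otherwise. The density of $S$ is $\lim_{N\to\infty}\#(S\cap[1,N])/N$ if $S$ is positive, $\lim_{N\to\infty}\#(S\cap[-N,-1])/N$ if $S$ is negative, and $\lim_{N\to\infty}\#(S\cap[-N,N])/(2N)$ if $S$ is indefinite (the limit being required to exist). $\delta(f)$ denotes the density of $D_f$. *)

theory Defs
  imports Complex_Main "HOL-Library.Poly_Mapping"
begin

text \<open>
  Polynomials with integer coefficients are finitely supported maps from monomials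
  (finitely supported exponent vectors) to coefficients. The variables
  \<open>t_1, \<dots>, t_n\<close> are indexed by \<open>0, \<dots>, n - 1\<close>.
\<close>

type_synonym int_mpoly = "(nat \<Rightarrow>\<^sub>0 nat) \<Rightarrow>\<^sub>0 int"

definition mpoly_eval :: "int_mpoly \<Rightarrow> (nat \<Rightarrow> int) \<Rightarrow> int" where
  "mpoly_eval f x =
     (\<Sum>m\<in>Poly_Mapping.keys f. Poly_Mapping.lookup f m *
        (\<Prod>i\<in>Poly_Mapping.keys m. x i ^ Poly_Mapping.lookup m i))"

definition quadratic_form :: "nat \<Rightarrow> int_mpoly \<Rightarrow> bool" where
  "quadratic_form n f \<longleftrightarrow>
     (\<forall>m\<in>Poly_Mapping.keys f. Poly_Mapping.keys m \<subseteq> {..<n} \<and>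
        (\<Sum>i\<in>Poly_Mapping.keys m. Poly_Mapping.lookup m i) = 2)"

text \<open>The lattice of integer vectors of length \<open>n\<close>, extended by zero to all indices.\<close>

definition int_lattice :: "nat \<Rightarrow> (nat \<Rightarrow> int) set" where
  "int_lattice n = {x. \<forall>i\<ge>n. x i = 0}"

definition polar_form :: "int_mpoly \<Rightarrow> (nat \<Rightarrow> int) \<Rightarrow> (nat \<Rightarrow> int) \<Rightarrow> int" where
  "polar_form f x y = mpoly_eval f (\<lambda>i. x i + y i) - mpoly_eval f x - mpoly_eval f y"

text \<open>
  A form is nondegenerate if its polar bilinear form has trivial radical. Clearing denominators,
  it does not matter whether the radical is taken over the integers or over the rationals.
\<close>

definition nondegenerate :: "nat \<Rightarrow> int_mpoly \<Rightarrow> bool" where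
  "nondegenerate n f \<longleftrightarrow>
     (\<forall>x\<in>int_lattice n. (\<forall>y\<in>int_lattice n. polar_form f x y = 0) \<longrightarrow> x = (\<lambda>_. 0))"

definition represented :: "nat \<Rightarrow> int_mpoly \<Rightarrow> int set" where
  "represented n f = mpoly_eval f ` int_lattice n - {0}"

definition positive_set :: "int set \<Rightarrow> bool" where
  "positive_set S \<longleftrightarrow> (\<forall>k\<in>S. \<not> k < 0)"

definition negative_set :: "int set \<Rightarrow> bool" where
  "negative_set S \<longleftrightarrow> (\<forall>k\<in>S. \<not> k > 0)"

text \<open>
  A set that is both positive and negative is contained in \<open>{0}\<close>; the first two branches then
  agree, both giving density 0.
\<close>

definition has_density :: "int set \<Rightarrow> real \<Rightarrow> bool" where
  "has_density S d \<longleftrightarrow>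
     (if positive_set S then
        (\<lambda>N::nat. real (card (S \<inter> {1..int N})) / real N) \<longlonglongrightarrow> d
      else if negative_set S then
        (\<lambda>N::nat. real (card (S \<inter> {- int N..-1})) / real N) \<longlonglongrightarrow> d
      else
        (\<lambda>N::nat. real (card (S \<inter> {- int N..int N})) / (2 * real N)) \<longlonglongrightarrow> d)"

end

theory Submission
  imports Defs "HOL-Analysis.Analysis" "HOL-Number_Theory.Cong"
begin

text \<open>
  On a sublattice of finite index the form is diagonal, with nonzero coefficients \<open>a\<^sub>i\<close>. Restricted to a
  residue class \<open>v\<^sub>0 + M t\<close> of that sublattice it becomes
  \<open>f v\<^sub>0 + g M (\<Sum>i. \<beta>\<^sub>i t\<^sub>i + k a\<^sub>i t\<^sub>i\<^sup>2)\<close> with \<open>g k = M\<close> and the \<open>\<beta>\<^sub>i\<close> coprime to \<open>k\<close>. If every prime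
  dividing \<open>30 \<Prod>a\<^sub>i\<close> divides \<open>k\<close>, there is no local obstruction left, and the polynomial in
  parentheses represents almost all positive integers. The classes where this fails consist of values
  divisible by a high power of one of finitely many primes, so they are negligible as \<open>M\<close> grows. Hence,
  up to density \<open>\<epsilon>\<close>, the represented integers of one sign form a finite union of residue classes, which
  gives a positive density.

  That almost all integers are represented is a second moment argument. Let \<open>r m\<close> count representations
  in a box of size \<open>Y\<close> and let \<open>r'\<close> be its average over the progression of difference \<open>D\<close>, a multiple of
  \<open>P!\<close>. By Parseval and Weyl's inequality for three of the variables, the variance of \<open>r - r'\<close> only sees
  rational frequencies with denominator greater than \<open>P\<close> and is smaller than trivial by a factor of
  about \<open>P\<close>. On the other hand \<open>r'\<close> is bounded below by counting solutions modulo \<open>D\<close>; the loss is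
  a power of \<open>\<Prod>p\<le>P. 1 - 5 / p\<close>, which decays more slowly than any power of \<open>P\<close>. So \<open>r m = 0\<close> is
  possible only for a proportion of integers \<open>m\<close> that tends to \<open>0\<close> with \<open>P\<close>.
\<close>

section \<open>Quadratic exponential sums\<close>

text \<open>The ternary case dictates the shape of the proof: three variables are too few for an
  asymptotic count at each single integer, and even the mean-square estimate is tight. Near a
  fraction with denominator \<open>q\<close> a normalised exponential sum is of size
  \<open>q^(-1/2)\<close>; squaring and multiplying over three variables gives
  \<open>q^(-3)\<close>, there are about \<open>q\<close> numerators, and the sum of
  \<open>1 / q^2\<close> beyond \<open>P\<close> leaves \<open>1 / P\<close>. Since \<open>P\<close>
  stays fixed while \<open>Y\<close> grows, a factor \<open>log Y\<close> would ruin this saving.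
  Comparing \<open>r\<close> with its own average replaces the evaluation of a singular series: the
  contributions of small denominators nearly cancel in \<open>r - r'\<close>, and of
  \<open>r'\<close> only a lower bound is required. That bound loses a product over primes up to
  \<open>P\<close>, so a large fixed \<open>P\<close> wins. The density is never computed. The
  represented set agrees with finite unions of residue classes up to arbitrarily small errors, which
  makes the counting ratios a Cauchy sequence.\<close>

definition unit_exp :: "real \<Rightarrow> complex" where
  "unit_exp x = cis (2 * pi * x)"

definition dist_int :: "real \<Rightarrow> real" where
  "dist_int x = \<bar>x - of_int (round x)\<bar>"

lemma norm_unit_exp [simp]: "norm (unit_exp x) = 1"
  by (simp add: unit_exp_def)

lemma unit_exp_add: "unit_exp (x + y) = unit_exp x * unit_exp y"
  by (simp add: unit_exp_def cis_mult ring_distribs)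

lemma cnj_unit_exp: "cnj (unit_exp x) = unit_exp (- x)"
  by (simp add: unit_exp_def cis_cnj)

lemma unit_exp_of_int [simp]: "unit_exp (of_int n) = 1"
  unfolding unit_exp_def by (rule cis_multiple_2pi) simp

lemma unit_exp_0 [simp]: "unit_exp 0 = 1"
  by (simp add: unit_exp_def)

lemma unit_exp_mult_nat: "unit_exp (x * of_nat n) = unit_exp x ^ n"
  by (simp add: unit_exp_def Complex.DeMoivre mult_ac)

lemma unit_exp_sum: "unit_exp (sum f A) = (\<Prod>i\<in>A. unit_exp (f i))"
  by (induction A rule: infinite_finite_induct) (auto simp: unit_exp_add)

lemma dist_int_nonneg [simp]: "dist_int x \<ge> 0"
  by (simp add: dist_int_def)

lemma dist_int_le_half: "dist_int x \<le> 1 / 2"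
  unfolding dist_int_def using of_int_round_abs_le[of x] by (simp add: abs_minus_commute)

text \<open>For \<open>|y| <= 2\<close> the cubic Taylor remainder is at most
  \<open>2 * |y| / 3\<close>, which leaves a third of \<open>|y|\<close>. The range covers
  \<open>pi * d\<close> with \<open>|d| <= 1/2\<close>, as \<open>pi < 4\<close>.\<close>

lemma abs_sin_ge_third:
  assumes "\<bar>y\<bar> \<le> (2::real)"
  shows "\<bar>y\<bar> / 3 \<le> \<bar>sin y\<bar>"
proof -
  have "\<bar>sin y - (\<Sum>m<3. sin_coeff m * y ^ m)\<bar> \<le> inverse (fact 3) * \<bar>y\<bar> ^ 3"
    by (rule Maclaurin_sin_bound)
  moreover have "(\<Sum>m<3. sin_coeff m * y ^ m) = y"
    by (simp add: numeral_3_eq_3 sin_coeff_def)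
  ultimately have 1: "\<bar>sin y - y\<bar> \<le> \<bar>y\<bar> ^ 3 / 6"
    by (simp add: fact_numeral field_simps)
  have "\<bar>y\<bar> * \<bar>y\<bar> \<le> 2 * 2"
    using assms by (intro mult_mono) auto
  then have "\<bar>y\<bar> * (\<bar>y\<bar> * \<bar>y\<bar>) \<le> \<bar>y\<bar> * 4"
    by (intro mult_left_mono) auto
  then have "\<bar>y\<bar> ^ 3 / 6 \<le> 2 * \<bar>y\<bar> / 3"
    by (simp add: power3_eq_cube)
  with 1 show ?thesis by linarith
qed

lemma norm_1_minus_unit_exp_eq: "norm (1 - unit_exp x) = \<bar>2 * sin (pi * x)\<bar>"
proof -
  have "(norm (1 - unit_exp x))\<^sup>2 = (1 - cos (2 * (pi * x)))\<^sup>2 + (sin (2 * (pi * x)))\<^sup>2"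
    by (simp add: unit_exp_def cmod_def mult.assoc)
  also have "\<dots> = 2 - 2 * cos (2 * (pi * x))"
    using sin_cos_squared_add[of "2 * (pi * x)"] by (simp add: power2_diff)
  also have "\<dots> = (2 * sin (pi * x))\<^sup>2"
    by (simp add: cos_double_sin power_mult_distrib)
  finally show ?thesis
    by (rule power2_eq_imp_eq[OF _ norm_ge_zero abs_ge_zero, unfolded power2_abs])
qed

lemma norm_1_minus_unit_exp:
  "2 * dist_int x \<le> norm (1 - unit_exp x)"
proof -
  define d where "d = x - of_int (round x)"
  have "unit_exp x = unit_exp (d + of_int (round x))"
    by (simp add: d_def)
  then have e: "unit_exp x = unit_exp d"
    by (simp only: unit_exp_add unit_exp_of_int mult_1_right)
  have d: "\<bar>d\<bar> = dist_int x" by (simp add: d_def dist_int_def)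
  have n: "norm (1 - unit_exp d) = \<bar>2 * sin (pi * d)\<bar>"
    by (rule norm_1_minus_unit_exp_eq)
  have "\<bar>pi * d\<bar> \<le> 4 * (1 / 2)"
    unfolding abs_mult using dist_int_le_half[of x] d pi_less_4 by (intro mult_mono) auto
  then have "\<bar>pi * d\<bar> / 3 \<le> \<bar>sin (pi * d)\<bar>"
    by (intro abs_sin_ge_third) simp
  moreover have "3 * \<bar>d\<bar> \<le> \<bar>pi * d\<bar>"
    unfolding abs_mult using pi_gt3 by (intro mult_right_mono) auto
  ultimately show ?thesis
    using n e d by (simp add: abs_mult)
qed

lemma norm_1_minus_unit_exp_le: "norm (1 - unit_exp x) \<le> 8 * \<bar>x\<bar>"
proof -
  have "norm (1 - unit_exp x) = \<bar>2 * sin (pi * x)\<bar>"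
    by (rule norm_1_minus_unit_exp_eq)
  also have "\<dots> \<le> 2 * \<bar>pi * x\<bar>"
    using abs_sin_x_le_abs_x[of "pi * x"] by (simp add: abs_mult)
  also have "\<dots> \<le> 8 * \<bar>x\<bar>"
    using pi_less_4 mult_right_mono[of pi 4 "\<bar>x\<bar>"] by (simp add: abs_mult)
  finally show ?thesis .
qed

text \<open>The trivial bound \<open>T <= Y\<close> and the geometric bound
  \<open>dist_int \<theta> * T <= 1\<close> are added instead of taking a minimum. The result is one
  smooth expression, which can be squared and summed over frequencies without case
  distinctions.\<close>

lemma geometric_unit_exp_bound:
  fixes Y :: nat and l u :: int
  assumes "u - l \<le> int Y"
  shows "norm (\<Sum>x\<in>{l..<u}. unit_exp (\<theta> * of_int x)) \<le> 2 * Y / (1 + Y * dist_int \<theta>)"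
proof (cases "l \<le> u")
  case False
  then show ?thesis by simp
next
  case True
  define T where "T = norm (\<Sum>x\<in>{l..<u}. unit_exp (\<theta> * of_int x))"
  define n where "n = nat (u - l)"
  have "(\<Sum>x\<in>{l..<u}. unit_exp (\<theta> * of_int x)) = (\<Sum>i<n. unit_exp (\<theta> * of_int (l + int i)))"
    by (rule sum.reindex_bij_witness[of _ "\<lambda>i. l + int i" "\<lambda>x. nat (x - l)"])
       (use True in \<open>auto simp: n_def\<close>)
  also have "\<dots> = unit_exp (\<theta> * of_int l) * (\<Sum>i<n. unit_exp \<theta> ^ i)"
    by (simp add: sum_distrib_left unit_exp_add unit_exp_mult_nat ring_distribs)
  finally have T: "T = norm (\<Sum>i<n. unit_exp \<theta> ^ i)"
    by (simp add: T_def norm_mult)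
  have "T \<le> (\<Sum>i<n. norm (unit_exp \<theta> ^ i))"
    unfolding T by (rule norm_sum)
  then have 1: "T \<le> Y"
    using assms True by (simp add: norm_power n_def)
  have "(1 - unit_exp \<theta>) * (\<Sum>i<n. unit_exp \<theta> ^ i) = 1 - unit_exp \<theta> ^ n"
    by (rule one_diff_power_eq[symmetric])
  then have "norm (1 - unit_exp \<theta>) * T = norm (1 - unit_exp \<theta> ^ n)"
    unfolding T by (metis norm_mult)
  also have "\<dots> \<le> 2"
    using norm_triangle_ineq4[of 1 "unit_exp \<theta> ^ n"] by (simp add: norm_power)
  finally have "norm (1 - unit_exp \<theta>) * T \<le> 2" .
  moreover have "2 * dist_int \<theta> * T \<le> norm (1 - unit_exp \<theta>) * T"
    by (intro mult_right_mono norm_1_minus_unit_exp) (simp add: T_def)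
  ultimately have 2: "dist_int \<theta> * T \<le> 1" by simp
  have "T * (1 + Y * dist_int \<theta>) = T + Y * (dist_int \<theta> * T)"
    by (simp add: algebra_simps)
  also have "\<dots> \<le> real Y + real Y * 1"
    by (intro add_mono mult_left_mono 1 2) auto
  finally have "T * (1 + Y * dist_int \<theta>) \<le> 2 * Y" by simp
  moreover have "1 + Y * dist_int \<theta> > 0"
    by (simp add: add_pos_nonneg)
  ultimately show ?thesis
    by (simp add: T_def pos_le_divide_eq)
qed

text \<open>Summing over \<open>x + y\<close> gives the variable a triangular weight. Weyl differencing then produces
  squares of geometric sums, and the bounds below carry no logarithms, which the argument could not
  afford when only three variables are available.\<close>

definition quad_sum :: "nat \<Rightarrow> int \<Rightarrow> int \<Rightarrow> real \<Rightarrow> complex" where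
  "quad_sum Y b A \<alpha> =
     (\<Sum>x\<in>{0..<int Y}. \<Sum>y\<in>{0..<int Y}. unit_exp (\<alpha> * of_int (b * (x + y) + A * (x + y)\<^sup>2)))"

text \<open>For a fixed difference \<open>h\<close> the remaining variable runs through an interval
  of length at most \<open>Y\<close>, so the inner sum can become a geometric sum.\<close>

lemma sum_pairs_by_difference:
  fixes F :: "int \<Rightarrow> int \<Rightarrow> 'a::comm_monoid_add"
  shows "(\<Sum>y\<in>{0..<Y}. \<Sum>z\<in>{0..<Y}. F y z) =
    (\<Sum>h\<in>{-Y<..<Y}. \<Sum>z\<in>{max 0 (-h)..<min Y (Y - h)}. F (z + h) z)"
proof -
  have "(\<Sum>y\<in>{0..<Y}. \<Sum>z\<in>{0..<Y}. F y z) = (\<Sum>(y,z)\<in>{0..<Y} \<times> {0..<Y}. F y z)"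
    by (simp add: sum.cartesian_product)
  also have "\<dots> = (\<Sum>(h,z)\<in>(SIGMA h:{-Y<..<Y}. {max 0 (-h)..<min Y (Y - h)}). F (z + h) z)"
    by (rule sum.reindex_bij_witness[of _ "\<lambda>(h,z). (z + h, z)" "\<lambda>(y,z). (y - z, z)"]) auto
  also have "\<dots> = (\<Sum>h\<in>{-Y<..<Y}. \<Sum>z\<in>{max 0 (-h)..<min Y (Y - h)}. F (z + h) z)"
    by (subst sum.Sigma) auto
  finally show ?thesis .
qed

text \<open>Cauchy-Schwarz over \<open>x\<close>, then differencing in \<open>y\<close> alone. The
  quadratic terms in \<open>x\<close> and \<open>y\<close> cancel and the remaining phase is linear
  in \<open>x + y\<close>, so it splits into a geometric sum over \<open>x\<close> and one over
  \<open>y\<close> with the same frequency. This is the source of the square in the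
  denominator.\<close>

lemma quad_sum_weyl:
  "(norm (quad_sum Y b A \<alpha>))\<^sup>2 \<le>
     4 * Y ^ 3 * (\<Sum>h\<in>{-int Y<..<int Y}. 1 / (1 + Y * dist_int (of_int h * (2 * A * \<alpha>)))\<^sup>2)"
proof -
  let ?I = "{0..<int Y}"
  let ?J = "\<lambda>h. {max 0 (-h)..<min (int Y) (int Y - h)}"
  define z where "z = (\<lambda>x y. unit_exp (\<alpha> * of_int (b * (x + y) + A * (x + y)\<^sup>2)))"
  define \<theta> where "\<theta> = (\<lambda>h::int. of_int h * (2 * A * \<alpha>))"
  have "norm (quad_sum Y b A \<alpha>) \<le> (\<Sum>x\<in>?I. norm (\<Sum>y\<in>?I. z x y))"
    unfolding quad_sum_def z_def by (rule norm_sum)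
  then have "(norm (quad_sum Y b A \<alpha>))\<^sup>2 \<le> (\<Sum>x\<in>?I. norm (\<Sum>y\<in>?I. z x y))\<^sup>2"
    by (intro power_mono) auto
  also have "\<dots> \<le> (\<Sum>x\<in>?I. (norm (\<Sum>y\<in>?I. z x y))\<^sup>2) * card ?I"
    by (rule sum_squared_le_sum_of_squares)
  finally have 1: "(norm (quad_sum Y b A \<alpha>))\<^sup>2 \<le> Y * (\<Sum>x\<in>?I. (norm (\<Sum>y\<in>?I. z x y))\<^sup>2)"
    by (simp add: mult.commute)
  have diff: "z x (y + h) * cnj (z x y) =
      unit_exp (\<alpha> * of_int (b * h + A * h\<^sup>2)) * (unit_exp (\<theta> h * of_int x) * unit_exp (\<theta> h * of_int y))"
    for x y h
    unfolding z_def cnj_unit_exp unit_exp_add[symmetric] \<theta>_def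
    by (rule arg_cong[where f = unit_exp]) (simp add: algebra_simps power2_eq_square)
  have "complex_of_real (\<Sum>x\<in>?I. (norm (\<Sum>y\<in>?I. z x y))\<^sup>2)
      = (\<Sum>x\<in>?I. \<Sum>y\<in>?I. \<Sum>y'\<in>?I. z x y * cnj (z x y'))"
    by (simp add: complex_norm_square sum_product del: of_real_power)
  also have "\<dots> = (\<Sum>x\<in>?I. \<Sum>h\<in>{-int Y<..<int Y}. \<Sum>y\<in>?J h. z x (y + h) * cnj (z x y))"
    by (simp only: sum_pairs_by_difference)
  also have "\<dots> = (\<Sum>h\<in>{-int Y<..<int Y}. \<Sum>x\<in>?I. \<Sum>y\<in>?J h. z x (y + h) * cnj (z x y))"
    by (rule sum.swap)
  also have "\<dots> = (\<Sum>h\<in>{-int Y<..<int Y}. unit_exp (\<alpha> * of_int (b * h + A * h\<^sup>2)) *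
       ((\<Sum>x\<in>?I. unit_exp (\<theta> h * of_int x)) * (\<Sum>y\<in>?J h. unit_exp (\<theta> h * of_int y))))"
    unfolding diff sum_product by (simp only: sum_distrib_left)
  finally have eq: "complex_of_real (\<Sum>x\<in>?I. (norm (\<Sum>y\<in>?I. z x y))\<^sup>2) = \<dots>" .
  have "R = norm W" if "complex_of_real R = W" "0 \<le> R" for R W
    using that by auto
  from this[OF eq] have "(\<Sum>x\<in>?I. (norm (\<Sum>y\<in>?I. z x y))\<^sup>2) =
     norm (\<Sum>h\<in>{-int Y<..<int Y}. unit_exp (\<alpha> * of_int (b * h + A * h\<^sup>2)) *
       ((\<Sum>x\<in>?I. unit_exp (\<theta> h * of_int x)) * (\<Sum>y\<in>?J h. unit_exp (\<theta> h * of_int y))))"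
    by (simp add: sum_nonneg)
  also have "\<dots> \<le> (\<Sum>h\<in>{-int Y<..<int Y}.
      norm (\<Sum>x\<in>?I. unit_exp (\<theta> h * of_int x)) * norm (\<Sum>y\<in>?J h. unit_exp (\<theta> h * of_int y)))"
    by (rule order_trans[OF norm_sum]) (simp add: norm_mult)
  also have "\<dots> \<le> (\<Sum>h\<in>{-int Y<..<int Y}.
      (2 * Y / (1 + Y * dist_int (\<theta> h))) * (2 * Y / (1 + Y * dist_int (\<theta> h))))"
    by (intro sum_mono mult_mono geometric_unit_exp_bound) auto
  also have "\<dots> = 4 * (real Y)\<^sup>2 * (\<Sum>h\<in>{-int Y<..<int Y}. 1 / (1 + Y * dist_int (\<theta> h))\<^sup>2)"
    by (simp add: sum_distrib_left power2_eq_square)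
  finally have "Y * (\<Sum>x\<in>?I. (norm (\<Sum>y\<in>?I. z x y))\<^sup>2) \<le>
     Y * (4 * (real Y)\<^sup>2 * (\<Sum>h\<in>{-int Y<..<int Y}. 1 / (1 + Y * dist_int (\<theta> h))\<^sup>2))"
    by (intro mult_left_mono) auto
  with 1 show ?thesis
    by (simp add: \<theta>_def power2_eq_square power3_eq_cube algebra_simps)
qed

section \<open>Sums of inverse squares and the major arc bound\<close>

lemma sum_inverse_square_nat:
  fixes B :: real
  assumes "B > 0" "finite F"
  shows "(\<Sum>l\<in>F. 1 / (1 + B * real l)\<^sup>2) \<le> 1 + 1 / B"
proof -
  \<comment> \<open>The subtracted remainder makes the induction telescope: each new term is at most
    \<open>1 / (x * (x + B))\<close>, which is a difference of two such remainders.\<close>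
  have *: "(\<Sum>l\<le>n. 1 / (1 + B * real l)\<^sup>2) \<le> 1 + 1 / B - 1 / (B * (1 + B * real n))" for n
  proof (induction n)
    case 0
    then show ?case using assms by simp
  next
    case (Suc n)
    define x where "x = 1 + B * real n"
    have x: "x > 0" "x + B > 0" using assms by (auto simp: x_def add_pos_nonneg)
    have s: "1 + B * real (Suc n) = x + B" by (simp add: x_def algebra_simps)
    have "1 / (x + B)\<^sup>2 \<le> 1 / (x * (x + B))"
      using x assms by (intro divide_left_mono) (auto simp: power2_eq_square)
    also have "\<dots> = 1 / (B * x) - 1 / (B * (x + B))"
    proof -
      have "1 / (B * x) - 1 / (B * (x + B)) = (B * (x + B) - B * x) / ((B * x) * (B * (x + B)))"
        using x assms by (intro diff_frac_eq[of "B * x" "B * (x + B)" 1 1, simplified]) auto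
      also have "\<dots> = (B * B) * 1 / ((B * B) * (x * (x + B)))"
        by (simp add: algebra_simps)
      also have "\<dots> = 1 / (x * (x + B))"
        using assms by (subst mult_divide_mult_cancel_left) auto
      finally show ?thesis by simp
    qed
    finally have "(\<Sum>l\<le>n. 1 / (1 + B * real l)\<^sup>2) + 1 / (x + B)\<^sup>2 \<le> 1 + 1 / B - 1 / (B * (x + B))"
      using Suc.IH by (simp add: x_def)
    then show ?case unfolding s[symmetric] by simp
  qed
  obtain n where "F \<subseteq> {..n}"
    using assms finite_nat_iff_bounded_le by blast
  then have "(\<Sum>l\<in>F. 1 / (1 + B * real l)\<^sup>2) \<le> (\<Sum>l\<le>n. 1 / (1 + B * real l)\<^sup>2)"
    by (intro sum_mono2) auto
  also have "\<dots> \<le> 1 + 1 / B - 1 / (B * (1 + B * real n))" by (rule *)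
  also have "\<dots> \<le> 1 + 1 / B"
    using assms by simp
  finally show ?thesis .
qed

text \<open>Split at the ceiling of \<open>x\<close>. On either side the distances to
  \<open>x\<close> are at least 0, 1, 2, ..., so the one-sided bound applies twice.\<close>

lemma sum_inverse_square_int:
  fixes B x :: real and F :: "int set"
  assumes "B > 0" "finite F"
  shows "(\<Sum>j\<in>F. 1 / (1 + B * \<bar>of_int j - x\<bar>)\<^sup>2) \<le> 2 + 2 / B"
proof -
  let ?c = "\<lceil>x\<rceil>"
  let ?f = "\<lambda>j::int. 1 / (1 + B * \<bar>of_int j - x\<bar>)\<^sup>2"
  have pos: "1 + B * t > 0" if "t \<ge> 0" for t :: real
    using that assms by (simp add: add_pos_nonneg)
  have "(\<Sum>j\<in>F \<inter> {?c..}. ?f j) \<le> (\<Sum>j\<in>F \<inter> {?c..}. 1 / (1 + B * real (nat (j - ?c)))\<^sup>2)"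
  proof (intro sum_mono divide_left_mono power_mono add_left_mono mult_left_mono)
    fix j assume j: "j \<in> F \<inter> {?c..}"
    show "real (nat (j - \<lceil>x\<rceil>)) \<le> \<bar>real_of_int j - x\<bar>"
      using j by auto linarith
    show "0 < (1 + B * \<bar>real_of_int j - x\<bar>)\<^sup>2 * (1 + B * real (nat (j - \<lceil>x\<rceil>)))\<^sup>2"
      by (intro mult_pos_pos zero_less_power pos) auto
  qed (use assms pos in \<open>auto simp: less_imp_le\<close>)
  also have "\<dots> = (\<Sum>l\<in>(\<lambda>j. nat (j - ?c)) ` (F \<inter> {?c..}). 1 / (1 + B * real l)\<^sup>2)"
    by (subst sum.reindex) (auto simp: inj_on_def)
  also have "\<dots> \<le> 1 + 1 / B"
    using assms by (intro sum_inverse_square_nat) auto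
  finally have 1: "(\<Sum>j\<in>F \<inter> {?c..}. ?f j) \<le> 1 + 1 / B" .
  have "(\<Sum>j\<in>F - {?c..}. ?f j) \<le> (\<Sum>j\<in>F - {?c..}. 1 / (1 + B * real (nat (?c - 1 - j)))\<^sup>2)"
  proof (intro sum_mono divide_left_mono power_mono add_left_mono mult_left_mono)
    fix j assume j: "j \<in> F - {?c..}"
    show "real (nat (\<lceil>x\<rceil> - 1 - j)) \<le> \<bar>real_of_int j - x\<bar>"
      using j by auto linarith
    show "0 < (1 + B * \<bar>real_of_int j - x\<bar>)\<^sup>2 * (1 + B * real (nat (\<lceil>x\<rceil> - 1 - j)))\<^sup>2"
      by (intro mult_pos_pos zero_less_power pos) auto
  qed (use assms pos in \<open>auto simp: less_imp_le\<close>)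
  also have "\<dots> = (\<Sum>l\<in>(\<lambda>j. nat (?c - 1 - j)) ` (F - {?c..}). 1 / (1 + B * real l)\<^sup>2)"
    by (subst sum.reindex) (auto simp: inj_on_def)
  also have "\<dots> \<le> 1 + 1 / B"
    using assms by (intro sum_inverse_square_nat) auto
  finally have 2: "(\<Sum>j\<in>F - {?c..}. ?f j) \<le> 1 + 1 / B" .
  have "(\<Sum>j\<in>F. ?f j) = (\<Sum>j\<in>F \<inter> {?c..}. ?f j) + (\<Sum>j\<in>F - {?c..}. ?f j)"
    using assms by (subst sum.Int_Diff[of _ _ "{?c..}"]) auto
  with 1 2 show ?thesis by simp
qed

lemma card_cong_interval_le:
  fixes F :: "int set" and q l u :: int
  assumes "F \<subseteq> {l..<u}" "l \<le> u" "q > 0" "\<And>x y. x \<in> F \<Longrightarrow> y \<in> F \<Longrightarrow> q dvd (x - y)"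
  shows "real (card F) \<le> (u - l) / q + 1"
proof (cases "F = {}")
  case True
  then show ?thesis using assms by simp
next
  case False
  have fin: "finite F" using assms(1) finite_subset by blast
  define m where "m = Min F"
  have m: "m \<in> F" "\<And>x. x \<in> F \<Longrightarrow> m \<le> x"
    using fin False by (auto simp: m_def)
  have "inj_on (\<lambda>x. (x - m) div q) F"
  proof (rule inj_onI)
    fix x y assume "x \<in> F" "y \<in> F" "(x - m) div q = (y - m) div q"
    moreover have "q * ((x - m) div q) = x - m"
      by (rule dvd_mult_div_cancel) (use calculation m assms(4) in blast)
    moreover have "q * ((y - m) div q) = y - m"
      by (rule dvd_mult_div_cancel) (use calculation m assms(4) in blast)
    ultimately have "x - m = y - m" by metis
    then show "x = y" by simp
  qed
  moreover have "(\<lambda>x. (x - m) div q) ` F \<subseteq> {0..(u - l) div q}"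
  proof (rule image_subsetI)
    fix x assume "x \<in> F"
    then have "m \<le> x" "x < u" "l \<le> m" using m assms(1) by auto
    then have "0 \<le> x - m" "x - m \<le> u - l" by auto
    then show "(x - m) div q \<in> {0..(u - l) div q}"
      using \<open>q > 0\<close> by (simp add: zdiv_mono1 pos_imp_zdiv_nonneg_iff)
  qed
  ultimately have "card F \<le> card {0..(u - l) div q}"
    by (intro card_inj_on_le) auto
  moreover have "0 \<le> (u - l) div q"
    using assms by (simp add: pos_imp_zdiv_nonneg_iff)
  ultimately have "real (card F) \<le> of_int ((u - l) div q) + 1"
    by simp
  also have "\<dots> \<le> (u - l) / q + 1"
    by (metis add_right_mono real_of_int_div4 of_int_diff)
  finally show ?thesis .
qed

lemma dist_int_ge_near:
  assumes "\<bar>x - of_int n\<bar> \<le> 1 / 2"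
  shows "\<bar>x - of_int n\<bar> \<le> dist_int x"
proof (cases "round x = n")
  case False
  then have "1 \<le> \<bar>round x - n\<bar>" by linarith
  then have "(1::real) \<le> \<bar>of_int (round x) - of_int n\<bar>" by linarith
  then show ?thesis using assms unfolding dist_int_def by linarith
qed (simp add: dist_int_def)

lemma sum_inverse_squares_le_2:
  "finite F \<Longrightarrow> F \<subseteq> {1..} \<Longrightarrow> (\<Sum>r\<in>F. 1 / (of_int r)\<^sup>2) \<le> (2::real)" for F :: "int set"
proof -
  assume F: "finite F" "F \<subseteq> {1..}"
  have "(\<Sum>r\<in>F. 1 / (of_int r)\<^sup>2) = (\<Sum>l\<in>(\<lambda>r. nat (r - 1)) ` F. 1 / (1 + 1 * real l)\<^sup>2)"
  proof (subst sum.reindex)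
    show "inj_on (\<lambda>r. nat (r - 1)) F"
    proof (rule inj_onI)
      fix x y assume "x \<in> F" "y \<in> F" "nat (x - 1) = nat (y - 1)"
      moreover have "1 \<le> x" "1 \<le> y" using calculation F by auto
      ultimately show "x = y" by simp
    qed
    show "(\<Sum>r\<in>F. 1 / (real_of_int r)\<^sup>2) = sum ((\<lambda>l. 1 / (1 + 1 * real l)\<^sup>2) \<circ> (\<lambda>r. nat (r - 1))) F"
      by (rule sum.cong) (use F in force)+
  qed
  also have "\<dots> \<le> 1 + 1 / 1"
    using F by (intro sum_inverse_square_nat) auto
  finally show ?thesis by simp
qed

text \<open>Multiples of \<open>q\<close> see only the error \<open>h * \<beta>\<close>; for the
  other \<open>h\<close> the fraction \<open>h * a / q\<close> itself stays away from the integers.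
  Each nonzero residue is hit at most \<open>4 * R\<close> times, and since the terms are squared
  the sum over residues converges like that of \<open>1 / r^2\<close>, where first powers would
  produce a logarithm.\<close>

lemma sum_dist_int_major_arc:
  fixes a q :: int and Y :: nat and \<theta> \<beta> :: real
  defines "\<beta> \<equiv> \<theta> - a / q"
  assumes "coprime a q" "0 < q" "q \<le> 2 * int Y" "1 \<le> Y" and \<beta>: "\<bar>\<beta>\<bar> \<le> 1 / (2 * q * Y)"
  shows "(\<Sum>h\<in>{-int Y<..<int Y}. 1 / (1 + Y * dist_int (of_int h * \<theta>))\<^sup>2)
           \<le> 400 * (Y / q) / (1 + Y\<^sup>2 * \<bar>\<beta>\<bar>)"
proof -
  let ?H = "{-int Y<..<int Y}"
  let ?f = "\<lambda>h::int. 1 / (1 + Y * dist_int (of_int h * \<theta>))\<^sup>2"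
  define X where "X = Y\<^sup>2 * \<bar>\<beta>\<bar>"
  define R where "R = Y / q"
  have q: "real_of_int q > 0" using assms by simp
  have Y: "real Y > 0" using assms by simp
  have "real_of_int q \<le> 2 * real Y" using assms by linarith
  then have R: "R > 0" "1 \<le> 2 * R"
    using q Y by (auto simp: R_def field_simps)
  have "\<bar>\<beta>\<bar> * real Y * real Y \<le> 1 / (2 * q * Y) * real Y * real Y"
    using \<beta> by (intro mult_right_mono) auto
  then have X: "X \<le> R / 2" "0 \<le> X"
    using q Y by (auto simp: X_def R_def power2_eq_square field_simps)
  have hb: "\<bar>of_int h * \<beta>\<bar> \<le> 1 / (2 * q)" if "h \<in> ?H" for h
  proof -
    have "\<bar>of_int h * \<beta>\<bar> \<le> real Y * (1 / (2 * q * Y))"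
      unfolding abs_mult using that \<beta> by (intro mult_mono) auto
    then show ?thesis using Y q by (simp add: field_simps)
  qed
  have split: "of_int h * \<theta> = of_int (h * a) / q + of_int h * \<beta>" for h
    using q by (simp add: \<beta>_def field_simps)
  have pos: "1 + real Y * t > 0" if "t \<ge> 0" for t :: real
    using that by (simp add: add_pos_nonneg)
  let ?HA = "{h\<in>?H. q dvd h}" and ?HB = "{h\<in>?H. \<not> q dvd h}"
  have "finite {h\<in>?H. Q h}" for Q
    by (rule finite_subset[of _ ?H]) auto
  note fin = this[of "\<lambda>h. q dvd h"] this[of "\<lambda>h. \<not> q dvd h"]
  have per_class: "real_of_int (int Y - (- int Y)) / real_of_int q + 1 \<le> 4 * R"
    using R by (simp add: R_def)
  have d0: "\<bar>of_int h * \<beta>\<bar> \<le> dist_int (of_int h * \<theta>)" if "h \<in> ?HA" for h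
  proof -
    from that obtain l where "h = q * l" by auto
    then have e: "of_int h * \<theta> = of_int (l * a) + of_int h * \<beta>"
      using split[of h] q by simp
    have "1 / (2 * real_of_int q) \<le> 1 / 2"
      using assms by (simp add: field_simps)
    then have "\<bar>of_int h * \<theta> - of_int (l * a)\<bar> \<le> 1 / 2"
      unfolding e using hb[of h] that by simp
    from dist_int_ge_near[OF this] show ?thesis by (simp add: e)
  qed
  \<comment> \<open>For \<open>X <= 1\<close> the terms are bounded by 1 and merely counted; for
    larger \<open>X\<close> the decay in \<open>h\<close> takes over. The factor
    \<open>1 + X\<close> covers both regimes.\<close>
  have S0: "(\<Sum>h\<in>?HA. ?f h) \<le> 8 * R / (1 + X)"
  proof (cases "X \<le> 1")
    case True
    have "(\<Sum>h\<in>?HA. ?f h) \<le> (\<Sum>h\<in>?HA. 1)"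
      using pos by (intro sum_mono) (auto simp: divide_le_eq)
    also have "\<dots> = real (card ?HA)" by simp
    also have "\<dots> \<le> real_of_int (int Y - (- int Y)) / real_of_int q + 1"
      by (rule card_cong_interval_le) (use assms in auto)
    also have "\<dots> \<le> 4 * R" by (rule per_class)
    also have "\<dots> \<le> 8 * R / (1 + X)"
      using True X R by (simp add: field_simps)
    finally show ?thesis .
  next
    case False
    define B where "B = Y * q * \<bar>\<beta>\<bar>"
    have "\<bar>\<beta>\<bar> > 0" using False X by (auto simp: X_def)
    then have B: "B > 0" using q Y by (simp add: B_def)
    have "(\<Sum>h\<in>?HA. ?f h) \<le> (\<Sum>h\<in>?HA. 1 / (1 + B * \<bar>of_int (h div q) - 0\<bar>)\<^sup>2)"
    proof (intro sum_mono divide_left_mono power_mono)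
      fix h assume h: "h \<in> ?HA"
      then obtain l where l: "h = q * l" by auto
      have "real Y * \<bar>of_int h * \<beta>\<bar> \<le> real Y * dist_int (of_int h * \<theta>)"
        using d0[OF h] by (intro mult_left_mono) auto
      then show "1 + B * \<bar>of_int (h div q) - 0\<bar> \<le> 1 + real Y * dist_int (of_int h * \<theta>)"
        using l q by (simp add: B_def abs_mult mult_ac)
    qed (use B pos in \<open>auto intro!: mult_pos_pos zero_less_power add_pos_nonneg\<close>)
    also have "\<dots> = (\<Sum>l\<in>(\<lambda>h. h div q) ` ?HA. 1 / (1 + B * \<bar>of_int l - 0\<bar>)\<^sup>2)"
      using assms by (subst sum.reindex) (auto simp: inj_on_def)
    also have "\<dots> \<le> 2 + 2 / B"
      using B fin by (intro sum_inverse_square_int) blast+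
    also have "\<dots> \<le> 4 * (1 / B)"
    proof -
      have "B * 2 \<le> 1"
        using mult_right_mono[OF \<beta>, of "Y * q * 2"] q Y by (simp add: B_def field_simps)
      then show ?thesis using B by (simp add: field_simps)
    qed
    also have "1 / B = R / X"
      using q Y \<open>\<bar>\<beta>\<bar> > 0\<close> by (simp add: B_def R_def X_def field_simps power2_eq_square)
    also have "4 * (R / X) \<le> 8 * R / (1 + X)"
      using False R by (simp add: field_simps)
    finally show ?thesis .
  qed
  \<comment> \<open>A bound for a term through the distance \<open>min r (q - r)\<close> to the
    multiples of \<open>q\<close>. Both ends are added, which removes the minimum.\<close>
  define T where "T = (\<lambda>r::int. 4 / R\<^sup>2 * (1 / (of_int r)\<^sup>2 + 1 / (of_int (q - r))\<^sup>2))"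
  have S1: "(\<Sum>h\<in>?HB. ?f h) \<le> 64 / R"
  proof -
    have rr: "h * a mod q \<in> {1..q-1}" if "h \<in> ?HB" for h
    proof -
      have "\<not> q dvd h * a"
        using that assms by (simp add: coprime_commute coprime_dvd_mult_left_iff)
      then have "h * a mod q \<noteq> 0" by (simp add: dvd_eq_mod_eq_0)
      moreover have "0 \<le> h * a mod q" "h * a mod q < q" using assms by auto
      ultimately show ?thesis by simp
    qed
    have "(\<Sum>h\<in>?HB. ?f h) \<le> (\<Sum>h\<in>?HB. T (h * a mod q))"
    proof (intro sum_mono)
      fix h assume h: "h \<in> ?HB"
      define r where "r = h * a mod q"
      define mn where "mn = min r (q - r)"
      define n where "n = round (of_int h * \<theta>)"
      have r: "1 \<le> r" "r \<le> q - 1" using rr[OF h] by (auto simp: r_def)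
      have mn: "1 \<le> mn" using r by (auto simp: mn_def)
      have "mn \<le> \<bar>h * a - n * q\<bar>"
      proof -
        have e: "h * a = q * (h * a div q) + r" by (simp add: r_def)
        consider "n \<le> h * a div q" | "n \<ge> h * a div q + 1" by linarith
        then show ?thesis
        proof cases
          case 1
          then have "q * n \<le> q * (h * a div q)" using assms by (intro mult_left_mono) auto
          then show ?thesis using e by (simp add: mn_def mult.commute[of n])
        next
          case 2
          then have "q * (h * a div q + 1) \<le> q * n" using assms by (intro mult_left_mono) auto
          then show ?thesis using e unfolding mn_def mult.commute[of n] distrib_left by linarith
        qed
      qed
      then have "real_of_int mn \<le> real_of_int \<bar>h * a - n * q\<bar>" by (simp only: of_int_le_iff)
      then have "real_of_int mn \<le> \<bar>of_int (h * a) - of_int n * of_int q\<bar>" by simp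
      then have "mn / q \<le> \<bar>of_int (h * a) - of_int n * of_int q\<bar> / q"
        using q by (intro divide_right_mono) auto
      also have "\<dots> = \<bar>(of_int (h * a) - of_int n * of_int q) / q\<bar>"
        using q by simp
      also have "\<dots> = \<bar>of_int (h * a) / q - of_int n\<bar>"
        using q by (simp add: diff_divide_distrib)
      also have "\<dots> \<le> dist_int (of_int h * \<theta>) + 1 / (2 * q)"
        using hb[of h] h split[of h] unfolding dist_int_def n_def by simp
      finally have "mn / q - 1 / (2 * q) \<le> dist_int (of_int h * \<theta>)" by simp
      \<comment> \<open>Since \<open>mn >= 1\<close>, half of \<open>mn / q\<close> absorbs the
        perturbation by \<open>h * \<beta>\<close>, which is at most
        \<open>1 / (2 * q)\<close>.\<close>
      moreover have "mn / (2 * q) \<le> mn / q - 1 / (2 * q)"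
        using mn q by (simp add: field_simps)
      ultimately have "real Y * (mn / (2 * q)) \<le> real Y * dist_int (of_int h * \<theta>)"
        by (intro mult_left_mono) auto
      then have l: "R * mn / 2 \<le> 1 + Y * dist_int (of_int h * \<theta>)"
        by (simp add: R_def)
      have p: "R * mn / 2 > 0" using R mn by simp
      have "?f h \<le> 1 / (R * mn / 2)\<^sup>2"
        using l p by (intro divide_left_mono power_mono) (auto intro!: mult_pos_pos zero_less_power)
      also have "\<dots> = 4 / R\<^sup>2 * (1 / (of_int mn)\<^sup>2)"
        by (simp add: power_mult_distrib power_divide)
      also have "\<dots> \<le> T r"
        unfolding T_def mn_def min_def using R by (intro mult_left_mono) auto
      finally show "?f h \<le> T (h * a mod q)" by (simp add: r_def)
    qed
    also have "\<dots> = (\<Sum>r\<in>{1..q-1}. \<Sum>h | h \<in> ?HB \<and> h * a mod q = r. T (h * a mod q))"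
      by (rule sum.group[symmetric]) (use rr fin in blast)+
    also have "\<dots> = (\<Sum>r\<in>{1..q-1}. real (card {h. h \<in> ?HB \<and> h * a mod q = r}) * T r)"
      by simp
    also have "\<dots> \<le> (\<Sum>r\<in>{1..q-1}. 4 * R * T r)"
    proof (intro sum_mono mult_right_mono)
      fix r assume "r \<in> {1..q-1}"
      have "real (card {h. h \<in> ?HB \<and> h * a mod q = r}) \<le> real_of_int (int Y - (- int Y)) / real_of_int q + 1"
      proof (rule card_cong_interval_le)
        fix x y assume "x \<in> {h. h \<in> ?HB \<and> h * a mod q = r}" "y \<in> {h. h \<in> ?HB \<and> h * a mod q = r}"
        then have "q dvd (x * a - y * a)" by (metis (mono_tags, lifting) mem_Collect_eq mod_eq_dvd_iff)
        then have "q dvd (x - y) * a" by (simp add: algebra_simps)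
        then show "q dvd x - y"
          using assms by (simp add: coprime_commute coprime_dvd_mult_left_iff)
      qed (use assms in auto)
      also have "\<dots> \<le> 4 * R" by (rule per_class)
      finally show "real (card {h. h \<in> ?HB \<and> h * a mod q = r}) \<le> 4 * R" .
    qed (use R in \<open>auto simp: T_def\<close>)
    also have "\<dots> = 16 / R * ((\<Sum>r\<in>{1..q-1}. 1 / (of_int r)\<^sup>2) + (\<Sum>r\<in>{1..q-1}. 1 / (of_int (q - r))\<^sup>2))"
      unfolding T_def using R by (simp add: sum_distrib_left sum.distrib[symmetric] power2_eq_square)
    also have "(\<Sum>r\<in>{1..q-1}. 1 / (real_of_int (q - r))\<^sup>2) = (\<Sum>r\<in>{1..q-1}. 1 / (of_int r)\<^sup>2)"
      by (rule sum.reindex_bij_witness[of _ "\<lambda>r. q - r" "\<lambda>r. q - r"]) auto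
    also have "16 / R * ((\<Sum>r\<in>{1..q-1}. 1 / (of_int r)\<^sup>2) + (\<Sum>r\<in>{1..q-1}. 1 / (of_int r)\<^sup>2)) \<le> 16 / R * (2 + 2)"
      using R by (intro mult_left_mono add_mono sum_inverse_squares_le_2) auto
    finally show ?thesis by simp
  qed
  \<comment> \<open>From \<open>R >= 1/2\<close> and \<open>X <= R / 2\<close> follows
    \<open>1 + X <= 5 * R / 2\<close>, so the part outside the multiples of \<open>q\<close> is also
    dominated by \<open>R / (1 + X)\<close>.\<close>
  have e1: "64 / R \<le> 320 * R / (1 + X)"
  proof -
    have "64 * (1 + X) \<le> 64 * (5 / 2 * R)" using X R by simp
    also have "\<dots> \<le> 320 * R * R" using R by simp
    finally show ?thesis using X R by (simp add: field_simps)
  qed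
  have HU: "?H = ?HA \<union> ?HB" by blast
  have e2: "(\<Sum>h\<in>?H. ?f h) = (\<Sum>h\<in>?HA. ?f h) + (\<Sum>h\<in>?HB. ?f h)"
    by (subst HU, rule sum.union_disjoint) (use fin in blast)+
  have e3: "8 * R / (1 + X) + 320 * R / (1 + X) \<le> 400 * R / (1 + X)"
    using R X by (simp add: add_divide_distrib[symmetric] divide_right_mono)
  have "(\<Sum>h\<in>?H. ?f h) \<le> 400 * R / (1 + X)"
    using S0 S1 e1 e2 e3 by linarith
  then show ?thesis by (simp add: R_def X_def)
qed

text \<open>The Fourier multiplier of averaging over \<open>J\<close> translates by multiples of
  \<open>D\<close>. It is close to 1 near a fraction whose denominator divides \<open>D\<close>, as
  long as \<open>J * D\<close> times the distance to that fraction is small.\<close>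

definition avg_exp :: "nat \<Rightarrow> nat \<Rightarrow> real \<Rightarrow> complex" where
  "avg_exp D J \<alpha> = (\<Sum>i<J. unit_exp (\<alpha> * of_nat (i * D))) / of_nat J"

lemma norm_1_minus_avg_exp:
  assumes "J \<ge> 1" "\<And>i. i < J \<Longrightarrow> norm (1 - unit_exp (\<alpha> * of_nat (i * D))) \<le> c"
  shows "norm (1 - avg_exp D J \<alpha>) \<le> c"
proof -
  have "1 - avg_exp D J \<alpha> = (\<Sum>i<J. 1 - unit_exp (\<alpha> * of_nat (i * D))) / of_nat J"
    using assms(1) by (simp add: avg_exp_def sum_subtractf diff_divide_distrib)
  then have "norm (1 - avg_exp D J \<alpha>) = norm (\<Sum>i<J. 1 - unit_exp (\<alpha> * of_nat (i * D))) / J"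
    by (simp add: norm_divide)
  also have "\<dots> \<le> (\<Sum>i<J. c) / J"
    using assms by (intro divide_right_mono order_trans[OF norm_sum] sum_mono) auto
  also have "\<dots> = c" using assms(1) by simp
  finally show ?thesis .
qed

section \<open>The sixth moment over sampled frequencies\<close>

lemma sum_inverse_squares_tail:
  assumes "finite F" "\<And>q. q \<in> F \<Longrightarrow> q > P" "P \<ge> 1"
  shows "(\<Sum>q\<in>F. 1 / (real q)\<^sup>2) \<le> 1 / real P"
proof -
  have "(\<Sum>q\<in>F. 1 / (real q)\<^sup>2) = (\<Sum>l\<in>(\<lambda>q. q - Suc P) ` F. 1 / (real (l + Suc P))\<^sup>2)"
  proof (subst sum.reindex)
    show "inj_on (\<lambda>q. q - Suc P) F"
      by (rule inj_onI) (use assms(2) in \<open>force simp: Suc_le_eq eq_diff_iff\<close>)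
    show "(\<Sum>q\<in>F. 1 / (real q)\<^sup>2) = sum ((\<lambda>l. 1 / (real (l + Suc P))\<^sup>2) \<circ> (\<lambda>q. q - Suc P)) F"
      using assms(2) by (intro sum.cong) (auto simp: Suc_le_eq)
  qed
  \<comment> \<open>Rescaling by \<open>P + 1\<close> turns the tail into the general sum with
    \<open>B = 1 / (P + 1)\<close>; the outcome \<open>(P + 2) / (P + 1)^2\<close> is at most
    \<open>1 / P\<close>.\<close>
  also have "\<dots> = (\<Sum>l\<in>(\<lambda>q. q - Suc P) ` F. 1 / (real (Suc P))\<^sup>2 * (1 / (1 + 1 / real (Suc P) * real l)\<^sup>2))"
  proof (rule sum.cong)
    fix l
    have "real (l + Suc P) = real (Suc P) * (1 + 1 / real (Suc P) * real l)"
      by (simp add: field_simps)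
    then show "1 / (real (l + Suc P))\<^sup>2 = 1 / (real (Suc P))\<^sup>2 * (1 / (1 + 1 / real (Suc P) * real l)\<^sup>2)"
      by (simp only: power_mult_distrib) simp
  qed simp
  also have "\<dots> = 1 / (real (Suc P))\<^sup>2 * (\<Sum>l\<in>(\<lambda>q. q - Suc P) ` F. 1 / (1 + 1 / real (Suc P) * real l)\<^sup>2)"
    by (simp only: sum_distrib_left)
  also have "\<dots> \<le> 1 / (real (Suc P))\<^sup>2 * (1 + 1 / (1 / real (Suc P)))"
    using assms(1) by (intro mult_left_mono sum_inverse_square_nat) auto
  also have "\<dots> \<le> 1 / real P"
  proof -
    have "1 / (real (Suc P))\<^sup>2 * (1 + 1 / (1 / real (Suc P))) = (real P + 2) / (real P + 1)\<^sup>2"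
      by (simp add: add.commute)
    also have "\<dots> \<le> 1 / real P"
      using assms(3) by (simp add: divide_le_eq le_divide_eq) (simp add: divide_simps power2_eq_square algebra_simps)
    finally show ?thesis .
  qed
  finally show ?thesis .
qed

text \<open>Denominators up to \<open>2 * Y\<close> make the approximation error small enough for
  all \<open>|h| < Y\<close> of the differenced sum at once. The sixth power is the cube of the Weyl
  bound for the square, one factor for each of three variables.\<close>

lemma quad_sum_dirichlet:
  fixes A b :: int and Y :: nat and \<alpha> :: real
  assumes "Y \<ge> 1"
  obtains a q :: int where "coprime a q" "0 < q" "q \<le> 2 * int Y"
    "\<bar>2 * A * \<alpha> - a / q\<bar> \<le> 1 / (2 * q * Y)"
    "norm (quad_sum Y b A \<alpha>) ^ 6 \<le>
       1600 ^ 3 * Y ^ 12 / q ^ 3 / (1 + Y\<^sup>2 * \<bar>2 * A * \<alpha> - a / q\<bar>) ^ 3"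
proof -
  define \<theta> where "\<theta> = 2 * A * \<alpha>"
  have "2 * Y > 0" using assms by simp
  from Dirichlet_approx_coprime[OF this] obtain a q
    where aq: "coprime a q" "0 < q" "q \<le> int (2 * Y)" "\<bar>of_int q * \<theta> - of_int a\<bar> < 1 / real (2 * Y)"
    by blast
  have "\<bar>\<theta> - a / q\<bar> = \<bar>(of_int q * \<theta> - of_int a) / q\<bar>"
    using aq(2) by (simp add: diff_divide_distrib)
  also have "\<dots> = \<bar>of_int q * \<theta> - of_int a\<bar> / q"
    using aq(2) by simp
  also have "\<dots> \<le> (1 / real (2 * Y)) / q"
    using aq by (intro divide_right_mono) auto
  finally have \<beta>: "\<bar>\<theta> - a / q\<bar> \<le> 1 / (2 * q * Y)" by (simp add: mult_ac)
  define X where "X = Y\<^sup>2 * \<bar>\<theta> - a / q\<bar>"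
  have X: "X \<ge> 0" by (simp add: X_def)
  have "(norm (quad_sum Y b A \<alpha>))\<^sup>2 \<le>
     4 * Y ^ 3 * (\<Sum>h\<in>{-int Y<..<int Y}. 1 / (1 + Y * dist_int (of_int h * \<theta>))\<^sup>2)"
    using quad_sum_weyl[of Y b A \<alpha>] by (simp add: \<theta>_def)
  also have "\<dots> \<le> 4 * Y ^ 3 * (400 * (Y / q) / (1 + X))"
    unfolding X_def using aq \<beta> assms by (intro mult_left_mono sum_dist_int_major_arc) auto
  also have "\<dots> = 1600 * Y ^ 4 / q / (1 + X)"
    by (simp add: power4_eq_xxxx power3_eq_cube)
  finally have "((norm (quad_sum Y b A \<alpha>))\<^sup>2) ^ 3 \<le> (1600 * Y ^ 4 / q / (1 + X)) ^ 3"
    by (intro power_mono) auto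
  then have "norm (quad_sum Y b A \<alpha>) ^ 6 \<le> 1600 ^ 3 * Y ^ 12 / q ^ 3 / (1 + X) ^ 3"
    by (simp add: power_mult_distrib power_divide flip: power_mult)
  with aq \<beta> show thesis
    by (intro that[of a q]) (auto simp: \<theta>_def X_def)
qed

text \<open>Every sampled frequency is charged to one fraction \<open>a / q\<close>, and all
  fractions in \<open>Q\<close> are then summed. The Weyl bound decays like
  \<open>(1 + X)^(-3)\<close>, the multiplier costs one factor \<open>1 + X\<close>, and what
  remains is summable over \<open>j\<close> with total about \<open>L / Y^2\<close>. The roughly
  \<open>q\<close> numerators turn \<open>q^(-3)\<close> into \<open>q^(-2)\<close>.\<close>

lemma quad_sum_sixth_moment:
  fixes A b :: int and Y L P D J :: nat and \<delta> :: real
  assumes A: "A \<noteq> 0" and Y: "Y \<ge> 1" and L: "Y\<^sup>2 \<le> L" and P: "P \<ge> 1" and J: "J \<ge> 1"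
    and D: "D > 0" "2 * A * fact P dvd int D" and \<delta>: "real (J * D) \<le> \<delta> * Y\<^sup>2" "\<delta> \<ge> 0"
  shows "(\<Sum>j<L. norm (quad_sum Y b A (j / L)) ^ 6 * (norm (1 - avg_exp D J (j / L)))\<^sup>2)
     \<le> 672 * 1600 ^ 3 * \<bar>A\<bar> * L * Y ^ 10 * (\<delta> + 1 / P)"
proof -
  \<comment> \<open>For \<open>q <= P\<close> the shifts are multiples of \<open>2 * A * q\<close>
    and the multiplier itself gains \<delta>. Beyond \<open>P\<close> it is bounded trivially, and
    the gain comes from the tail of the sum of \<open>1 / q^2\<close>.\<close>
  define w where "w = (\<lambda>q::nat. if q \<le> P then \<delta> else 1)"
  define c where "c = (16 * 1600 ^ 3 :: real)"
  define Ab where "Ab = \<bar>A\<bar>"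
  have Ab: "Ab \<ge> 1" using A by (simp add: Ab_def)
  define H where "H = (\<lambda>(q::nat) (a::int) (j::nat).
     c * Y ^ 12 * w q / real q ^ 3 * (1 / (1 + Y\<^sup>2 * \<bar>2 * A * (j / L) - a / q\<bar>)\<^sup>2))"
  \<comment> \<open>The range of numerators comes from \<open>|2 * A * \<alpha>| <= 2 * Ab\<close>
    and an approximation error of at most 1.\<close>
  define Q where "Q = (SIGMA q:{1..2*Y}. {-(3 * Ab * int q)..3 * Ab * int q})"
  have w: "w q \<ge> 0" for q using \<delta> by (simp add: w_def)
  have H: "H q a j \<ge> 0" for q a j
    unfolding H_def c_def using w by (intro mult_nonneg_nonneg divide_nonneg_nonneg) auto
  have Lpos: "real L > 0" using L Y by (cases "L = 0") auto
  have Ypos: "real Y > 0" using Y by simp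
  have finQ: "finite Q" by (simp add: Q_def)
  have "(\<Sum>j<L. norm (quad_sum Y b A (j / L)) ^ 6 * (norm (1 - avg_exp D J (j / L)))\<^sup>2)
      \<le> (\<Sum>j<L. \<Sum>(q,a)\<in>Q. H q a j)"
  proof (rule sum_mono)
    fix j assume "j \<in> {..<L}"
    then have jL: "real j / L \<ge> 0" "real j / L \<le> 1" by auto
    define \<alpha> where "\<alpha> = real j / L"
    obtain a q' :: int where
      aq: "coprime a q'" "0 < q'" "q' \<le> 2 * int Y" "\<bar>2 * A * \<alpha> - a / q'\<bar> \<le> 1 / (2 * q' * Y)"
      and S: "norm (quad_sum Y b A \<alpha>) ^ 6 \<le>
       1600 ^ 3 * Y ^ 12 / q' ^ 3 / (1 + Y\<^sup>2 * \<bar>2 * A * \<alpha> - a / q'\<bar>) ^ 3"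
      by (rule quad_sum_dirichlet[OF Y])
    define q where "q = nat q'"
    have q: "int q = q'" "q \<ge> 1" "q \<le> 2 * Y" using aq by (auto simp: q_def)
    have qr: "real_of_int q' = real q" using q by simp
    define \<beta> where "\<beta> = 2 * A * \<alpha> - a / q"
    define X where "X = Y\<^sup>2 * \<bar>\<beta>\<bar>"
    have X: "X \<ge> 0" by (simp add: X_def)
    have S': "norm (quad_sum Y b A \<alpha>) ^ 6 \<le> 1600 ^ 3 * Y ^ 12 / real q ^ 3 / (1 + X) ^ 3"
      using S by (simp add: X_def \<beta>_def qr)
    have N4: "norm (1 - avg_exp D J \<alpha>) \<le> 2"
    proof (rule norm_1_minus_avg_exp[OF J])
      fix i
      show "norm (1 - unit_exp (\<alpha> * real (i * D))) \<le> 2"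
        using norm_triangle_ineq4[of 1 "unit_exp (\<alpha> * real (i * D))"] by simp
    qed
    have N: "(norm (1 - avg_exp D J \<alpha>))\<^sup>2 \<le> 16 * w q * (1 + X)"
    proof (cases "q \<le> P")
      case True
      obtain D' where D': "int D = 2 * A * fact P * D'" using D(2) by (elim dvdE)
      have "q dvd fact P" using True q by (intro dvd_fact) auto
      then have "int q dvd fact P" by (metis of_nat_dvd_iff of_nat_fact)
      then obtain e where e: "fact P = int q * e" by (elim dvdE)
      have Dr: "real D = 2 * A * (q * e * D')"
        using arg_cong[OF D', of real_of_int] e by simp
      have "norm (1 - avg_exp D J \<alpha>) \<le> 8 * (\<delta> * X)"
      proof (rule norm_1_minus_avg_exp[OF J])
        fix i assume i: "i < J"
        have qa: "2 * A * \<alpha> = a / q + \<beta>" by (simp add: \<beta>_def)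
        have "\<alpha> * real (i * D) = real i * (q * e * D') * (2 * A * \<alpha>)"
          by (simp add: Dr)
        also have "\<dots> = of_int (int i * e * D' * a) + real i * (q * e * D') * \<beta>"
          unfolding qa using q by (simp add: field_simps)
        \<comment> \<open>The rational part of the phase is an integer and disappears; only the
          deviation \<beta> is left.\<close>
        finally have u: "unit_exp (\<alpha> * real (i * D)) = unit_exp (real i * (q * e * D') * \<beta>)"
          by (simp only: unit_exp_add unit_exp_of_int mult_1_left)
        have "1 * \<bar>real_of_int (q * e * D')\<bar> \<le> \<bar>real_of_int (2 * A)\<bar> * \<bar>real_of_int (q * e * D')\<bar>"
          using A by (intro mult_right_mono) auto
        also have "\<dots> = \<bar>real D\<bar>" unfolding Dr by (simp add: abs_mult)
        finally have "\<bar>real_of_int (q * e * D')\<bar> \<le> real D" by simp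
        then have "real i * \<bar>real_of_int (q * e * D')\<bar> * \<bar>\<beta>\<bar> \<le> real J * real D * \<bar>\<beta>\<bar>"
          using i by (intro mult_mono) auto
        also have "\<dots> \<le> \<delta> * Y\<^sup>2 * \<bar>\<beta>\<bar>"
          using \<delta> by (intro mult_right_mono) auto
        finally have "8 * \<bar>real i * (q * e * D') * \<beta>\<bar> \<le> 8 * (\<delta> * X)"
          by (simp add: X_def abs_mult)
        with norm_1_minus_unit_exp_le[of "real i * (q * e * D') * \<beta>"]
        show "norm (1 - unit_exp (\<alpha> * real (i * D))) \<le> 8 * (\<delta> * X)"
          unfolding u by linarith
      qed
      \<comment> \<open>The small bound is used for one factor only and the trivial bound 2 for the
        other. Two small factors would cost \<open>X^2\<close>, and the remaining decay in
        \<open>j\<close> would no longer be summable.\<close>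
      then have "(norm (1 - avg_exp D J \<alpha>))\<^sup>2 \<le> 2 * (8 * (\<delta> * X))"
        unfolding power2_eq_square using N4 by (intro mult_mono) auto
      also have "\<dots> \<le> 16 * \<delta> * (1 + X)" using \<delta> by (simp add: algebra_simps)
      finally show ?thesis using True by (simp add: w_def)
    next
      case False
      have "(norm (1 - avg_exp D J \<alpha>))\<^sup>2 \<le> 2\<^sup>2"
        using N4 by (intro power_mono) auto
      with X False show ?thesis by (simp add: w_def)
    qed
    have "norm (quad_sum Y b A \<alpha>) ^ 6 * (norm (1 - avg_exp D J \<alpha>))\<^sup>2
       \<le> (1600 ^ 3 * Y ^ 12 / real q ^ 3 / (1 + X) ^ 3) * (16 * w q * (1 + X))"
      using S' N X by (intro mult_mono) auto
    also have "\<dots> = c * Y ^ 12 * w q / real q ^ 3 * ((1 + X) / (1 + X) ^ 3)"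
      by (simp add: c_def)
    also have "(1 + X) / (1 + X) ^ 3 = 1 / (1 + X)\<^sup>2"
      using X by (simp add: power3_eq_cube power2_eq_square divide_simps)
    finally have "norm (quad_sum Y b A \<alpha>) ^ 6 * (norm (1 - avg_exp D J \<alpha>))\<^sup>2 \<le> H q a j"
      by (simp add: H_def X_def \<beta>_def \<alpha>_def)
    also have "\<dots> \<le> (\<Sum>(q,a)\<in>Q. H q a j)"
    proof -
      have "\<bar>a / q\<bar> \<le> \<bar>2 * A * \<alpha>\<bar> + \<bar>\<beta>\<bar>" unfolding \<beta>_def by linarith
      moreover have "\<bar>2 * A * \<alpha>\<bar> \<le> 2 * Ab * 1"
        using jL mult_left_mono[of \<alpha> 1 "2 * \<bar>real_of_int A\<bar>"] by (simp add: abs_mult Ab_def \<alpha>_def)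
      moreover have "\<bar>\<beta>\<bar> \<le> 1"
      proof -
        have "1 * 1 \<le> real q * (2 * real Y)" using q Y by (intro mult_mono) auto
        then have "1 / (2 * real q * Y) \<le> 1" using q Y by (simp add: divide_le_eq mult_ac)
        then show ?thesis using aq(4) by (simp add: \<beta>_def qr)
      qed
      ultimately have "\<bar>a / q\<bar> \<le> 3 * Ab" using Ab by simp
      then have "\<bar>real_of_int a\<bar> \<le> 3 * real_of_int Ab * real q" using q(2) by (simp add: field_simps)
      then have "real_of_int \<bar>a\<bar> \<le> real_of_int (3 * Ab * int q)" by simp
      then have "\<bar>a\<bar> \<le> 3 * Ab * int q" by (simp only: of_int_le_iff)
      then have "(q, a) \<in> Q" using q by (auto simp: Q_def)
      then show ?thesis
        using member_le_sum[of "(q,a)" Q "\<lambda>(q,a). H q a j"] H finQ by auto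
    qed
    finally show "norm (quad_sum Y b A (real j / L)) ^ 6 * (norm (1 - avg_exp D J (real j / L)))\<^sup>2
        \<le> (\<Sum>(q,a)\<in>Q. H q a j)" by (simp add: \<alpha>_def)
  qed
  also have "\<dots> = (\<Sum>(q,a)\<in>Q. \<Sum>j<L. H q a j)"
    by (subst sum.swap) (simp add: case_prod_unfold)
  also have "\<dots> \<le> (\<Sum>(q,a)\<in>Q. c * Y ^ 12 * w q / real q ^ 3 * (3 * L / Y\<^sup>2))"
  proof (rule sum_mono)
    fix qa assume "qa \<in> Q"
    obtain q a where qa: "qa = (q, a)" by force
    \<comment> \<open>As a function of \<open>j\<close> the quantity \<open>X\<close> equals
      \<open>B * |j - x|\<close>: consecutive frequencies differ by \<open>1 / L\<close>, and
      \<open>x\<close> is the position of the fraction.\<close>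
    define B where "B = 2 * Ab * Y\<^sup>2 / L"
    define x where "x = a * L / (2 * A * q)"
    have B: "B > 0" using Ab Y Lpos by (simp add: B_def)
    have "q \<ge> 1" using \<open>qa \<in> Q\<close> qa by (auto simp: Q_def)
    have "Y\<^sup>2 * \<bar>2 * A * (real j / L) - a / q\<bar> = B * \<bar>of_int (int j) - x\<bar>" for j :: nat
    proof -
      have "2 * A * (real j / L) - a / q = (2 * A / L) * (real j - x)"
        using A Lpos \<open>q \<ge> 1\<close> by (simp add: x_def field_simps)
      then show ?thesis using Lpos by (simp add: abs_mult B_def Ab_def)
    qed
    then have "(\<Sum>j<L. H q a j) = c * Y ^ 12 * w q / real q ^ 3 * (\<Sum>j<L. 1 / (1 + B * \<bar>of_int (int j) - x\<bar>)\<^sup>2)"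
      unfolding H_def by (simp add: sum_distrib_left)
    also have "(\<Sum>j<L. 1 / (1 + B * \<bar>of_int (int j) - x\<bar>)\<^sup>2) = (\<Sum>j\<in>int ` {..<L}. 1 / (1 + B * \<bar>of_int j - x\<bar>)\<^sup>2)"
      by (subst sum.reindex) auto
    also have "c * Y ^ 12 * w q / real q ^ 3 * \<dots> \<le> c * Y ^ 12 * w q / real q ^ 3 * (2 + 2 / B)"
      using B w by (intro mult_left_mono sum_inverse_square_int) (auto simp: c_def)
    also have "\<dots> \<le> c * Y ^ 12 * w q / real q ^ 3 * (3 * L / Y\<^sup>2)"
    proof (intro mult_left_mono)
      have "2 / B = L / (Ab * Y\<^sup>2)" using Lpos Ab Y by (simp add: B_def)
      also have "\<dots> \<le> L / (1 * Y\<^sup>2)"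
        using Ab Ypos by (intro divide_left_mono mult_right_mono) (auto intro!: mult_pos_pos)
      also have "(2::real) \<le> 2 * L / Y\<^sup>2"
        using L Ypos by (simp add: field_simps flip: of_nat_power)
      then have "2 + L / (1 * Y\<^sup>2) \<le> 3 * L / real (Y\<^sup>2)" by (simp add: add_divide_distrib[symmetric])
      ultimately show "2 + 2 / B \<le> 3 * L / Y\<^sup>2" by simp
    qed (use w in \<open>auto simp: c_def\<close>)
    finally show "(case qa of (q, a) \<Rightarrow> \<Sum>j<L. H q a j)
        \<le> (case qa of (q, a) \<Rightarrow> c * Y ^ 12 * w q / real q ^ 3 * (3 * L / Y\<^sup>2))"
      by (simp add: qa)
  qed
  also have "\<dots> = (\<Sum>q\<in>{1..2*Y}. real_of_int (6 * Ab * int q + 1) * (c * Y ^ 12 * w q / real q ^ 3 * (3 * L / Y\<^sup>2)))"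
    unfolding Q_def using Ab by (subst sum.Sigma[symmetric]) (auto intro!: sum.cong)
  also have "\<dots> \<le> (\<Sum>q\<in>{1..2*Y}. 21 * c * Ab * L * Y ^ 10 * (w q / (real q)\<^sup>2))"
  proof (rule sum_mono)
    fix q assume "q \<in> {1..2*Y}"
    then have q: "real q > 0" "q \<ge> 1" by auto
    have "1 * 1 \<le> Ab * int q" using Ab q by (intro mult_mono) auto
    then have "6 * Ab * int q + 1 \<le> 7 * Ab * int q" by simp
    then have "real_of_int (6 * Ab * int q + 1) \<le> real_of_int (7 * Ab * int q)" by (simp only: of_int_le_iff)
    then have "real_of_int (6 * Ab * int q + 1) * (c * Y ^ 12 * w q / real q ^ 3 * (3 * L / Y\<^sup>2))
       \<le> real_of_int (7 * Ab * int q) * (c * Y ^ 12 * w q / real q ^ 3 * (3 * L / Y\<^sup>2))"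
      using w by (intro mult_right_mono) (auto simp: c_def)
    also have "\<dots> = 21 * c * Ab * L * (real Y ^ 12 / real Y ^ 2) * (w q * (real q / real q ^ 3))"
      by (simp add: mult_ac)
    also have "real Y ^ 12 / real Y ^ 2 = real Y ^ 10"
      using Ypos by (simp add: power_diff[symmetric])
    also have "real q / real q ^ 3 = 1 / (real q)\<^sup>2"
      using q by (simp add: power3_eq_cube power2_eq_square)
    finally show "real_of_int (6 * Ab * int q + 1) * (c * Y ^ 12 * w q / real q ^ 3 * (3 * L / Y\<^sup>2))
       \<le> 21 * c * Ab * L * Y ^ 10 * (w q / (real q)\<^sup>2)" by simp
  qed
  also have "\<dots> = 21 * c * Ab * L * Y ^ 10 * (\<Sum>q\<in>{1..2*Y}. w q / (real q)\<^sup>2)"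
    by (simp only: sum_distrib_left)
  also have "\<dots> \<le> 21 * c * Ab * L * Y ^ 10 * (2 * \<delta> + 1 / P)"
  proof (intro mult_left_mono)
    have "(\<Sum>q\<in>{1..2*Y}. w q / (real q)\<^sup>2) =
        (\<Sum>q\<in>{1..2*Y} \<inter> {..P}. w q / (real q)\<^sup>2) + (\<Sum>q\<in>{1..2*Y} - {..P}. w q / (real q)\<^sup>2)"
      by (rule sum.Int_Diff) auto
    also have "(\<Sum>q\<in>{1..2*Y} \<inter> {..P}. w q / (real q)\<^sup>2) = \<delta> * (\<Sum>q\<in>{1..2*Y} \<inter> {..P}. 1 / (real q)\<^sup>2)"
      unfolding sum_distrib_left by (rule sum.cong) (auto simp: w_def)
    also have "(\<Sum>q\<in>{1..2*Y} \<inter> {..P}. 1 / (real q)\<^sup>2) = (\<Sum>q\<in>int ` ({1..2*Y} \<inter> {..P}). 1 / (of_int q)\<^sup>2)"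
      by (subst sum.reindex) auto
    also have "\<delta> * \<dots> \<le> \<delta> * 2"
      using \<delta> by (intro mult_left_mono sum_inverse_squares_le_2) auto
    also have "(\<Sum>q\<in>{1..2*Y} - {..P}. w q / (real q)\<^sup>2) = (\<Sum>q\<in>{1..2*Y} - {..P}. 1 / (real q)\<^sup>2)"
      by (rule sum.cong) (auto simp: w_def)
    also have "\<dots> \<le> 1 / P"
      using P by (intro sum_inverse_squares_tail) auto
    finally show "(\<Sum>q\<in>{1..2*Y}. w q / (real q)\<^sup>2) \<le> 2 * \<delta> + 1 / P" by simp
  qed (use Ab in \<open>auto simp: c_def\<close>)
  also have "\<dots> \<le> 21 * c * Ab * L * Y ^ 10 * (2 * (\<delta> + 1 / P))"
    using Ab P by (intro mult_left_mono) (auto simp: c_def divide_right_mono)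
  also have "\<dots> = 672 * 1600 ^ 3 * \<bar>A\<bar> * L * Y ^ 10 * (\<delta> + 1 / P)"
    unfolding c_def Ab_def by (simp add: algebra_simps)
  finally show ?thesis .
qed

section \<open>Variance of the representation count\<close>

definition diag_quad :: "nat \<Rightarrow> (nat \<Rightarrow> int) \<Rightarrow> (nat \<Rightarrow> int) \<Rightarrow> (nat \<Rightarrow> int) \<Rightarrow> int" where
  "diag_quad \<nu> b A t = (\<Sum>i<\<nu>. b i * t i + A i * (t i)\<^sup>2)"

text \<open>A coordinate is a pair standing for the value \<open>t = x + y\<close>. Counting pairs
  instead of values is what puts the triangular weight on \<open>t\<close>.\<close>

definition pair_box :: "nat \<Rightarrow> nat \<Rightarrow> (nat \<Rightarrow> int \<times> int) set" where
  "pair_box \<nu> Y = (\<Pi>\<^sub>E i\<in>{..<\<nu>}. {0..<int Y} \<times> {0..<int Y})"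

definition pair_quad :: "nat \<Rightarrow> (nat \<Rightarrow> int) \<Rightarrow> (nat \<Rightarrow> int) \<Rightarrow> (nat \<Rightarrow> int \<times> int) \<Rightarrow> int" where
  "pair_quad \<nu> b A z = diag_quad \<nu> b A (\<lambda>i. fst (z i) + snd (z i))"

definition rep_count :: "nat \<Rightarrow> (nat \<Rightarrow> int) \<Rightarrow> (nat \<Rightarrow> int) \<Rightarrow> nat \<Rightarrow> int \<Rightarrow> nat" where
  "rep_count \<nu> b A Y m = card {z\<in>pair_box \<nu> Y. pair_quad \<nu> b A z = m}"

lemma finite_pair_box [simp]: "finite (pair_box \<nu> Y)"
  unfolding pair_box_def by (intro finite_PiE) auto

lemma sum_unit_exp_pair_quad:
  "(\<Sum>z\<in>pair_box \<nu> Y. unit_exp (\<alpha> * of_int (pair_quad \<nu> b A z))) =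
     (\<Prod>i<\<nu>. quad_sum Y (b i) (A i) \<alpha>)"
proof -
  define g where "g = (\<lambda>i (p::int\<times>int). unit_exp (\<alpha> * of_int (b i * (fst p + snd p) + A i * (fst p + snd p)\<^sup>2)))"
  have "(\<Prod>i<\<nu>. quad_sum Y (b i) (A i) \<alpha>) = (\<Prod>i<\<nu>. \<Sum>p\<in>{0..<int Y} \<times> {0..<int Y}. g i p)"
    unfolding quad_sum_def g_def by (simp add: sum.cartesian_product case_prod_unfold)
  also have "\<dots> = (\<Sum>z\<in>pair_box \<nu> Y. \<Prod>i<\<nu>. g i (z i))"
    unfolding pair_box_def by (rule prod_sum_PiE) auto
  also have "\<dots> = (\<Sum>z\<in>pair_box \<nu> Y. unit_exp (\<alpha> * of_int (pair_quad \<nu> b A z)))"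
    by (intro sum.cong) (simp_all add: g_def pair_quad_def diag_quad_def unit_exp_sum[symmetric] sum_distrib_left)
  finally show ?thesis ..
qed

lemma norm_quad_sum_le: "norm (quad_sum Y b A \<alpha>) \<le> (real Y)\<^sup>2"
proof -
  have "norm (quad_sum Y b A \<alpha>) \<le> (\<Sum>x\<in>{0..<int Y}. \<Sum>y\<in>{0..<int Y}. 1)"
    unfolding quad_sum_def by (intro order_trans[OF norm_sum] sum_mono) simp
  then show ?thesis by (simp add: power2_eq_square)
qed

lemma unit_exp_eq_1_iff: "unit_exp x = 1 \<longleftrightarrow> x \<in> \<int>"
proof
  assume "unit_exp x = 1"
  then have "dist_int x = 0"
    using norm_1_minus_unit_exp[of x] dist_int_nonneg[of x] by simp
  then have "x = of_int (round x)" by (simp add: dist_int_def)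
  then show "x \<in> \<int>" by (metis Ints_of_int)
qed (auto elim: Ints_cases)

lemma unit_exp_orthogonality:
  assumes "L > 0" "\<bar>d\<bar> < int L"
  shows "(\<Sum>j<L. unit_exp (real j / L * of_int d)) = (if d = 0 then of_nat L else 0)"
proof (cases "d = 0")
  case False
  define x where "x = of_int d / real L"
  have ne: "unit_exp x \<noteq> 1"
  proof
    assume "unit_exp x = 1"
    then obtain n where "x = of_int n" by (auto simp: unit_exp_eq_1_iff elim: Ints_cases)
    then have "real_of_int d = of_int (n * int L)"
      using assms by (simp add: x_def field_simps)
    then have "d = n * int L" by (simp only: of_int_eq_iff)
    then have "int L dvd d" by simp
    then have "\<bar>int L\<bar> \<le> \<bar>d\<bar>" using False by (rule dvd_imp_le_int[rotated])
    then show False using assms by simp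
  qed
  have "unit_exp x ^ L = unit_exp (of_int d)"
    using assms by (simp add: unit_exp_mult_nat[symmetric] x_def)
  then have 1: "unit_exp x ^ L = 1" by simp
  have "(\<Sum>j<L. unit_exp (real j / L * of_int d)) = (\<Sum>j<L. unit_exp x ^ j)"
    by (intro sum.cong) (simp_all add: unit_exp_mult_nat[symmetric] x_def mult.commute)
  moreover have "(1 - unit_exp x) * (\<Sum>j<L. unit_exp x ^ j) = 0"
    by (simp add: one_diff_power_eq[symmetric] 1)
  ultimately show ?thesis using ne False by simp
qed simp

text \<open>Sampling at \<open>j / L\<close> is exact: two points of a window of length
  \<open>L\<close> differ by less than \<open>L\<close>, so orthogonality isolates the diagonal. A
  finite sum thus replaces the integral over the circle.\<close>

lemma discrete_parseval:
  fixes u :: "int \<Rightarrow> real"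
  assumes "L > 0"
  shows "(\<Sum>m\<in>{lo..<lo + int L}. (u m)\<^sup>2) =
    (\<Sum>j<L. (norm (\<Sum>m\<in>{lo..<lo + int L}. u m * unit_exp (real j / L * of_int m)))\<^sup>2) / L"
proof -
  let ?W = "{lo..<lo + int L}"
  have "complex_of_real (\<Sum>j<L. (norm (\<Sum>m\<in>?W. u m * unit_exp (real j / L * of_int m)))\<^sup>2)
     = (\<Sum>j<L. \<Sum>m\<in>?W. \<Sum>m'\<in>?W. (u m * unit_exp (real j / L * of_int m)) * (u m' * unit_exp (- (real j / L * of_int m'))))"
    by (simp add: complex_norm_square sum_product cnj_unit_exp del: of_real_power)
  also have "\<dots> = (\<Sum>j<L. \<Sum>m\<in>?W. \<Sum>m'\<in>?W. (u m * u m') * unit_exp (real j / L * of_int (m - m')))"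
  proof (intro sum.cong refl)
    fix j m m'
    have "unit_exp (real j / L * of_int (m - m')) = unit_exp (real j / L * of_int m) * unit_exp (- (real j / L * of_int m'))"
      unfolding unit_exp_add[symmetric] by (rule arg_cong[where f = unit_exp]) (simp add: right_diff_distrib)
    then show "(u m * unit_exp (real j / L * of_int m)) * (u m' * unit_exp (- (real j / L * of_int m'))) =
       (u m * u m') * unit_exp (real j / L * of_int (m - m'))" by simp
  qed
  also have "\<dots> = (\<Sum>m\<in>?W. \<Sum>j<L. \<Sum>m'\<in>?W. (u m * u m') * unit_exp (real j / L * of_int (m - m')))"
    by (rule sum.swap)
  also have "\<dots> = (\<Sum>m\<in>?W. \<Sum>m'\<in>?W. \<Sum>j<L. (u m * u m') * unit_exp (real j / L * of_int (m - m')))"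
    by (intro sum.cong refl) (rule sum.swap)
  also have "\<dots> = (\<Sum>m\<in>?W. \<Sum>m'\<in>?W. (u m * u m') * (if m = m' then complex_of_nat L else 0))"
  proof (intro sum.cong refl)
    fix m m' assume "m \<in> ?W" "m' \<in> ?W"
    then have "\<bar>m - m'\<bar> < int L" by auto
    from unit_exp_orthogonality[OF assms this]
    show "(\<Sum>j<L. (u m * u m') * unit_exp (real j / L * of_int (m - m'))) = (u m * u m') * (if m = m' then complex_of_nat L else 0)"
      by (simp only: sum_distrib_left[symmetric]) simp
  qed
  also have "\<dots> = (\<Sum>m\<in>?W. complex_of_real ((u m)\<^sup>2 * L))"
    by (intro sum.cong refl) (simp add: power2_eq_square if_distrib[of "\<lambda>x. _ * x"] cong: if_cong)
  also have "\<dots> = complex_of_real ((\<Sum>m\<in>?W. (u m)\<^sup>2) * L)"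
    by (simp add: sum_distrib_right)
  finally have "(\<Sum>j<L. (norm (\<Sum>m\<in>?W. u m * unit_exp (real j / L * of_int m)))\<^sup>2) = (\<Sum>m\<in>?W. (u m)\<^sup>2) * L"
    by (simp only: of_real_eq_iff)
  then show ?thesis using assms by (simp add: field_simps)
qed

lemma sum_card_fibre_mult:
  fixes f :: "int \<Rightarrow> complex"
  assumes "finite Z" "finite W" "\<And>z. z \<in> Z \<Longrightarrow> G z \<in> W"
  shows "(\<Sum>m\<in>W. of_nat (card {z\<in>Z. G z = m}) * f m) = (\<Sum>z\<in>Z. f (G z))"
proof -
  have "(\<Sum>z\<in>Z. f (G z)) = (\<Sum>m\<in>W. \<Sum>z | z \<in> Z \<and> G z = m. f (G z))"
    by (rule sum.group[symmetric]) (use assms in auto)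
  also have "\<dots> = (\<Sum>m\<in>W. of_nat (card {z\<in>Z. G z = m}) * f m)"
    by (intro sum.cong) simp_all
  finally show ?thesis ..
qed

lemma amgm3:
  fixes x y z :: real
  assumes "x \<ge> 0" "y \<ge> 0" "z \<ge> 0"
  shows "x * y * z \<le> (x ^ 3 + y ^ 3 + z ^ 3) / 3"
proof -
  have "x ^ 3 + y ^ 3 + z ^ 3 - 3 * (x * y * z) = (x + y + z) * ((x - y)\<^sup>2 + (y - z)\<^sup>2 + (z - x)\<^sup>2) / 2"
    by (simp add: power2_eq_square power3_eq_cube algebra_simps)
  also have "\<dots> \<ge> 0" using assms by simp
  finally show ?thesis by simp
qed

text \<open>The inequality of arithmetic and geometric means separates three of the variables, so
  only sixth powers of single sums have to be estimated. Each further variable is given its trivial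
  bound \<open>Y^2\<close>, squared.\<close>

lemma prod_quad_sum_bound:
  assumes "\<nu> \<ge> 3"
  shows "(norm (\<Prod>i<\<nu>. quad_sum Y (b i) (A i) \<alpha>))\<^sup>2 \<le>
     real Y ^ (4 * (\<nu> - 3)) * (\<Sum>i<3. norm (quad_sum Y (b i) (A i) \<alpha>) ^ 6)"
proof -
  define s where "s = (\<lambda>i. norm (quad_sum Y (b i) (A i) \<alpha>))"
  have s: "s i \<ge> 0" for i by (simp add: s_def)
  have "(norm (\<Prod>i<\<nu>. quad_sum Y (b i) (A i) \<alpha>))\<^sup>2 = (\<Prod>i<\<nu>. (s i)\<^sup>2)"
    by (simp add: s_def prod_norm[symmetric] prod_power_distrib)
  also have "\<dots> = (\<Prod>i\<in>{..<3} \<union> {3..<\<nu>}. (s i)\<^sup>2)"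
    using assms by (intro prod.cong) auto
  also have "(\<Prod>i\<in>{..<3} \<union> {3..<\<nu>}. (s i)\<^sup>2) = (\<Prod>i<3. (s i)\<^sup>2) * (\<Prod>i\<in>{3..<\<nu>}. (s i)\<^sup>2)"
    by (rule prod.union_disjoint) auto
  also have "\<dots> \<le> (\<Sum>i<3. s i ^ 6) * real Y ^ (4 * (\<nu> - 3))"
  proof (intro mult_mono)
    have "(\<Prod>i<3. (s i)\<^sup>2) = (s 0)\<^sup>2 * (s 1)\<^sup>2 * (s 2)\<^sup>2"
      by (simp add: numeral_3_eq_3 numeral_2_eq_2)
    also have "\<dots> \<le> (((s 0)\<^sup>2) ^ 3 + ((s 1)\<^sup>2) ^ 3 + ((s 2)\<^sup>2) ^ 3) / 3"
      by (rule amgm3) auto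
    also have "\<dots> = (\<Sum>i<3. s i ^ 6) / 3"
      by (simp add: eval_nat_numeral)
    also have "\<dots> \<le> (\<Sum>i<3. s i ^ 6)"
      using s by (simp add: sum_nonneg)
    finally show "(\<Prod>i<3. (s i)\<^sup>2) \<le> (\<Sum>i<3. s i ^ 6)" .
    have "(\<Prod>i\<in>{3..<\<nu>}. (s i)\<^sup>2) \<le> (\<Prod>i\<in>{3..<\<nu>}. ((real Y)\<^sup>2)\<^sup>2)"
      unfolding s_def by (intro prod_mono conjI power_mono norm_quad_sum_le) auto
    also have "\<dots> = real Y ^ (4 * (\<nu> - 3))"
      by (simp flip: power_mult)
    finally show "(\<Prod>i\<in>{3..<\<nu>}. (s i)\<^sup>2) \<le> real Y ^ (4 * (\<nu> - 3))" .
  qed (auto intro: sum_nonneg prod_nonneg simp: s)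
  finally show ?thesis by (simp add: s_def mult.commute)
qed

text \<open>Counts of order \<open>Y^(2\<nu> - 2)\<close> on a range of about \<open>Y^2\<close>
  integers have a second moment of order \<open>Y^(4\<nu> - 2)\<close>; the bound improves on this
  by the factor \<open>\<delta> + 1 / P\<close>.\<close>

lemma rep_count_variance:
  fixes A b :: "nat \<Rightarrow> int" and Y P D J \<nu> :: nat and \<delta> :: real and F :: "int set"
  assumes \<nu>: "\<nu> \<ge> 3" and A: "\<And>i. i < 3 \<Longrightarrow> A i \<noteq> 0" and Y: "Y \<ge> 1" and P: "P \<ge> 1" and J: "J \<ge> 1"
    and D: "D > 0" "\<And>i. i < 3 \<Longrightarrow> 2 * A i * fact P dvd int D"
    and \<delta>: "real (J * D) \<le> \<delta> * Y\<^sup>2" "\<delta> \<ge> 0" and F: "finite F"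
  shows "(\<Sum>m\<in>F. (real (rep_count \<nu> b A Y m) - (\<Sum>i<J. real (rep_count \<nu> b A Y (m - int (i * D)))) / J)\<^sup>2)
     \<le> 672 * 1600 ^ 3 * (\<Sum>i<3. \<bar>A i\<bar>) * real Y ^ (4 * \<nu> - 2) * (\<delta> + 1 / P)"
proof -
  let ?Z = "pair_box \<nu> Y" and ?G = "pair_quad \<nu> b A"
  let ?r = "rep_count \<nu> b A Y"
  define u where "u = (\<lambda>m. real (?r m) - (\<Sum>i<J. real (?r (m - int (i * D)))) / J)"
  \<comment> \<open>The window for Parseval has to contain \<open>F\<close> and every shifted value
    of the polynomial, so that the transform sees all representations. Adding \<open>Y^2\<close> to
    its length meets the condition of the sixth moment bound.\<close>
  define V where "V = F \<union> (\<lambda>(z,i). ?G z + int (i * D)) ` (?Z \<times> {..<J})"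
  have "finite V" using F by (simp add: V_def)
  define B where "B = Max (abs ` V)"
  have B: "\<bar>x\<bar> \<le> B" if "x \<in> V" for x
    unfolding B_def using that \<open>finite V\<close> by (intro Max_ge) auto
  define lo where "lo = - \<bar>B\<bar>"
  define L where "L = nat (2 * \<bar>B\<bar> + 1) + Y\<^sup>2"
  let ?W = "{lo..<lo + int L}"
  have L: "L > 0" "Y\<^sup>2 \<le> L" "2 * \<bar>B\<bar> + 1 \<le> int L" by (auto simp: L_def)
  have inW: "x \<in> ?W" if "\<bar>x\<bar> \<le> B" for x
    using that L by (auto simp: lo_def)
  have F': "F \<subseteq> ?W" using B inW unfolding V_def by blast
  have ZW: "?G z + int (i * D) \<in> ?W" if "z \<in> ?Z" "i < J" for z i
  proof (intro inW B)
    show "?G z + int (i * D) \<in> V"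
      unfolding V_def using that by (intro UnI2 rev_image_eqI[of "(z, i)"]) auto
  qed
  \<comment> \<open>Averaging over translates becomes multiplication by \<open>avg_exp\<close>, and
    the transform of the count factors over the variables.\<close>
  have hat: "(\<Sum>m\<in>?W. u m * unit_exp (\<alpha> * of_int m)) =
      (1 - avg_exp D J \<alpha>) * (\<Prod>i<\<nu>. quad_sum Y (b i) (A i) \<alpha>)" for \<alpha>
  proof -
    define S where "S = (\<Sum>z\<in>?Z. unit_exp (\<alpha> * of_int (?G z)))"
    have 1: "(\<Sum>m\<in>?W. of_nat (?r (m - int (i * D))) * unit_exp (\<alpha> * of_int m)) = unit_exp (\<alpha> * real (i * D)) * S"
      if "i < J" for i
    proof -
      have e: "{z \<in> ?Z. ?G z = m - int (i * D)} = {z \<in> ?Z. ?G z + int (i * D) = m}" for m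
        by auto
      have "(\<Sum>m\<in>?W. of_nat (?r (m - int (i * D))) * unit_exp (\<alpha> * of_int m)) =
         (\<Sum>z\<in>?Z. unit_exp (\<alpha> * of_int (?G z + int (i * D))))"
        unfolding rep_count_def e using that ZW by (intro sum_card_fibre_mult) auto
      also have "\<dots> = (\<Sum>z\<in>?Z. unit_exp (\<alpha> * real (i * D)) * unit_exp (\<alpha> * of_int (?G z)))"
        by (intro sum.cong refl) (simp add: ring_distribs add.commute flip: unit_exp_add)
      finally show ?thesis by (simp add: S_def sum_distrib_left)
    qed
    have "(\<Sum>m\<in>?W. u m * unit_exp (\<alpha> * of_int m)) =
       (\<Sum>m\<in>?W. of_nat (?r m) * unit_exp (\<alpha> * of_int m)) -
       (\<Sum>m\<in>?W. \<Sum>i<J. of_nat (?r (m - int (i * D))) * unit_exp (\<alpha> * of_int m)) / of_nat J"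
      unfolding u_def
      by (simp add: left_diff_distrib sum_subtractf sum_distrib_right sum_divide_distrib)
    also have "(\<Sum>m\<in>?W. \<Sum>i<J. of_nat (?r (m - int (i * D))) * unit_exp (\<alpha> * of_int m))
       = (\<Sum>i<J. \<Sum>m\<in>?W. of_nat (?r (m - int (i * D))) * unit_exp (\<alpha> * of_int m))"
      by (rule sum.swap)
    also have "\<dots> = (\<Sum>i<J. unit_exp (\<alpha> * real (i * D)) * S)"
      by (intro sum.cong refl 1) auto
    also have "(\<Sum>m\<in>?W. of_nat (?r m) * unit_exp (\<alpha> * of_int m)) = S"
      using 1[of 0] J by simp
    also have "S - (\<Sum>i<J. unit_exp (\<alpha> * real (i * D)) * S) / of_nat J = (1 - avg_exp D J \<alpha>) * S"
      by (simp add: avg_exp_def left_diff_distrib sum_distrib_right)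
    finally show ?thesis unfolding S_def sum_unit_exp_pair_quad .
  qed
  have "(\<Sum>m\<in>F. (u m)\<^sup>2) \<le> (\<Sum>m\<in>?W. (u m)\<^sup>2)"
    using F' by (intro sum_mono2) auto
  also have "\<dots> = (\<Sum>j<L. (norm ((1 - avg_exp D J (real j / L)) * (\<Prod>i<\<nu>. quad_sum Y (b i) (A i) (real j / L))))\<^sup>2) / L"
    by (subst discrete_parseval[OF L(1)]) (simp only: hat)
  also have "\<dots> \<le> (\<Sum>j<L. real Y ^ (4 * (\<nu> - 3)) *
      (\<Sum>i<3. norm (quad_sum Y (b i) (A i) (real j / L)) ^ 6 * (norm (1 - avg_exp D J (real j / L)))\<^sup>2)) / L"
  proof (intro divide_right_mono sum_mono)
    fix j
    let ?a = "real j / L"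
    have "(norm ((1 - avg_exp D J ?a) * (\<Prod>i<\<nu>. quad_sum Y (b i) (A i) ?a)))\<^sup>2
        = (norm (1 - avg_exp D J ?a))\<^sup>2 * (norm (\<Prod>i<\<nu>. quad_sum Y (b i) (A i) ?a))\<^sup>2"
      by (simp only: norm_mult power_mult_distrib)
    also have "\<dots> \<le> (norm (1 - avg_exp D J ?a))\<^sup>2 * (real Y ^ (4 * (\<nu> - 3)) * (\<Sum>i<3. norm (quad_sum Y (b i) (A i) ?a) ^ 6))"
      by (intro mult_left_mono prod_quad_sum_bound \<nu>) auto
    also have "\<dots> = real Y ^ (4 * (\<nu> - 3)) *
      (\<Sum>i<3. norm (quad_sum Y (b i) (A i) ?a) ^ 6 * (norm (1 - avg_exp D J ?a))\<^sup>2)"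
      by (simp add: sum_distrib_right[symmetric])
    finally show "(norm ((1 - avg_exp D J ?a) * (\<Prod>i<\<nu>. quad_sum Y (b i) (A i) ?a)))\<^sup>2 \<le> \<dots>" .
  qed simp
  also have "\<dots> = real Y ^ (4 * (\<nu> - 3)) * (\<Sum>i<3. \<Sum>j<L. norm (quad_sum Y (b i) (A i) (real j / L)) ^ 6 * (norm (1 - avg_exp D J (real j / L)))\<^sup>2) / L"
    by (subst sum.swap) (simp add: sum_distrib_left[symmetric])
  also have "\<dots> \<le> real Y ^ (4 * (\<nu> - 3)) * (\<Sum>i<3. 672 * 1600 ^ 3 * \<bar>A i\<bar> * L * Y ^ 10 * (\<delta> + 1 / P)) / L"
    using A D \<delta> Y P J L by (intro divide_right_mono mult_left_mono sum_mono quad_sum_sixth_moment) auto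
  also have "(\<Sum>i<3. 672 * 1600 ^ 3 * \<bar>A i\<bar> * L * Y ^ 10 * (\<delta> + 1 / P)) =
      672 * 1600 ^ 3 * (\<Sum>i<3. \<bar>A i\<bar>) * L * Y ^ 10 * (\<delta> + 1 / P)"
    by (simp add: sum_distrib_left sum_distrib_right)
  also have "real Y ^ (4 * (\<nu> - 3)) * (672 * 1600 ^ 3 * (\<Sum>i<3. \<bar>A i\<bar>) * L * Y ^ 10 * (\<delta> + 1 / P)) / L
     = 672 * 1600 ^ 3 * (\<Sum>i<3. \<bar>A i\<bar>) * (real Y ^ (4 * (\<nu> - 3)) * real Y ^ 10) * (\<delta> + 1 / P)"
    using L by simp
  also have "real Y ^ (4 * (\<nu> - 3)) * real Y ^ 10 = real Y ^ (4 * \<nu> - 2)"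
    unfolding power_add[symmetric] using \<nu> by (intro arg_cong[where f = "\<lambda>k. real Y ^ k"]) simp
  finally show ?thesis by (simp add: u_def)
qed

section \<open>Solutions modulo integers\<close>

lemma card_quadratic_roots_le:
  fixes p u v w :: int
  assumes "prime p" "\<not> p dvd u"
  shows "card {t\<in>{0..<p}. p dvd (u * t\<^sup>2 + v * t + w)} \<le> 2"
proof (cases "{t\<in>{0..<p}. p dvd (u * t\<^sup>2 + v * t + w)} = {}")
  case False
  then obtain r where r: "r \<in> {0..<p}" "p dvd (u * r\<^sup>2 + v * r + w)" by auto
  have p0: "p > 0" using assms prime_gt_0_int by blast
  have "coprime u p" using assms by (simp add: prime_imp_coprime coprime_commute)
  then obtain u' where u': "[u * u' = 1] (mod p)" using cong_solve_coprime_int by blast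
  have "{t\<in>{0..<p}. p dvd (u * t\<^sup>2 + v * t + w)} \<subseteq> {r, (- r - v * u') mod p}"
  proof
    fix t assume "t \<in> {t\<in>{0..<p}. p dvd (u * t\<^sup>2 + v * t + w)}"
    then have t: "t \<in> {0..<p}" "p dvd (u * t\<^sup>2 + v * t + w)" by auto
    \<comment> \<open>The difference of two values has the factor \<open>t - r\<close>, so any other
      root is determined by \<open>r\<close>.\<close>
    have "p dvd (u * t\<^sup>2 + v * t + w) - (u * r\<^sup>2 + v * r + w)"
      using t r by (intro dvd_diff)
    also have "(u * t\<^sup>2 + v * t + w) - (u * r\<^sup>2 + v * r + w) = (t - r) * (u * (t + r) + v)"
      by (simp add: algebra_simps power2_eq_square)
    finally consider "p dvd t - r" | "p dvd u * (t + r) + v"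
      using assms prime_dvd_mult_iff by blast
    then show "t \<in> {r, (- r - v * u') mod p}"
    proof cases
      case 1
      then have "t mod p = r mod p" by (simp add: mod_eq_dvd_iff)
      then show ?thesis using t r by simp
    next
      case 2
      have "[u' * (u * (t + r) + v) = 0] (mod p)"
        using 2 by (simp add: cong_0_iff)
      moreover have "[(u * u') * (t + r) + v * u' = 1 * (t + r) + v * u'] (mod p)"
        by (intro cong_add cong_mult u' cong_refl)
      ultimately have "[1 * (t + r) + v * u' = 0] (mod p)"
        by (metis (no_types, opaque_lifting) cong_sym cong_trans distrib_left mult.assoc mult.commute)
      then have "[t = - r - v * u'] (mod p)"
        by (simp add: cong_iff_dvd_diff algebra_simps)
      then have "t = (- r - v * u') mod p" using t by (simp add: cong_def)
      then show ?thesis by simp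
    qed
  qed
  then have "card {t\<in>{0..<p}. p dvd (u * t\<^sup>2 + v * t + w)} \<le> card {r, (- r - v * u') mod p}"
    by (intro card_mono) auto
  also have "\<dots> \<le> 2" by (simp add: card_insert_if)
  finally show ?thesis .
next
  case True
  then show ?thesis by (simp only: card.empty)
qed

text \<open>Pigeonhole: with \<open>p = 2 * h + 1\<close>, the numbers \<open>0, ..., h\<close>
  represent every residue once up to sign, so \<open>s^2\<close> and \<open>e - d * t^2\<close> each
  take \<open>h + 1\<close> distinct values among \<open>p\<close> residues.\<close>

lemma sum_of_two_squares_mod:
  fixes p d e :: int
  assumes p: "prime p" "p > 2" and d: "\<not> p dvd d"
  obtains s t where "[s\<^sup>2 + d * t\<^sup>2 = e] (mod p)"
proof -
  define h where "h = (p - 1) div 2"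
  have "odd p" using p prime_odd_int by blast
  then have h: "p = 2 * h + 1" by (auto simp: h_def elim!: oddE)
  have h0: "h \<ge> 0" using p h by simp
  have inj: "s = t" if "s \<in> {0..h}" "t \<in> {0..h}" "p dvd s\<^sup>2 - t\<^sup>2" for s t
  proof -
    have "p dvd (s - t) * (s + t)" using that(3) by (simp add: power2_eq_square algebra_simps)
    then consider "p dvd s - t" | "p dvd s + t" using p prime_dvd_mult_iff by blast
    then show ?thesis
    proof cases
      case 1
      show ?thesis
      proof (rule ccontr)
        assume "s \<noteq> t"
        then have "\<bar>p\<bar> \<le> \<bar>s - t\<bar>" using 1 by (intro dvd_imp_le_int) auto
        then show False using that h by auto
      qed
    next
      case 2
      show ?thesis
      proof (rule ccontr)
        assume "s \<noteq> t"
        then have "s + t \<noteq> 0" using that by auto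
        then have "\<bar>p\<bar> \<le> \<bar>s + t\<bar>" using 2 by (intro dvd_imp_le_int) auto
        then show False using that h by auto
      qed
    qed
  qed
  let ?S = "(\<lambda>s. s\<^sup>2 mod p) ` {0..h}" and ?T = "(\<lambda>t. (e - d * t\<^sup>2) mod p) ` {0..h}"
  have "inj_on (\<lambda>s. s\<^sup>2 mod p) {0..h}"
    by (rule inj_onI) (auto intro: inj simp: mod_eq_dvd_iff)
  then have S: "card ?S = nat (h + 1)" by (simp add: card_image)
  have "inj_on (\<lambda>t. (e - d * t\<^sup>2) mod p) {0..h}"
  proof (rule inj_onI)
    fix x y assume xy: "x \<in> {0..h}" "y \<in> {0..h}" "(e - d * x\<^sup>2) mod p = (e - d * y\<^sup>2) mod p"
    then have "p dvd (e - d * x\<^sup>2) - (e - d * y\<^sup>2)" by (simp add: mod_eq_dvd_iff)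
    then have "p dvd d * (y\<^sup>2 - x\<^sup>2)" by (simp add: algebra_simps)
    then have "p dvd y\<^sup>2 - x\<^sup>2" using p d prime_dvd_mult_iff by blast
    then show "x = y" using xy inj by metis
  qed
  then have T: "card ?T = nat (h + 1)" by (simp add: card_image)
  have "?S \<inter> ?T \<noteq> {}"
  proof
    assume "?S \<inter> ?T = {}"
    then have "card (?S \<union> ?T) = nat (h + 1) + nat (h + 1)"
      using S T by (subst card_Un_disjoint) auto
    moreover have "card (?S \<union> ?T) \<le> card {0..<p}"
      using p by (intro card_mono) auto
    ultimately show False using h h0 by simp
  qed
  then obtain s t where "s\<^sup>2 mod p = (e - d * t\<^sup>2) mod p" by auto
  then have "[s\<^sup>2 + d * t\<^sup>2 = e] (mod p)"
    by (simp add: cong_def mod_eq_dvd_iff algebra_simps)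
  then show thesis by (rule that)
qed

text \<open>Multiplication by an element of norm \<open>s\<^sup>2 + d t\<^sup>2\<close>, where \<open>d = b / a\<close>, permutes the level sets of
  \<open>a x\<^sup>2 + b y\<^sup>2\<close>. Every unit is such a norm, so all nonzero levels have the same number of points.\<close>

lemma card_conic_ge:
  fixes p a b c :: int
  assumes p: "prime p" "p > 2" and ab: "\<not> p dvd a" "\<not> p dvd b" and c: "\<not> p dvd c"
  shows "p - 1 \<le> int (card {(x,y)\<in>{0..<p}\<times>{0..<p}. p dvd (a * x\<^sup>2 + b * y\<^sup>2 - c)})"
proof -
  define N where "N = (\<lambda>c. {(x,y)\<in>{0..<p}\<times>{0..<p}. p dvd (a * x\<^sup>2 + b * y\<^sup>2 - c)})"
  have p0: "p > 0" using p by simp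
  have finN: "finite (N c)" for c
    unfolding N_def by (rule finite_subset[of _ "{0..<p}\<times>{0..<p}"]) auto
  have unit: "\<exists>u. [z * u = 1] (mod p)" if "\<not> p dvd z" for z
    using that p by (intro cong_solve_coprime_int) (simp add: prime_imp_coprime coprime_commute)
  obtain a' where a': "[a * a' = 1] (mod p)" using unit ab by blast
  define d where "d = b * a'"
  have da: "[a * d = b] (mod p)"
    using cong_mult[OF cong_refl[of b] a'] by (simp add: d_def mult_ac)
  have pd: "\<not> p dvd d"
  proof
    assume "p dvd d"
    then have "[a * d = 0] (mod p)" by (simp add: cong_0_iff)
    then have "[b = 0] (mod p)" using da cong_sym cong_trans by blast
    then show False using ab by (simp add: cong_0_iff)
  qed
  have le: "card (N c1) \<le> card (N c2)" if c12: "\<not> p dvd c1" "\<not> p dvd c2" for c1 c2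
  proof -
    obtain c1' where c1': "[c1 * c1' = 1] (mod p)" using unit c12 by blast
    obtain s t where st: "[s\<^sup>2 + d * t\<^sup>2 = c2 * c1'] (mod p)"
      using sum_of_two_squares_mod[OF p pd] by blast
    define n where "n = s\<^sup>2 + d * t\<^sup>2"
    have nc: "[n * c1 = c2] (mod p)"
    proof -
      have "[n * c1 = c2 * c1' * c1] (mod p)" using st unfolding n_def by (intro cong_mult cong_refl)
      moreover have "[c2 * (c1 * c1') = c2 * 1] (mod p)" using c1' by (intro cong_mult cong_refl)
      ultimately show ?thesis by (metis (no_types, opaque_lifting) cong_trans mult.assoc mult.commute mult_1_right)
    qed
    have pn: "\<not> p dvd n"
    proof
      assume "p dvd n"
      then have "[n * c1 = 0] (mod p)" by (simp add: cong_0_iff)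
      then have "[c2 = 0] (mod p)" using nc cong_sym cong_trans by blast
      then show False using c12 by (simp add: cong_0_iff)
    qed
    \<comment> \<open>This is multiplication of \<open>x + y * sqrt (-d)\<close> by
      \<open>s + t * sqrt (-d)\<close>.\<close>
    define f where "f = (\<lambda>(x,y). ((s * x - d * t * y) mod p, (t * x + s * y) mod p))"
    have "inj_on f (N c1)"
    proof (rule inj_onI)
      fix w z assume wz: "w \<in> N c1" "z \<in> N c1" "f w = f z"
      obtain x y x' y' where e: "w = (x,y)" "z = (x',y')" by force
      have r: "x \<in> {0..<p}" "y \<in> {0..<p}" "x' \<in> {0..<p}" "y' \<in> {0..<p}"
        using wz e by (auto simp: N_def)
      have 1: "p dvd (s * x - d * t * y) - (s * x' - d * t * y')"
        and 2: "p dvd (t * x + s * y) - (t * x' + s * y')"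
        using wz(3) by (auto simp: f_def e mod_eq_dvd_iff)
      have "p dvd s * ((s * x - d * t * y) - (s * x' - d * t * y')) + d * t * ((t * x + s * y) - (t * x' + s * y'))"
        by (rule dvd_add[OF dvd_mult[OF 1] dvd_mult[OF 2]])
      also have "\<dots> = n * (x - x')" by (simp add: n_def algebra_simps power2_eq_square)
      finally have "p dvd x - x'" using p pn prime_dvd_mult_iff by blast
      moreover have "p dvd s * ((t * x + s * y) - (t * x' + s * y')) - t * ((s * x - d * t * y) - (s * x' - d * t * y'))"
        by (rule dvd_diff[OF dvd_mult[OF 2] dvd_mult[OF 1]])
      then have "p dvd n * (y - y')" by (simp add: n_def algebra_simps power2_eq_square)
      then have "p dvd y - y'" using p pn prime_dvd_mult_iff by blast
      ultimately have "x mod p = x' mod p" "y mod p = y' mod p" by (auto simp: mod_eq_dvd_iff)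
      then show "w = z" using r e by simp
    qed
    moreover have "f ` N c1 \<subseteq> N c2"
    proof (rule image_subsetI)
      fix w assume w: "w \<in> N c1"
      obtain x y where e: "w = (x,y)" by force
      have xy: "p dvd a * x\<^sup>2 + b * y\<^sup>2 - c1" using w e by (auto simp: N_def)
      define X where "X = s * x - d * t * y"
      define Y where "Y = t * x + s * y"
      have "[a * (X mod p)\<^sup>2 + b * (Y mod p)\<^sup>2 = a * X\<^sup>2 + b * Y\<^sup>2] (mod p)"
        by (intro cong_add cong_mult cong_refl cong_pow) (simp_all add: cong_def)
      also have "[a * X\<^sup>2 + b * Y\<^sup>2 = a * X\<^sup>2 + (a * d) * Y\<^sup>2] (mod p)"
        using da by (intro cong_add cong_mult cong_refl) (rule cong_sym)
      also have "a * X\<^sup>2 + (a * d) * Y\<^sup>2 = n * (a * x\<^sup>2 + (a * d) * y\<^sup>2)"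
        by (simp add: X_def Y_def n_def algebra_simps power2_eq_square)
      also have "[n * (a * x\<^sup>2 + (a * d) * y\<^sup>2) = n * (a * x\<^sup>2 + b * y\<^sup>2)] (mod p)"
        using da by (intro cong_add cong_mult cong_refl)
      also have "[n * (a * x\<^sup>2 + b * y\<^sup>2) = n * c1] (mod p)"
        using xy by (intro cong_mult cong_refl) (simp add: cong_iff_dvd_diff)
      also note nc
      finally have "p dvd a * (X mod p)\<^sup>2 + b * (Y mod p)\<^sup>2 - c2" by (simp add: cong_iff_dvd_diff)
      then show "f w \<in> N c2" using p0 by (auto simp: f_def e N_def X_def Y_def)
    qed
    ultimately show ?thesis using finN by (intro card_inj_on_le)
  qed
  \<comment> \<open>The zero level is at most a pair of lines. Removing it from the
    \<open>p^2\<close> points leaves at least \<open>(p - 1)^2\<close> for the \<open>p - 1\<close>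
    other levels, which are equally large.\<close>
  have N0: "card (N 0) \<le> nat (2 * p - 1)"
  proof -
    define R where "R = (\<lambda>y. {x\<in>{0..<p}. p dvd (a * x\<^sup>2 + 0 * x + b * y\<^sup>2)})"
    have finR: "finite (R y)" for y
      unfolding R_def by (rule finite_subset[of _ "{0..<p}"]) auto
    have R2: "card (R y) \<le> 2" for y
      unfolding R_def using p ab by (intro card_quadratic_roots_le) auto
    have "N 0 \<subseteq> insert (0,0) (\<Union>y\<in>{1..<p}. (\<lambda>x. (x,y)) ` R y)"
    proof
      fix w assume w: "w \<in> N 0"
      obtain x y where e: "w = (x,y)" by force
      show "w \<in> insert (0,0) (\<Union>y\<in>{1..<p}. (\<lambda>x. (x,y)) ` R y)"
      proof (cases "y = 0")
        case True
        then have "p dvd a * x\<^sup>2" using w e by (auto simp: N_def)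
        then have "p dvd x" using p ab prime_dvd_mult_iff prime_dvd_power_iff[of p 2 x] by auto
        moreover have "0 \<le> x" "x < p" using w e by (auto simp: N_def)
        ultimately have "x = 0" using zdvd_not_zless[of x p] by force
        then show ?thesis using True e by simp
      next
        case False
        then show ?thesis using w e by (auto simp: N_def R_def)
      qed
    qed
    then have "card (N 0) \<le> card (insert (0,0) (\<Union>y\<in>{1..<p}. (\<lambda>x. (x,y)) ` R y))"
      using finR by (intro card_mono) auto
    also have "\<dots> \<le> Suc (card (\<Union>y\<in>{1..<p}. (\<lambda>x. (x,y)) ` R y))"
      using finR by (subst card_insert_if) auto
    also have "\<dots> \<le> Suc (\<Sum>y\<in>{1..<p}. card ((\<lambda>x. (x,y)) ` R y))"
      by (intro Suc_le_mono[THEN iffD2] card_UN_le) auto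
    also have "\<dots> \<le> Suc (\<Sum>y\<in>{1..<p}. 2)"
      using finR R2 by (intro Suc_le_mono[THEN iffD2] sum_mono order_trans[OF card_image_le]) auto
    also have "\<dots> = nat (2 * p - 1)" using p0 by simp
    finally show ?thesis .
  qed
  have U: "{0..<p}\<times>{0..<p} = (\<Union>e\<in>{0..<p}. N e)"
  proof
    show "{0..<p}\<times>{0..<p} \<subseteq> (\<Union>e\<in>{0..<p}. N e)"
    proof clarsimp
      fix x y assume "0 \<le> x" "x < p" "0 \<le> y" "y < p"
      then show "\<exists>e\<in>{0..<p}. (x, y) \<in> N e"
        using p0 by (intro bexI[of _ "(a * x\<^sup>2 + b * y\<^sup>2) mod p"]) (auto simp: N_def minus_mod_eq_mult_div)
    qed
  qed (auto simp: N_def)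
  have "nat (p * p) = card ({0..<p}\<times>{0..<p})"
    using p0 by (simp add: card_cartesian_product nat_mult_distrib)
  also have "\<dots> \<le> (\<Sum>e\<in>{0..<p}. card (N e))"
    unfolding U by (rule card_UN_le) simp
  also have "{0..<p} = insert 0 {1..<p}" using p0 by auto
  also have "(\<Sum>e\<in>insert 0 {1..<p}. card (N e)) = card (N 0) + (\<Sum>e\<in>{1..<p}. card (N e))"
    by simp
  also have "\<dots> \<le> nat (2 * p - 1) + (\<Sum>e\<in>{1..<p}. card (N c))"
    using c zdvd_not_zless by (intro add_mono N0 sum_mono le) force+
  also have "\<dots> = nat (2 * p - 1) + nat (p - 1) * card (N c)" by simp
  finally have "int (nat (p * p)) \<le> int (nat (2 * p - 1) + nat (p - 1) * card (N c))"
    by (simp only: of_nat_le_iff)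
  then have "p * p \<le> (2 * p - 1) + (p - 1) * int (card (N c))" using p0 by simp
  then have "(p - 1) * (p - 1) \<le> (p - 1) * int (card (N c))" by (simp add: algebra_simps)
  then show ?thesis using p by (simp add: N_def)
qed

section \<open>Lifting solutions to prime powers\<close>

lemma hensel_quadratic:
  fixes p b A r c :: int
  assumes p: "prime p" and r: "\<not> p dvd (b + 2 * A * r)" "p dvd (b * r + A * r\<^sup>2 - c)"
  shows "\<exists>x. p dvd (x - r) \<and> p ^ Suc j dvd (b * x + A * x\<^sup>2 - c)"
proof (induction j)
  case 0
  then show ?case using r by (intro exI[of _ r]) auto
next
  case (Suc j)
  then obtain x where x: "p dvd (x - r)" "p ^ Suc j dvd (b * x + A * x\<^sup>2 - c)" by blast
  obtain e where e: "b * x + A * x\<^sup>2 - c = p ^ Suc j * e" using x(2) by (elim dvdE)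
  \<comment> \<open>Staying congruent to \<open>r\<close> keeps the derivative a unit throughout the
    induction.\<close>
  have "\<not> p dvd (b + 2 * A * x)"
  proof
    assume "p dvd (b + 2 * A * x)"
    from dvd_diff[OF this dvd_mult[OF x(1)]] have "p dvd (b + 2 * A * x) - 2 * A * (x - r)" .
    then show False using r by (simp add: algebra_simps)
  qed
  then have "coprime (b + 2 * A * x) p" using p by (simp add: prime_imp_coprime coprime_commute)
  then obtain u where "[(b + 2 * A * x) * u = 1] (mod p)" using cong_solve_coprime_int by blast
  then have u: "p dvd (b + 2 * A * x) * u - 1" by (simp add: cong_iff_dvd_diff)
  \<comment> \<open>The Newton step: it cancels \<open>e\<close> modulo \<open>p\<close>, while the
    second-order term carries \<open>p^(2j + 2)\<close>.\<close>
  define s where "s = - e * u"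
  have "b * (x + p ^ Suc j * s) + A * (x + p ^ Suc j * s)\<^sup>2 - c =
     p ^ Suc j * (e + (b + 2 * A * x) * s) + (p ^ Suc j * p ^ Suc j) * (A * s\<^sup>2)"
    using e by (simp add: algebra_simps power2_eq_square)
  also have "\<dots> = p ^ Suc j * (- e * ((b + 2 * A * x) * u - 1)) + (p ^ Suc (Suc j) * p ^ j) * (A * s\<^sup>2)"
    by (simp add: s_def algebra_simps)
  also have "p ^ Suc (Suc j) dvd \<dots>"
  proof (rule dvd_add)
    have "p ^ Suc j * p dvd p ^ Suc j * (- e * ((b + 2 * A * x) * u - 1))"
      using u by (intro mult_dvd_mono dvd_refl dvd_mult)
    then show "p ^ Suc (Suc j) dvd p ^ Suc j * (- e * ((b + 2 * A * x) * u - 1))" by (simp add: mult.commute)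
  qed (simp add: mult.assoc)
  finally have "p ^ Suc (Suc j) dvd b * (x + p ^ Suc j * s) + A * (x + p ^ Suc j * s)\<^sup>2 - c" .
  moreover have "p dvd (x + p ^ Suc j * s - r)"
    using dvd_add[OF x(1), of "p ^ Suc j * s"] by (simp add: algebra_simps)
  ultimately show ?case by blast
qed

definition sols_mod :: "nat \<Rightarrow> (nat \<Rightarrow> int) \<Rightarrow> (nat \<Rightarrow> int) \<Rightarrow> int \<Rightarrow> int \<Rightarrow> (nat \<Rightarrow> int) set" where
  "sols_mod \<nu> b A D m = {t \<in> {..<\<nu>} \<rightarrow>\<^sub>E {0..<D}. D dvd (diag_quad \<nu> b A t - m)}"

text \<open>Solutions that are nonsingular in direction \<open>i\<close>: the partial derivative is
  a unit, which is what lifting in this coordinate requires.\<close>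

definition smooth_sols :: "nat \<Rightarrow> (nat \<Rightarrow> int) \<Rightarrow> (nat \<Rightarrow> int) \<Rightarrow> int \<Rightarrow> int \<Rightarrow> nat \<Rightarrow> (nat \<Rightarrow> int) set" where
  "smooth_sols \<nu> b A p m i = {t \<in> sols_mod \<nu> b A p m. \<not> p dvd (b i + 2 * A i * t i)}"

lemma finite_sols_mod [simp]: "finite (sols_mod \<nu> b A D m)"
  unfolding sols_mod_def by (rule finite_subset[of _ "{..<\<nu>} \<rightarrow>\<^sub>E {0..<D}"]) (auto intro: finite_PiE)

lemma finite_smooth_sols [simp]: "finite (smooth_sols \<nu> b A p m i)"
  unfolding smooth_sols_def by (rule finite_subset[of _ "sols_mod \<nu> b A p m"]) auto

lemma diag_quad_remove:
  "i < \<nu> \<Longrightarrow> diag_quad \<nu> b A t = (b i * t i + A i * (t i)\<^sup>2) + (\<Sum>l\<in>{..<\<nu>} - {i}. b l * t l + A l * (t l)\<^sup>2)"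
  unfolding diag_quad_def by (rule sum.remove) auto

lemma quad_diff_factor:
  "(b * x + A * x\<^sup>2) - (b * y + A * y\<^sup>2) = (x - y) * (b + A * (x + y))" for b A x y :: int
  by (simp add: algebra_simps power2_eq_square)

lemma diag_quad_cong_mod:
  fixes D :: int
  assumes "\<And>i. i \<in> I \<Longrightarrow> D dvd (s i - t i)"
  shows "D dvd (\<Sum>l\<in>I. b l * s l + A l * (s l)\<^sup>2) - (\<Sum>l\<in>I. b l * t l + A l * (t l)\<^sup>2)"
  unfolding sum_subtractf[symmetric] quad_diff_factor
  by (intro dvd_sum dvd_mult2 assms)

text \<open>All coordinates except \<open>i\<close> are lifted arbitrarily, with \<open>p^j\<close>
  choices each, and Hensel's lemma then supplies coordinate \<open>i\<close>. The original solution
  is recovered by reduction modulo \<open>p\<close>, so different choices give different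
  lifts.\<close>

lemma card_sols_mod_prime_power_ge:
  fixes p m :: int
  assumes p: "prime p" and i: "i < \<nu>"
  shows "card (smooth_sols \<nu> b A p m i) * nat (p ^ j) ^ (\<nu> - 1) \<le> card (sols_mod \<nu> b A (p ^ Suc j) m)"
proof -
  let ?I = "{..<\<nu>} - {i}"
  let ?g = "\<lambda>l x. b l * x + A l * x\<^sup>2"
  define S where "S = (?I \<rightarrow>\<^sub>E {0..<p ^ j})"
  have p0: "p > 0" using p prime_gt_0_int by blast
  have cardS: "card S = nat (p ^ j) ^ (\<nu> - 1)"
    using i by (simp add: S_def card_PiE)
  define C where "C = (\<lambda>t s. m - (\<Sum>l\<in>?I. ?g l (t l + p * s l)))"
  have ex: "\<exists>x. x \<in> {0..<p ^ Suc j} \<and> p dvd (x - t i) \<and> p ^ Suc j dvd (?g i x - C t s)"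
    if t: "t \<in> smooth_sols \<nu> b A p m i" for t s
  proof -
    have "p dvd (\<Sum>l\<in>?I. ?g l (t l + p * s l)) - (\<Sum>l\<in>?I. ?g l (t l))"
      by (rule diag_quad_cong_mod) simp
    moreover have "p dvd ?g i (t i) + (\<Sum>l\<in>?I. ?g l (t l)) - m"
      using t diag_quad_remove[OF i, of b A t] by (simp add: smooth_sols_def sols_mod_def)
    ultimately have "p dvd ((\<Sum>l\<in>?I. ?g l (t l + p * s l)) - (\<Sum>l\<in>?I. ?g l (t l))) + (?g i (t i) + (\<Sum>l\<in>?I. ?g l (t l)) - m)"
      by (rule dvd_add)
    then have "p dvd ?g i (t i) - C t s" by (simp add: C_def algebra_simps)
    moreover have "\<not> p dvd (b i + 2 * A i * t i)" using t by (simp add: smooth_sols_def)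
    ultimately obtain x where x: "p dvd (x - t i)" "p ^ Suc j dvd (?g i x - C t s)"
      using hensel_quadratic[OF p, of "b i" "A i" "t i" "C t s" j] by blast
    define y where "y = x mod p ^ Suc j"
    have yx: "p ^ Suc j dvd y - x" by (simp add: y_def mod_eq_dvd_iff[symmetric])
    have "p dvd y - x" using yx by (rule dvd_trans[rotated]) simp
    then have "p dvd (y - x) + (x - t i)" using x(1) by (rule dvd_add)
    moreover have "p ^ Suc j dvd ?g i y - C t s"
    proof -
      have "p ^ Suc j dvd (?g i y - ?g i x) + (?g i x - C t s)"
        unfolding quad_diff_factor using yx x(2) by (intro dvd_add dvd_mult2)
      then show ?thesis by (simp only: add_diff_eq diff_add_cancel)
    qed
    moreover have "y \<in> {0..<p ^ Suc j}" using p0 by (simp add: y_def)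
    ultimately show ?thesis by (intro exI[of _ y]) (simp del: power_Suc)
  qed
  define X where "X = (\<lambda>t s. SOME x. x \<in> {0..<p ^ Suc j} \<and> p dvd (x - t i) \<and> p ^ Suc j dvd (?g i x - C t s))"
  have X: "X t s \<in> {0..<p ^ Suc j}" "p dvd (X t s - t i)" "p ^ Suc j dvd (?g i (X t s) - C t s)"
    if "t \<in> smooth_sols \<nu> b A p m i" for t s
    using someI_ex[OF ex[OF that, of s]] unfolding X_def by blast+
  define \<Phi> where "\<Phi> = (\<lambda>(t, s). \<lambda>l\<in>{..<\<nu>}. if l = i then X t s else t l + p * s l)"
  have \<Phi>i: "\<Phi> (t, s) i = X t s" for t s using i by (simp add: \<Phi>_def)
  have \<Phi>l: "\<Phi> (t, s) l = t l + p * s l" if "l \<in> ?I" for t s l using that by (simp add: \<Phi>_def)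
  have "inj_on \<Phi> (smooth_sols \<nu> b A p m i \<times> S)"
  proof (rule inj_onI)
    fix u v assume uv: "u \<in> smooth_sols \<nu> b A p m i \<times> S" "v \<in> smooth_sols \<nu> b A p m i \<times> S" "\<Phi> u = \<Phi> v"
    obtain t s t' s' where e: "u = (t, s)" "v = (t', s')" by force
    have t: "t \<in> smooth_sols \<nu> b A p m i" "t' \<in> smooth_sols \<nu> b A p m i" "s \<in> S" "s' \<in> S"
      using uv e by auto
    have tE: "t \<in> {..<\<nu>} \<rightarrow>\<^sub>E {0..<p}" "t' \<in> {..<\<nu>} \<rightarrow>\<^sub>E {0..<p}"
      using t by (auto simp: smooth_sols_def sols_mod_def)
    have l: "t l = t' l \<and> s l = s' l" if "l \<in> ?I" for l
    proof -
      have e2: "t l + p * s l = t' l + p * s' l"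
        using fun_cong[OF uv(3), of l] unfolding e \<Phi>l[OF that] .
      have r: "t l \<in> {0..<p}" "t' l \<in> {0..<p}"
        by (rule PiE_mem[OF tE(1)] PiE_mem[OF tE(2)], use that in blast)+
      have "(t l + p * s l) mod p = (t' l + p * s' l) mod p" using e2 by simp
      then have "t l = t' l" using r by simp
      then show ?thesis using e2 p0 by simp
    qed
    have "X t s = X t' s'"
      using fun_cong[OF uv(3), of i] unfolding e \<Phi>i .
    moreover have "p dvd (X t s - t i)" by (rule X(2)[OF t(1)])
    moreover have "p dvd (X t' s' - t' i)" by (rule X(2)[OF t(2)])
    ultimately have "p dvd (X t s - t i)" "p dvd (X t' s' - t' i)" "X t s = X t' s'" by simp_all
    then have "p dvd t i - t' i"
      using dvd_diff[of p "X t' s' - t' i" "X t s - t i"] by simp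
    then have "t i mod p = t' i mod p" by (simp add: mod_eq_dvd_iff)
    moreover have "t i \<in> {0..<p}" "t' i \<in> {0..<p}"
      by (rule PiE_mem[OF tE(1)] PiE_mem[OF tE(2)], use i in simp)+
    ultimately have ti: "t i = t' i" by simp
    have "t = t'"
      by (rule PiE_ext[OF tE]) (use l ti in auto)
    moreover have "s = s'"
      using t(3,4) unfolding S_def by (rule PiE_ext) (use l in auto)
    ultimately show "u = v" using e by simp
  qed
  moreover have "\<Phi> ` (smooth_sols \<nu> b A p m i \<times> S) \<subseteq> sols_mod \<nu> b A (p ^ Suc j) m"
  proof (rule image_subsetI)
    fix u assume u: "u \<in> smooth_sols \<nu> b A p m i \<times> S"
    obtain t s where e: "u = (t, s)" by force
    have t: "t \<in> smooth_sols \<nu> b A p m i" "s \<in> S" using u e by auto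
    have "\<Phi> u \<in> {..<\<nu>} \<rightarrow>\<^sub>E {0..<p ^ Suc j}"
    proof (rule PiE_I)
      fix l assume l: "l \<in> {..<\<nu>}"
      show "\<Phi> u l \<in> {0..<p ^ Suc j}"
      proof (cases "l = i")
        case True
        then show ?thesis using X(1)[OF t(1), of s] unfolding True e \<Phi>i by simp
      next
        case False
        have "t \<in> {..<\<nu>} \<rightarrow>\<^sub>E {0..<p}" using t(1) by (simp add: smooth_sols_def sols_mod_def)
        from PiE_mem[OF this l] have "t l \<in> {0..<p}" .
        moreover have "s l \<in> {0..<p ^ j}"
          using t(2) l False unfolding S_def by (intro PiE_mem[of s ?I]) auto
        ultimately have "t l \<in> {0..<p}" "s l \<in> {0..<p ^ j}" by blast+
        then have "0 \<le> t l" "t l < p" "0 \<le> s l" "s l + 1 \<le> p ^ j" by auto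
        then have "p * (s l + 1) \<le> p * p ^ j" using p0 by (intro mult_left_mono) auto
        then have "t l + p * s l < p ^ Suc j" using \<open>t l < p\<close> by (simp add: algebra_simps)
        then show ?thesis using \<Phi>l[of l t s] False l e \<open>0 \<le> t l\<close> \<open>0 \<le> s l\<close> p0 by simp
      qed
    qed (auto simp: \<Phi>_def e)
    moreover have "diag_quad \<nu> b A (\<Phi> u) - m = ?g i (X t s) - C t s"
      unfolding diag_quad_remove[OF i] C_def e \<Phi>i using \<Phi>l by simp
    ultimately show "\<Phi> u \<in> sols_mod \<nu> b A (p ^ Suc j) m"
      using X(3)[OF t(1)] by (simp add: sols_mod_def del: power_Suc)
  qed
  ultimately have "card (smooth_sols \<nu> b A p m i \<times> S) \<le> card (sols_mod \<nu> b A (p ^ Suc j) m)"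
    by (intro card_inj_on_le) auto
  then show ?thesis by (simp add: card_cartesian_product cardS)
qed

text \<open>Modulo \<open>p\<close> the quadratic terms vanish, and the remaining linear equation is
  solved for coordinate \<open>i\<close>. The derivative there is \<open>b i\<close>, so every
  solution is smooth.\<close>

lemma card_smooth_sols_linear:
  fixes p m :: int
  assumes p: "prime p" and i: "i < \<nu>" and A: "\<And>l. l < \<nu> \<Longrightarrow> p dvd A l" and b: "\<not> p dvd b i"
  shows "nat p ^ (\<nu> - 1) \<le> card (smooth_sols \<nu> b A p m i)"
proof -
  let ?I = "{..<\<nu>} - {i}"
  let ?g = "\<lambda>l x. b l * x + A l * x\<^sup>2"
  define S where "S = (?I \<rightarrow>\<^sub>E {0..<p})"
  have p0: "p > 0" using p prime_gt_0_int by blast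
  have cardS: "card S = nat p ^ (\<nu> - 1)"
    using i by (simp add: S_def card_PiE)
  have "coprime (b i) p" using p b by (simp add: prime_imp_coprime coprime_commute)
  then obtain u where "[b i * u = 1] (mod p)" using cong_solve_coprime_int by blast
  then have u: "p dvd b i * u - 1" by (simp add: cong_iff_dvd_diff)
  define c where "c = (\<lambda>s. m - (\<Sum>l\<in>?I. ?g l (s l)))"
  define \<Phi> where "\<Phi> = (\<lambda>s. \<lambda>l\<in>{..<\<nu>}. if l = i then (u * c s) mod p else s l)"
  have \<Phi>i: "\<Phi> s i = (u * c s) mod p" for s using i by (simp add: \<Phi>_def)
  have \<Phi>l: "\<Phi> s l = s l" if "l \<in> ?I" for s l using that by (simp add: \<Phi>_def)
  have "inj_on \<Phi> S"
  proof (rule inj_onI)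
    fix s s' assume s: "s \<in> S" "s' \<in> S" "\<Phi> s = \<Phi> s'"
    show "s = s'"
    proof (rule PiE_ext[OF s(1)[unfolded S_def] s(2)[unfolded S_def]])
      fix l assume "l \<in> ?I"
      from fun_cong[OF s(3), of l] show "s l = s' l" unfolding \<Phi>l[OF \<open>l \<in> ?I\<close>] .
    qed
  qed
  moreover have "\<Phi> ` S \<subseteq> smooth_sols \<nu> b A p m i"
  proof (rule image_subsetI)
    fix s assume s: "s \<in> S"
    have "\<Phi> s \<in> {..<\<nu>} \<rightarrow>\<^sub>E {0..<p}"
    proof (rule PiE_I)
      fix l assume l: "l \<in> {..<\<nu>}"
      show "\<Phi> s l \<in> {0..<p}"
      proof (cases "l = i")
        case True
        then show ?thesis unfolding True \<Phi>i using p0 by simp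
      next
        case False
        then have "l \<in> ?I" using l by simp
        then show ?thesis unfolding \<Phi>l[OF \<open>l \<in> ?I\<close>] using s unfolding S_def by (rule PiE_mem[rotated])
      qed
    qed (simp add: \<Phi>_def)
    moreover have "p dvd diag_quad \<nu> b A (\<Phi> s) - m"
    proof -
      define x where "x = (u * c s) mod p"
      have "diag_quad \<nu> b A (\<Phi> s) - m = ?g i x - c s"
        unfolding diag_quad_remove[OF i] c_def \<Phi>i x_def using \<Phi>l by simp
      also have "\<dots> = b i * (x - u * c s) + (c s * (b i * u - 1) + A i * x\<^sup>2)"
        by (simp add: algebra_simps)
      also have "p dvd \<dots>"
      proof (rule dvd_add[OF dvd_mult dvd_add[OF dvd_mult[OF u] dvd_mult2[OF A[OF i]]]])
        show "p dvd x - u * c s" by (simp add: x_def mod_eq_dvd_iff[symmetric])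
      qed
      finally show ?thesis .
    qed
    moreover have "\<not> p dvd b i + 2 * A i * \<Phi> s i"
    proof
      assume *: "p dvd b i + 2 * A i * \<Phi> s i"
      have "p dvd 2 * A i * \<Phi> s i" using A[OF i] by simp
      then show False using dvd_diff[OF *, of "2 * A i * \<Phi> s i"] b by simp
    qed
    ultimately show "\<Phi> s \<in> smooth_sols \<nu> b A p m i"
      by (simp add: smooth_sols_def sols_mod_def)
  qed
  ultimately have "card S \<le> card (smooth_sols \<nu> b A p m i)"
    by (intro card_inj_on_le) auto
  then show ?thesis by (simp add: cardS)
qed

text \<open>Completing squares by \<open>X = b0 + 2 * A0 * x\<close> and
  \<open>Y = b1 + 2 * A1 * y\<close> gives a conic at the nonzero level \<open>C\<close>, with at
  least \<open>p - 1\<close> points. The at most two points with \<open>X = 0\<close> are those that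
  are singular in \<open>x\<close>, and they are discarded.\<close>

lemma card_two_variable_ge:
  fixes p b0 A0 b1 A1 c :: int
  assumes p: "prime p" "p > 2" and A: "\<not> p dvd A0" "\<not> p dvd A1"
    and C: "\<not> p dvd 4 * A0 * A1 * c + A1 * b0\<^sup>2 + A0 * b1\<^sup>2"
  shows "p - 3 \<le> int (card {(x,y)\<in>{0..<p}\<times>{0..<p}.
     p dvd ((b0 * x + A0 * x\<^sup>2) + (b1 * y + A1 * y\<^sup>2) - c) \<and> \<not> p dvd (b0 + 2 * A0 * x)})"
    (is "_ \<le> int (card ?R)")
proof -
  define C where "C = 4 * A0 * A1 * c + A1 * b0\<^sup>2 + A0 * b1\<^sup>2"
  define N where "N = {(x,y)\<in>{0..<p}\<times>{0..<p}. p dvd (A1 * x\<^sup>2 + A0 * y\<^sup>2 - C)}"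
  define N0 where "N0 = {y\<in>{0..<p}. p dvd (A0 * y\<^sup>2 + 0 * y + (- C))}"
  have p0: "p > 0" using p by simp
  have p2: "\<not> p dvd 2" using p zdvd_imp_le[of p 2] by auto
  have p2A: "\<not> p dvd 2 * A0" "\<not> p dvd 2 * A1" using p p2 A prime_dvd_mult_iff by blast+
  have p4: "\<not> p dvd 4 * A0 * A1"
  proof
    assume "p dvd 4 * A0 * A1"
    then have "p dvd (2 * A0) * (2 * A1)" by (simp add: mult_ac)
    then show False using p p2A prime_dvd_mult_iff by blast
  qed
  have finN: "finite N" unfolding N_def by (rule finite_subset[of _ "{0..<p}\<times>{0..<p}"]) auto
  have fin0: "finite N0" unfolding N0_def by (rule finite_subset[of _ "{0..<p}"]) auto
  have finR: "finite ?R" by (rule finite_subset[of _ "{0..<p}\<times>{0..<p}"]) auto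
  have "p - 1 \<le> int (card N)"
    unfolding N_def using p A C by (intro card_conic_ge) (auto simp: C_def)
  moreover have "card N0 \<le> 2" unfolding N0_def using p A by (intro card_quadratic_roots_le)
  moreover have "card N - card (Pair (0::int) ` N0) \<le> card (N - Pair 0 ` N0)"
    by (rule diff_card_le_card_Diff[OF finite_imageI[OF fin0]])
  moreover have "card (Pair (0::int) ` N0) = card N0" by (intro card_image) (auto simp: inj_on_def)
  ultimately have 1: "p - 3 \<le> int (card (N - Pair 0 ` N0))" by presburger
  have cop: "coprime z p" if "\<not> p dvd z" for z
    using that p by (simp add: prime_imp_coprime coprime_commute)
  obtain u0 where "[2 * A0 * u0 = 1] (mod p)"
    using cong_solve_coprime_int[OF cop[OF p2A(1)]] by blast
  then have u0: "p dvd 2 * A0 * u0 - 1" by (simp add: cong_iff_dvd_diff)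
  obtain u1 where "[2 * A1 * u1 = 1] (mod p)"
    using cong_solve_coprime_int[OF cop[OF p2A(2)]] by blast
  then have u1: "p dvd 2 * A1 * u1 - 1" by (simp add: cong_iff_dvd_diff)
  have shift_back: "p dvd (b + 2 * B * (((X - b) * u) mod p)) - X" if "p dvd 2 * B * u - 1" for b B X u :: int
  proof -
    define x where "x = ((X - b) * u) mod p"
    have "p dvd x - (X - b) * u" by (simp add: x_def mod_eq_dvd_iff[symmetric])
    then have "p dvd 2 * B * (x - (X - b) * u) + (X - b) * (2 * B * u - 1)"
      using that by (rule dvd_add[OF dvd_mult dvd_mult])
    also have "\<dots> = (b + 2 * B * x) - X" by (simp add: algebra_simps)
    finally show ?thesis by (simp add: x_def)
  qed
  define f where "f = (\<lambda>(X,Y). (((X - b0) * u0) mod p, ((Y - b1) * u1) mod p))"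
  have "inj_on f (N - Pair 0 ` N0)"
  proof (rule inj_onI)
    fix w z assume wz: "w \<in> N - Pair 0 ` N0" "z \<in> N - Pair 0 ` N0" "f w = f z"
    obtain X Y X' Y' where e: "w = (X,Y)" "z = (X',Y')" by force
    have r: "X \<in> {0..<p}" "Y \<in> {0..<p}" "X' \<in> {0..<p}" "Y' \<in> {0..<p}"
      using wz e by (auto simp: N_def)
    have q: "((X - b0) * u0) mod p = ((X' - b0) * u0) mod p" "((Y - b1) * u1) mod p = ((Y' - b1) * u1) mod p"
      using wz(3) by (auto simp: f_def e)
    have "p dvd X' - X"
      using dvd_diff[OF shift_back[OF u0, of b0 X] shift_back[OF u0, of b0 X']] q by simp
    moreover have "p dvd Y' - Y"
      using dvd_diff[OF shift_back[OF u1, of b1 Y] shift_back[OF u1, of b1 Y']] q by simp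
    ultimately have "X' mod p = X mod p" "Y' mod p = Y mod p" by (auto simp: mod_eq_dvd_iff)
    then show "w = z" using r e by simp
  qed
  moreover have "f ` (N - Pair 0 ` N0) \<subseteq> ?R"
  proof (rule image_subsetI)
    fix w assume w: "w \<in> N - Pair 0 ` N0"
    obtain X Y where e: "w = (X,Y)" by force
    have XY: "X \<in> {0..<p}" "Y \<in> {0..<p}" "p dvd A1 * X\<^sup>2 + A0 * Y\<^sup>2 - C" using w e by (auto simp: N_def)
    have "X \<noteq> 0" using w e XY by (auto simp: N0_def)
    then have pX: "\<not> p dvd X" using XY zdvd_not_zless[of X p] by auto
    define x where "x = ((X - b0) * u0) mod p"
    define y where "y = ((Y - b1) * u1) mod p"
    have x: "p dvd (b0 + 2 * A0 * x) - X" unfolding x_def by (rule shift_back[OF u0])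
    have y: "p dvd (b1 + 2 * A1 * y) - Y" unfolding y_def by (rule shift_back[OF u1])
    have "\<not> p dvd b0 + 2 * A0 * x"
    proof
      assume "p dvd b0 + 2 * A0 * x"
      from dvd_diff[OF this x] show False using pX by simp
    qed
    moreover have "p dvd (b0 * x + A0 * x\<^sup>2) + (b1 * y + A1 * y\<^sup>2) - c"
    proof -
      have "4 * A0 * A1 * ((b0 * x + A0 * x\<^sup>2) + (b1 * y + A1 * y\<^sup>2) - c) =
         A1 * (b0 + 2 * A0 * x + X) * ((b0 + 2 * A0 * x) - X) +
         (A0 * (b1 + 2 * A1 * y + Y) * ((b1 + 2 * A1 * y) - Y) + (A1 * X\<^sup>2 + A0 * Y\<^sup>2 - C))"
        by (simp add: C_def algebra_simps power2_eq_square)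
      also have "p dvd \<dots>"
        by (rule dvd_add[OF dvd_mult[OF x] dvd_add[OF dvd_mult[OF y] XY(3)]])
      finally show ?thesis using p p4 prime_dvd_mult_iff by blast
    qed
    ultimately show "f w \<in> ?R" using p0 by (auto simp: f_def e x_def y_def)
  qed
  ultimately have "card (N - Pair 0 ` N0) \<le> card ?R" using finR by (intro card_inj_on_le)
  then show ?thesis using 1 by linarith
qed

lemma sum_split_first_three:
  fixes g :: "nat \<Rightarrow> 'a::comm_monoid_add"
  assumes "\<nu> \<ge> 3"
  shows "(\<Sum>l<\<nu>. g l) = g 0 + g 1 + g 2 + (\<Sum>l\<in>{3..<\<nu>}. g l)"
proof -
  have "(\<Sum>l<\<nu>. g l) = (\<Sum>l\<in>{..<3} \<union> {3..<\<nu>}. g l)"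
    using assms by (intro sum.cong) auto
  also have "\<dots> = (\<Sum>l<3. g l) + (\<Sum>l\<in>{3..<\<nu>}. g l)"
    by (rule sum.union_disjoint) auto
  also have "(\<Sum>l<3. g l) = g 0 + g 1 + g 2"
    by (simp add: numeral_3_eq_3 numeral_2_eq_2)
  finally show ?thesis .
qed

text \<open>Coordinates from 3 on are free. Coordinate 2 avoids the at most two values at which the
  conic in the first two coordinates degenerates, and the conic then has \<open>p - 3\<close> smooth
  points.\<close>

lemma card_smooth_sols_ternary:
  fixes p m :: int
  assumes p: "prime p" "p > 2" and \<nu>: "\<nu> \<ge> 3" and A: "\<And>l. l < 3 \<Longrightarrow> \<not> p dvd A l"
  shows "(p - 2) * (p - 3) * p ^ (\<nu> - 3) \<le> int (card (smooth_sols \<nu> b A p m 0))"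
proof -
  let ?g = "\<lambda>l x. b l * x + A l * x\<^sup>2"
  define S where "S = ({3..<\<nu>} \<rightarrow>\<^sub>E {0..<p})"
  define c where "c = (\<lambda>s z. m - (\<Sum>l\<in>{3..<\<nu>}. ?g l (s l)) - ?g 2 z)"
  define C where "C = (\<lambda>s z. 4 * A 0 * A 1 * c s z + A 1 * (b 0)\<^sup>2 + A 0 * (b 1)\<^sup>2)"
  define Z where "Z = (\<lambda>s. {z\<in>{0..<p}. \<not> p dvd C s z})"
  define E where "E = (\<lambda>s z. {(x,y)\<in>{0..<p}\<times>{0..<p}. p dvd (?g 0 x + ?g 1 y - c s z) \<and> \<not> p dvd (b 0 + 2 * A 0 * x)})"
  have p0: "p > 0" and p3: "p \<ge> 3" using p by auto
  have finS: "finite S" by (auto simp: S_def intro: finite_PiE)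
  have finZ: "finite (Z s)" for s unfolding Z_def by (rule finite_subset[of _ "{0..<p}"]) auto
  have finE: "finite (E s z)" for s z unfolding E_def by (rule finite_subset[of _ "{0..<p}\<times>{0..<p}"]) auto
  have A': "\<not> p dvd A 0" "\<not> p dvd A 1" "\<not> p dvd A 2" using A by auto
  have cE: "p - 3 \<le> int (card (E s z))" if "z \<in> Z s" for s z
    unfolding E_def using that p A' by (intro card_two_variable_ge) (auto simp: Z_def C_def)
  have cZ: "p - 2 \<le> int (card (Z s))" for s
  proof -
    define R where "R = {z\<in>{0..<p}. p dvd ((- 4 * A 0 * A 1 * A 2) * z\<^sup>2 + (- 4 * A 0 * A 1 * b 2) * z
        + (4 * A 0 * A 1 * (m - (\<Sum>l\<in>{3..<\<nu>}. ?g l (s l))) + A 1 * (b 0)\<^sup>2 + A 0 * (b 1)\<^sup>2))}"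
    have "p \<noteq> 2" "\<not> p dvd 2" using p zdvd_imp_le[of p 2] by auto
    then have "\<not> p dvd 2 * (2 * (A 0 * (A 1 * A 2)))"
      unfolding prime_dvd_mult_iff[OF p(1)] using A' by blast
    then have "\<not> p dvd - 4 * A 0 * A 1 * A 2" by (simp add: mult_ac)
    then have "card R \<le> 2" unfolding R_def using p by (intro card_quadratic_roots_le) auto
    moreover have "{0..<p} - R = Z s"
      unfolding R_def Z_def C_def c_def by (auto simp: algebra_simps power2_eq_square)
    moreover have "card {0..<p} - card R \<le> card ({0..<p} - R)"
      by (rule diff_card_le_card_Diff) (auto simp: R_def intro: finite_subset[of _ "{0..<p}"])
    ultimately show ?thesis using p0 by simp
  qed
  define Dom where "Dom = (SIGMA s:S. SIGMA z:Z s. E s z)"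
  have "(p - 2) * (p - 3) * p ^ (\<nu> - 3) = (\<Sum>s\<in>S. (p - 2) * (p - 3))"
    using p0 by (simp add: S_def card_PiE)
  also have "\<dots> \<le> (\<Sum>s\<in>S. int (card (Z s)) * (p - 3))"
    using cZ p3 by (intro sum_mono mult_right_mono) auto
  also have "\<dots> = (\<Sum>s\<in>S. \<Sum>z\<in>Z s. (p - 3))" by simp
  also have "\<dots> \<le> (\<Sum>s\<in>S. \<Sum>z\<in>Z s. int (card (E s z)))"
    using cE by (intro sum_mono) auto
  also have "\<dots> = int (card Dom)"
    unfolding Dom_def using finS finZ finE by simp
  finally have 1: "(p - 2) * (p - 3) * p ^ (\<nu> - 3) \<le> int (card Dom)" .
  define \<Phi> where "\<Phi> = (\<lambda>(s::nat \<Rightarrow> int, z::int, x::int, y::int). \<lambda>l\<in>{..<\<nu>}. if l = 0 then x else if l = 1 then y else if l = 2 then z else s l)"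
  have \<Phi>: "\<Phi> (s,z,x,y) 0 = x" "\<Phi> (s,z,x,y) 1 = y" "\<Phi> (s,z,x,y) 2 = z" for s z x y
    using \<nu> by (auto simp: \<Phi>_def)
  have \<Phi>l: "\<Phi> (s,z,x,y) l = s l" if "l \<in> {3..<\<nu>}" for s z x y l
    using that by (auto simp: \<Phi>_def)
  have "inj_on \<Phi> Dom"
  proof (rule inj_onI)
    fix u v assume uv: "u \<in> Dom" "v \<in> Dom" "\<Phi> u = \<Phi> v"
    obtain s z x y s' z' x' y' where e: "u = (s,z,x,y)" "v = (s',z',x',y')"
      by (metis prod_cases4)
    have "x = x'" using fun_cong[OF uv(3), of 0] unfolding e \<Phi> .
    moreover have "y = y'" using fun_cong[OF uv(3), of 1] unfolding e \<Phi> .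
    moreover have "z = z'" using fun_cong[OF uv(3), of 2] unfolding e \<Phi> .
    moreover have "s = s'"
    proof (rule PiE_ext)
      show "s \<in> {3..<\<nu>} \<rightarrow>\<^sub>E {0..<p}" "s' \<in> {3..<\<nu>} \<rightarrow>\<^sub>E {0..<p}"
        using uv(1,2) by (simp_all add: e Dom_def S_def)
      fix l assume l: "l \<in> {3..<\<nu>}"
      show "s l = s' l" using fun_cong[OF uv(3), of l] unfolding e \<Phi>l[OF l] .
    qed
    ultimately show "u = v" using e by simp
  qed
  moreover have "\<Phi> ` Dom \<subseteq> smooth_sols \<nu> b A p m 0"
  proof (rule image_subsetI)
    fix u assume u: "u \<in> Dom"
    obtain s z x y where e: "u = (s,z,x,y)" by (metis prod_cases4)
    have s: "s \<in> {3..<\<nu>} \<rightarrow>\<^sub>E {0..<p}" and z: "z \<in> {0..<p}" and x: "x \<in> {0..<p}" and y: "y \<in> {0..<p}"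
      and sol: "p dvd (?g 0 x + ?g 1 y - c s z)" and der: "\<not> p dvd (b 0 + 2 * A 0 * x)"
      using u by (simp_all add: e Dom_def S_def Z_def E_def)
    have "\<Phi> u \<in> {..<\<nu>} \<rightarrow>\<^sub>E {0..<p}"
    proof (rule PiE_I)
      fix l assume l: "l \<in> {..<\<nu>}"
      consider "l = 0" | "l = 1" | "l = 2" | "l \<in> {3..<\<nu>}" using l by force
      then show "\<Phi> u l \<in> {0..<p}"
      proof cases
        case 4
        then show ?thesis unfolding e \<Phi>l[OF 4] using s by (rule PiE_mem[rotated])
      qed (use x y z in \<open>simp_all only: e \<Phi>\<close>)
    qed (simp add: \<Phi>_def e)
    moreover have "diag_quad \<nu> b A (\<Phi> u) - m = ?g 0 x + ?g 1 y - c s z"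
      unfolding diag_quad_def sum_split_first_three[OF \<nu>] e \<Phi> c_def using \<Phi>l by simp
    ultimately show "\<Phi> u \<in> smooth_sols \<nu> b A p m 0"
      using sol der \<Phi>(1)[of s z x y] by (simp add: smooth_sols_def sols_mod_def e)
  qed
  ultimately have "card Dom \<le> card (smooth_sols \<nu> b A p m 0)"
    by (intro card_inj_on_le) auto
  with 1 show ?thesis by linarith
qed

section \<open>Composite moduli by Chinese remaindering\<close>

lemma card_sols_mod_mult:
  fixes D1 D2 :: int
  assumes cop: "coprime D1 D2" and pos: "D1 > 0" "D2 > 0"
  shows "card (sols_mod \<nu> b A D1 m) * card (sols_mod \<nu> b A D2 m) \<le> card (sols_mod \<nu> b A (D1 * D2) m)"
proof -
  have ex: "\<exists>z. z \<in> {0..<D1 * D2} \<and> D1 dvd z - x \<and> D2 dvd z - y" for x y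
  proof -
    obtain w where w: "[w = x] (mod D1)" "[w = y] (mod D2)"
      using binary_chinese_remainder_int[OF cop] by blast
    define z where "z = w mod (D1 * D2)"
    have "D1 * D2 dvd z - w" by (simp add: z_def mod_eq_dvd_iff[symmetric])
    then have "D1 dvd z - w" "D2 dvd z - w" by (auto intro: dvd_mult_left dvd_mult_right)
    then have "D1 dvd (z - w) + (w - x)" "D2 dvd (z - w) + (w - y)"
      using w unfolding cong_iff_dvd_diff by (blast intro: dvd_add)+
    moreover have "z \<in> {0..<D1 * D2}" using pos by (simp add: z_def)
    ultimately show ?thesis by (intro exI[of _ z]) simp
  qed
  define crt where "crt = (\<lambda>x y. SOME z. z \<in> {0..<D1 * D2} \<and> D1 dvd z - x \<and> D2 dvd z - y)"
  have crt: "crt x y \<in> {0..<D1 * D2}" "D1 dvd crt x y - x" "D2 dvd crt x y - y" for x y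
    using someI_ex[OF ex[of x y]] unfolding crt_def by blast+
  define \<Phi> where "\<Phi> = (\<lambda>(s, t). \<lambda>l\<in>{..<\<nu>}. crt (s l) (t l))"
  have \<Phi>l: "\<Phi> (s, t) l = crt (s l) (t l)" if "l \<in> {..<\<nu>}" for s t l using that by (simp add: \<Phi>_def)
  have "inj_on \<Phi> (sols_mod \<nu> b A D1 m \<times> sols_mod \<nu> b A D2 m)"
  proof (rule inj_onI)
    fix u v assume uv: "u \<in> sols_mod \<nu> b A D1 m \<times> sols_mod \<nu> b A D2 m"
      "v \<in> sols_mod \<nu> b A D1 m \<times> sols_mod \<nu> b A D2 m" "\<Phi> u = \<Phi> v"
    obtain s t s' t' where e: "u = (s,t)" "v = (s',t')" by force
    have E: "s \<in> {..<\<nu>} \<rightarrow>\<^sub>E {0..<D1}" "s' \<in> {..<\<nu>} \<rightarrow>\<^sub>E {0..<D1}"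
      "t \<in> {..<\<nu>} \<rightarrow>\<^sub>E {0..<D2}" "t' \<in> {..<\<nu>} \<rightarrow>\<^sub>E {0..<D2}"
      using uv by (simp_all add: e sols_mod_def)
    have eq: "crt (s l) (t l) = crt (s' l) (t' l)" if "l \<in> {..<\<nu>}" for l
      using fun_cong[OF uv(3), of l] unfolding e \<Phi>l[OF that] .
    have *: "x = x'" if "D dvd w - x" "D dvd w - x'" "x \<in> {0..<D}" "x' \<in> {0..<D}" for D w x x' :: int
    proof -
      have "D dvd (w - x') - (w - x)" by (rule dvd_diff[OF that(2,1)])
      then have "x mod D = x' mod D" by (simp add: mod_eq_dvd_iff)
      then show ?thesis using that by simp
    qed
    have "s = s'"
    proof (rule PiE_ext[OF E(1,2)])
      fix l assume l: "l \<in> {..<\<nu>}"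
      show "s l = s' l"
        using crt(2)[of "s l" "t l"] crt(2)[of "s' l" "t' l"] PiE_mem[OF E(1) l] PiE_mem[OF E(2) l]
        unfolding eq[OF l] by (rule *)
    qed
    moreover have "t = t'"
    proof (rule PiE_ext[OF E(3,4)])
      fix l assume l: "l \<in> {..<\<nu>}"
      show "t l = t' l"
        using crt(3)[where x="s l" and y="t l"] crt(3)[where x="s' l" and y="t' l"] PiE_mem[OF E(3) l] PiE_mem[OF E(4) l]
        unfolding eq[OF l] by (rule *)
    qed
    ultimately show "u = v" using e by simp
  qed
  moreover have "\<Phi> ` (sols_mod \<nu> b A D1 m \<times> sols_mod \<nu> b A D2 m) \<subseteq> sols_mod \<nu> b A (D1 * D2) m"
  proof (rule image_subsetI)
    fix u assume u: "u \<in> sols_mod \<nu> b A D1 m \<times> sols_mod \<nu> b A D2 m"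
    obtain s t where e: "u = (s,t)" by force
    have s: "D1 dvd diag_quad \<nu> b A s - m" and t: "D2 dvd diag_quad \<nu> b A t - m"
      using u by (simp_all add: e sols_mod_def)
    have "\<Phi> u \<in> {..<\<nu>} \<rightarrow>\<^sub>E {0..<D1 * D2}"
    proof (rule PiE_I)
      fix l assume l: "l \<in> {..<\<nu>}"
      show "\<Phi> u l \<in> {0..<D1 * D2}" unfolding e \<Phi>l[OF l] by (rule crt)
    qed (simp add: \<Phi>_def e)
    moreover have "D1 dvd diag_quad \<nu> b A (\<Phi> u) - diag_quad \<nu> b A s"
      unfolding diag_quad_def by (rule diag_quad_cong_mod) (use crt(2) \<Phi>l in \<open>simp add: e\<close>)
    from dvd_add[OF this s] have "D1 dvd diag_quad \<nu> b A (\<Phi> u) - m" by simp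
    moreover have "D2 dvd diag_quad \<nu> b A (\<Phi> u) - diag_quad \<nu> b A t"
      unfolding diag_quad_def by (rule diag_quad_cong_mod) (use crt(3) \<Phi>l in \<open>simp add: e\<close>)
    from dvd_add[OF this t] have "D2 dvd diag_quad \<nu> b A (\<Phi> u) - m" by simp
    ultimately show "\<Phi> u \<in> sols_mod \<nu> b A (D1 * D2) m"
      using cop by (simp add: sols_mod_def divides_mult)
  qed
  ultimately have "card (sols_mod \<nu> b A D1 m \<times> sols_mod \<nu> b A D2 m) \<le> card (sols_mod \<nu> b A (D1 * D2) m)"
    by (intro card_inj_on_le) auto
  then show ?thesis by (simp add: card_cartesian_product)
qed

text \<open>A lower bound for the number of solutions modulo powers of \<open>p\<close>, relative to
  the expected number. The 5 comes from \<open>(p - 2) * (p - 3) >= p^2 - 5 * p\<close>; at primes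
  dividing \<open>k\<close> the equation is linear modulo \<open>p\<close> and nothing is
  lost.\<close>

definition local_factor :: "int \<Rightarrow> nat \<Rightarrow> real" where
  "local_factor k p = (if int p dvd k then 1 else 1 - 5 / real p)"

text \<open>A prime dividing \<open>k\<close> is handled through a linear coordinate, any other
  prime through the conic count. In both cases smooth solutions modulo \<open>p\<close> lift, and
  coprime prime powers multiply. The bound is uniform in \<open>m\<close>: no residue class is
  obstructed.\<close>

lemma card_sols_mod_ge:
  fixes b A :: "nat \<Rightarrow> int" and k m :: int and D :: nat
  assumes \<nu>: "\<nu> \<ge> 3"
    and kA: "\<And>i. i < \<nu> \<Longrightarrow> k dvd A i"
    and good: "\<And>p. prime p \<Longrightarrow> \<not> int p dvd k \<Longrightarrow> p \<ge> 7 \<and> (\<forall>i<\<nu>. \<not> int p dvd A i)"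
    and bad: "\<And>p. prime p \<Longrightarrow> int p dvd k \<Longrightarrow> \<exists>i<\<nu>. \<not> int p dvd b i"
    and D: "D > 0"
  shows "real D ^ (\<nu> - 1) * (\<Prod>p\<in>prime_factors D. local_factor k p) \<le> real (card (sols_mod \<nu> b A (int D) m))"
proof -
  have loc: "local_factor k p \<ge> 0" if "prime p" for p
    using good[OF that] by (auto simp: local_factor_def divide_le_eq)
  have pp: "real (p ^ Suc j) ^ (\<nu> - 1) * local_factor k p \<le> real (card (sols_mod \<nu> b A (int p ^ Suc j) m))"
    if p: "prime p" for p j
  proof -
    have pi: "prime (int p)" using p by simp
    have lift: "real (card (smooth_sols \<nu> b A (int p) m i)) * real (p ^ j) ^ (\<nu> - 1) \<le> real (card (sols_mod \<nu> b A (int p ^ Suc j) m))"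
      if "i < \<nu>" for i
      using card_sols_mod_prime_power_ge[OF pi that, of b A m j]
      by (simp flip: of_nat_power of_nat_mult add: nat_power_eq del: power_Suc)
    have base: "real p ^ (\<nu> - 1) * local_factor k p \<le> real (card (smooth_sols \<nu> b A (int p) m i)) \<Longrightarrow> i < \<nu> \<Longrightarrow> ?thesis" for i
    proof -
      assume *: "real p ^ (\<nu> - 1) * local_factor k p \<le> real (card (smooth_sols \<nu> b A (int p) m i))" and "i < \<nu>"
      have "real (p ^ Suc j) ^ (\<nu> - 1) * local_factor k p = (real p ^ (\<nu> - 1) * local_factor k p) * real (p ^ j) ^ (\<nu> - 1)"
        by (simp add: power_mult_distrib)
      also have "\<dots> \<le> real (card (smooth_sols \<nu> b A (int p) m i)) * real (p ^ j) ^ (\<nu> - 1)"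
        by (intro mult_right_mono *) auto
      also have "\<dots> \<le> real (card (sols_mod \<nu> b A (int p ^ Suc j) m))" by (rule lift) fact
      finally show ?thesis .
    qed
    show ?thesis
    proof (cases "int p dvd k")
      case True
      then obtain i where i: "i < \<nu>" "\<not> int p dvd b i" using bad p by blast
      have "nat (int p) ^ (\<nu> - 1) \<le> card (smooth_sols \<nu> b A (int p) m i)"
        using True kA dvd_trans i by (intro card_smooth_sols_linear pi) blast+
      then have "real p ^ (\<nu> - 1) \<le> real (card (smooth_sols \<nu> b A (int p) m i))"
        by (simp flip: of_nat_power)
      then show ?thesis using True i by (intro base[of i]) (auto simp: local_factor_def)
    next
      case False
      then have p7: "p \<ge> 7" and pA: "\<And>i. i < \<nu> \<Longrightarrow> \<not> int p dvd A i" using good p by auto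
      have "(int p - 2) * (int p - 3) * int p ^ (\<nu> - 3) \<le> int (card (smooth_sols \<nu> b A (int p) m 0))"
        using p7 \<nu> pA by (intro card_smooth_sols_ternary pi) auto
      then have 1: "real_of_int ((int p - 2) * (int p - 3) * int p ^ (\<nu> - 3)) \<le> real_of_int (int (card (smooth_sols \<nu> b A (int p) m 0)))"
        by (simp only: of_int_le_iff)
      have "\<nu> - 1 = 2 + (\<nu> - 3)" using \<nu> by simp
      then have "real p ^ (\<nu> - 1) * (1 - 5 / real p) = (real p)\<^sup>2 * (1 - 5 / real p) * real p ^ (\<nu> - 3)"
        by (simp only: power_add) simp
      also have "(real p)\<^sup>2 * (1 - 5 / real p) = real p * real p - 5 * real p"
        using p7 by (simp add: field_simps power2_eq_square)
      also have "(real p * real p - 5 * real p) * real p ^ (\<nu> - 3) \<le> ((real p - 2) * (real p - 3)) * real p ^ (\<nu> - 3)"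
        by (intro mult_right_mono) (auto simp: algebra_simps)
      also have "\<dots> \<le> real (card (smooth_sols \<nu> b A (int p) m 0))"
        using 1 by simp
      finally show ?thesis using False \<nu> by (intro base[of 0]) (auto simp: local_factor_def)
    qed
  qed
  have gen: "real (\<Prod>p\<in>S. p ^ e p) ^ (\<nu> - 1) * (\<Prod>p\<in>S. local_factor k p) \<le> real (card (sols_mod \<nu> b A (int (\<Prod>p\<in>S. p ^ e p)) m))"
    if "finite S" "\<And>p. p \<in> S \<Longrightarrow> prime p \<and> e p > 0" for S and e :: "nat \<Rightarrow> nat"
    using that
  proof (induction S rule: finite_induct)
    case empty
    have "(\<lambda>l\<in>{..<\<nu>}. 0) \<in> sols_mod \<nu> b A 1 m"
      by (simp add: sols_mod_def PiE_iff)
    then have "card (sols_mod \<nu> b A 1 m) > 0" by (auto simp: card_gt_0_iff)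
    then show ?case by simp
  next
    case (insert q S)
    define X where "X = (\<Prod>p\<in>S. p ^ e p)"
    have q: "prime q" "e q > 0" using insert.prems by auto
    have prS: "prime p" if "p \<in> S" for p using insert.prems that by auto
    then have X0: "X > 0" unfolding X_def by (intro prod_pos) (auto simp: prime_gt_0_nat)
    have "coprime (q ^ e q) X"
      unfolding X_def
    proof (rule prod_coprime_right)
      fix p assume "p \<in> S"
      then have "coprime q p" using q prS insert.hyps by (intro primes_coprime) auto
      then show "coprime (q ^ e q) (p ^ e p)" by (simp add: coprime_power_left_iff coprime_power_right_iff)
    qed
    then have cop: "coprime (int (q ^ e q)) (int X)" by (simp only: coprime_int_iff)
    have "real (q ^ e q * X) ^ (\<nu> - 1) * (local_factor k q * (\<Prod>p\<in>S. local_factor k p)) =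
       (real (q ^ e q) ^ (\<nu> - 1) * local_factor k q) * (real X ^ (\<nu> - 1) * (\<Prod>p\<in>S. local_factor k p))"
      by (simp add: power_mult_distrib)
    also have "\<dots> \<le> real (card (sols_mod \<nu> b A (int (q ^ e q)) m)) * real (card (sols_mod \<nu> b A (int X) m))"
    proof (intro mult_mono)
      obtain j where "e q = Suc j" using q(2) gr0_implies_Suc by blast
      then show "real (q ^ e q) ^ (\<nu> - 1) * local_factor k q \<le> real (card (sols_mod \<nu> b A (int (q ^ e q)) m))"
        using pp[OF q(1), of j] by (simp del: power_Suc)
      show "real X ^ (\<nu> - 1) * (\<Prod>p\<in>S. local_factor k p) \<le> real (card (sols_mod \<nu> b A (int X) m))"
        unfolding X_def using insert.prems by (intro insert.IH) auto
    qed (auto intro!: mult_nonneg_nonneg prod_nonneg loc prS)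
    also have "\<dots> \<le> real (card (sols_mod \<nu> b A (int (q ^ e q) * int X) m))"
    proof -
      have "q > 0" using q prime_gt_0_nat by blast
      then have "card (sols_mod \<nu> b A (int (q ^ e q)) m) * card (sols_mod \<nu> b A (int X) m)
          \<le> card (sols_mod \<nu> b A (int (q ^ e q) * int X) m)"
        using X0 by (intro card_sols_mod_mult cop) auto
      then show ?thesis unfolding of_nat_mult[symmetric] of_nat_le_iff .
    qed
    finally show ?case using insert.hyps by (simp add: X_def)
  qed
  have pf: "prime p \<and> multiplicity p D > 0" if "p \<in> prime_factors D" for p
    using that D by (simp add: prime_factors_multiplicity)
  have "real (\<Prod>p\<in>prime_factors D. p ^ multiplicity p D) ^ (\<nu> - 1) * (\<Prod>p\<in>prime_factors D. local_factor k p)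
     \<le> real (card (sols_mod \<nu> b A (int (\<Prod>p\<in>prime_factors D. p ^ multiplicity p D)) m))"
    by (rule gen) (simp, rule pf)
  moreover have "(\<Prod>p\<in>prime_factors D. p ^ multiplicity p D) = D"
    using D by (simp add: prime_factorization_nat[symmetric])
  ultimately show ?thesis by simp
qed

section \<open>The product over small primes\<close>

definition sieve_product :: "nat \<Rightarrow> real" where
  "sieve_product P = (\<Prod>p | prime p \<and> 7 \<le> p \<and> p \<le> P. 1 - 5 / real p)"

lemma prod_primes_dvd:
  fixes n :: nat
  assumes "finite Q" "\<And>p. p \<in> Q \<Longrightarrow> prime p \<and> p dvd n"
  shows "\<Prod>Q dvd n"
  using assms
proof (induction Q rule: finite_induct)
  case (insert q Q)
  have "coprime q (\<Prod>Q)"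
    using insert.prems insert.hyps by (intro prod_coprime_right primes_coprime) auto
  then show ?case using insert by (simp add: divides_mult)
qed simp

text \<open>Chebyshev's argument: with \<open>y = 2^J\<close>, the primes in \<open>(y, 2y]\<close>
  all divide the central binomial coefficient, which is at most \<open>2^(2y)\<close>, and each of
  them exceeds \<open>y\<close>.\<close>

lemma card_primes_dyadic:
  "J * card {p. prime p \<and> 2 ^ J < p \<and> p \<le> (2::nat) ^ Suc J} \<le> 2 ^ Suc J"
proof -
  define y where "y = (2::nat) ^ J"
  define Q where "Q = {p. prime p \<and> y < p \<and> p \<le> 2 * y}"
  have fin: "finite Q" unfolding Q_def by (rule finite_subset[of _ "{..2*y}"]) auto
  have "p dvd ((2 * y) choose y)" if "p \<in> Q" for p
  proof -
    have p: "prime p" "y < p" "p \<le> 2 * y" using that by (auto simp: Q_def)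
    have "fact y * fact (2 * y - y) * ((2 * y) choose y) = fact (2 * y)"
      by (rule binomial_fact_lemma) simp
    moreover have "p dvd fact (2 * y)" using p by (simp add: prime_dvd_fact_iff)
    moreover have "\<not> p dvd (fact y :: nat)" using p by (simp add: prime_dvd_fact_iff)
    ultimately show ?thesis using p(1) by (metis add_diff_cancel_right' mult_2 prime_dvd_mult_iff)
  qed
  then have "\<Prod>Q dvd ((2 * y) choose y)"
    using fin by (intro prod_primes_dvd) (auto simp: Q_def)
  then have "\<Prod>Q \<le> ((2 * y) choose y)" by (intro dvd_imp_le) auto
  also have "\<dots> \<le> (\<Sum>k\<le>2 * y. (2 * y) choose k)"
    by (rule member_le_sum) auto
  also have "\<dots> = 2 ^ (2 * y)" by (rule choose_row_sum)
  finally have "\<Prod>Q \<le> 2 ^ (2 * y)" .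
  moreover have "y ^ card Q \<le> \<Prod>Q"
    using prod_mono[of Q "\<lambda>_. y" "\<lambda>p. p"] by (simp add: Q_def less_imp_le)
  ultimately have "(2::nat) ^ (J * card Q) \<le> 2 ^ (2 * y)" by (simp add: y_def power_mult)
  then show ?thesis by (simp add: Q_def y_def)
qed

lemma sieve_product_pos: "sieve_product P > 0"
  unfolding sieve_product_def by (intro prod_pos) (auto simp: field_simps)

text \<open>The new block has at most \<open>2^(J+1) / J\<close> factors, each at least
  \<open>1 - 5 / 2^J\<close>, and Bernoulli's inequality combines them. The condition
  \<open>J >= 3\<close> places the block beyond the cutoff 7.\<close>

lemma sieve_product_double:
  assumes "J \<ge> 3"
  shows "sieve_product (2 ^ Suc J) \<ge> sieve_product (2 ^ J) * (1 - 10 / real J)"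
proof -
  define T where "T = {p. prime p \<and> 7 \<le> p \<and> p \<le> (2::nat) ^ J}"
  define Q where "Q = {p. prime p \<and> 2 ^ J < p \<and> p \<le> (2::nat) ^ Suc J}"
  have J8: "(2::nat) ^ J \<ge> 8" using power_increasing[OF assms, of "2::nat"] by simp
  have fin: "finite T" "finite Q"
    unfolding T_def Q_def by (rule finite_subset[of _ "{..2 ^ Suc J}"]; auto)+
  have "{p. prime p \<and> 7 \<le> p \<and> p \<le> (2::nat) ^ Suc J} = T \<union> Q"
    using J8 by (auto simp: T_def Q_def)
  then have "sieve_product (2 ^ Suc J) = (\<Prod>p\<in>T \<union> Q. 1 - 5 / real p)"
    by (simp only: sieve_product_def)
  also have "\<dots> = (\<Prod>p\<in>T. 1 - 5 / real p) * (\<Prod>p\<in>Q. 1 - 5 / real p)"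
    using fin by (intro prod.union_disjoint) (auto simp: T_def Q_def)
  also have "(\<Prod>p\<in>T. 1 - 5 / real p) = sieve_product (2 ^ J)"
    by (simp only: sieve_product_def T_def)
  finally have 1: "sieve_product (2 ^ Suc J) = sieve_product (2 ^ J) * (\<Prod>p\<in>Q. 1 - 5 / real p)" .
  define x where "x = 5 / (2::real) ^ J"
  have "(8::real) \<le> 2 ^ J" using J8 by (metis of_nat_le_iff of_nat_numeral of_nat_power)
  then have x: "x \<le> 1" "x \<ge> 0" by (auto simp: x_def)
  have "real J * card Q \<le> 2 ^ Suc J"
    using card_primes_dyadic[of J] unfolding Q_def[symmetric]
    by (metis of_nat_le_iff of_nat_mult of_nat_numeral of_nat_power)
  then have "card Q * x \<le> 10 / real J"
    using assms by (simp add: x_def field_simps)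
  then have "1 - 10 / real J \<le> 1 + card Q * (- x)" by simp
  also have "\<dots> \<le> (1 + (- x)) ^ card Q"
    using x by (intro Bernoulli_inequality) simp
  also have "\<dots> = (\<Prod>p\<in>Q. 1 - x)" by simp
  also have "\<dots> \<le> (\<Prod>p\<in>Q. 1 - 5 / real p)"
  proof (intro prod_mono conjI)
    fix p assume "p \<in> Q"
    then have "2 ^ J \<le> p" by (auto simp: Q_def)
    then have "(2::real) ^ J \<le> real p" by (metis of_nat_le_iff of_nat_numeral of_nat_power)
    then show "1 - x \<le> 1 - 5 / real p"
      unfolding x_def by (intro diff_left_mono divide_left_mono mult_pos_pos) (auto intro: less_le_trans[of _ "2 ^ J"])
    show "0 \<le> 1 - x" using x by simp
  qed
  finally show ?thesis
    unfolding 1 using sieve_product_pos by (intro mult_left_mono) (auto simp: less_imp_le)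
qed

text \<open>Over a dyadic block the product shrinks by a factor that tends to 1, while
  \<open>P\<close> doubles. Hence \<open>P * (sieve_product P)^2\<close> eventually grows
  geometrically along powers of two.\<close>

lemma sieve_product_slow_decay:
  assumes "c > 0"
  obtains P where "P \<ge> 2" "1 / real P \<le> c * (sieve_product P)\<^sup>2"
proof -
  define s where "s = (\<lambda>J. 2 ^ J * (sieve_product (2 ^ J))\<^sup>2)"
  have s0: "s J > 0" for J using sieve_product_pos[of "2 ^ J"] by (simp add: s_def)
  \<comment> \<open>From \<open>J = 100\<close> on the factor is at least \<open>9/10\<close>, and
    \<open>2 * (9/10)^2 = 1.62\<close> exceeds \<open>3/2\<close>.\<close>
  have step: "s (Suc J) \<ge> 3 / 2 * s J" if "J \<ge> 100" for J
  proof -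
    have h: "(9 / 10 :: real) \<le> 1 - 10 / real J" using that by (simp add: field_simps)
    have "sieve_product (2 ^ J) * (9 / 10) \<le> sieve_product (2 ^ J) * (1 - 10 / real J)"
      using h sieve_product_pos by (intro mult_left_mono) (auto simp: less_imp_le)
    also have "\<dots> \<le> sieve_product (2 ^ Suc J)" using that by (intro sieve_product_double) simp
    finally have "(sieve_product (2 ^ J) * (9 / 10))\<^sup>2 \<le> (sieve_product (2 ^ Suc J))\<^sup>2"
      using sieve_product_pos[of "2 ^ J"] by (intro power_mono) auto
    then have "2 ^ Suc J * (sieve_product (2 ^ J) * (9 / 10))\<^sup>2 \<le> s (Suc J)"
      unfolding s_def by (intro mult_left_mono) auto
    moreover have "2 ^ Suc J * (sieve_product (2 ^ J) * (9 / 10))\<^sup>2 = 162 / 100 * s J"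
      by (simp add: s_def power_mult_distrib power2_eq_square)
    ultimately show ?thesis using s0[of J] by simp
  qed
  have grow: "(3 / 2) ^ i * s 100 \<le> s (100 + i)" for i
  proof (induction i)
    case (Suc i)
    have "(3 / 2) ^ Suc i * s 100 \<le> 3 / 2 * s (100 + i)" using Suc by simp
    also have "\<dots> \<le> s (100 + Suc i)" using step[of "100 + i"] by simp
    finally show ?case .
  qed simp
  obtain i where "1 / (c * s 100) < (3 / 2 :: real) ^ i"
    using real_arch_pow[of "3 / 2"] by auto
  then have "1 < (3 / 2) ^ i * s 100 * c" using assms s0[of 100] by (simp add: field_simps)
  also have "\<dots> \<le> s (100 + i) * c" using grow assms by (intro mult_right_mono) auto
  finally have "1 / 2 ^ (100 + i) \<le> c * (sieve_product (2 ^ (100 + i)))\<^sup>2"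
    unfolding s_def by (simp add: field_simps)
  moreover have "(2::nat) ^ 1 \<le> 2 ^ (100 + i)" by (intro power_increasing) auto
  ultimately show thesis by (intro that[of "2 ^ (100 + i)"]) auto
qed

section \<open>Lower bounds for the averaged representation count\<close>

lemma card_residue_class_ge:
  fixes l r D :: int and s :: nat
  assumes "D > 0"
  shows "real s / D - 1 \<le> real (card {t\<in>{l..<l + int s}. D dvd t - r})"
proof -
  define f where "f = (\<lambda>j. l + (r - l) mod D + j * D)"
  define n where "n = int s div D"
  have "inj_on f {0..<n}" using assms by (auto simp: f_def inj_on_def)
  moreover have "f ` {0..<n} \<subseteq> {t\<in>{l..<l + int s}. D dvd t - r}"
  proof (rule image_subsetI)
    fix j assume j: "j \<in> {0..<n}"
    have m: "0 \<le> (r - l) mod D" "(r - l) mod D < D" using assms by auto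
    have "(j + 1) * D \<le> n * D" using j assms by (intro mult_right_mono) auto
    also have "n * D \<le> int s"
      using assms mult_div_mod_eq[of D "int s"] pos_mod_sign[of D "int s"] unfolding n_def mult.commute[of _ D] by linarith
    finally have "f j < l + int s" using m by (simp add: f_def algebra_simps)
    moreover have "l \<le> f j" using m j assms by (simp add: f_def)
    moreover have "D dvd f j - r"
    proof -
      have "D dvd (r - l) mod D - (r - l)" by (simp add: mod_eq_dvd_iff[symmetric])
      then have "D dvd ((r - l) mod D - (r - l)) + j * D" by (rule dvd_add) simp
      then show ?thesis by (simp add: f_def algebra_simps)
    qed
    ultimately show "f j \<in> {t\<in>{l..<l + int s}. D dvd t - r}" by simp
  qed
  moreover have "finite {t\<in>{l..<l + int s}. D dvd t - r}"
    by (rule finite_subset[of _ "{l..<l + int s}"]) auto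
  ultimately have "card {0..<n} \<le> card {t\<in>{l..<l + int s}. D dvd t - r}"
    by (rule card_inj_on_le)
  moreover have "real s / D - 1 \<le> real_of_int n"
    using floor_divide_of_int_eq[of "int s" D, where ?'a = real] unfolding n_def by simp linarith
  ultimately show ?thesis by simp
qed

text \<open>Sufficiently many representations are exhibited. The variables other than
  \<open>i0\<close> lie in \<open>[w, 2w)\<close> with \<open>w = Y / H\<close>, too small to move
  the value by more than \<open>a * Y^2 / 16\<close>. The variable \<open>i0\<close> then has a
  block of \<open>s0\<close> consecutive values for which the polynomial falls at most
  \<open>J * D\<close> short of \<open>m\<close>. Taking all variables in the classes of a solution
  modulo \<open>D\<close> makes the shortfall a multiple \<open>i * D\<close> with
  \<open>i < J\<close>. Finally every \<open>t\<close> in \<open>[w, Y)\<close> has at least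
  \<open>w\<close> decompositions \<open>x + y\<close>.\<close>

lemma rep_count_avg_lower:
  fixes A b :: "nat \<Rightarrow> int" and \<nu> H w D J i0 Y :: nat and m a :: int
  assumes i0: "i0 < \<nu>" and a: "a = A i0" "a > 0" and H: "H \<ge> 8" "even H"
    and HA: "128 * (\<Sum>l<\<nu>. \<bar>A l\<bar>) \<le> (int H)\<^sup>2"
    and wb: "64 * (\<Sum>l<\<nu>. \<bar>b l\<bar>) \<le> int w" and w: "w \<ge> 1" "w \<ge> 2 * D" and D: "D > 0"
    and Y: "Y = H * w" and J: "12 * a * int Y \<le> int J" "2 * J * D \<le> Y\<^sup>2"
    and m: "3 * a * (int Y)\<^sup>2 \<le> 8 * m" "8 * m \<le> 5 * a * (int Y)\<^sup>2"
  shows "real (card (sols_mod \<nu> b A (int D) m)) * (real w ^ \<nu> * (w / (2 * D)) ^ (\<nu> - 1) * (J / (12 * a * Y)))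
     \<le> (\<Sum>i<J. real (rep_count \<nu> b A Y (m - int (i * D))))"
proof -
  let ?I = "{..<\<nu>} - {i0}"
  let ?g = "\<lambda>l x. b l * x + A l * x\<^sup>2"
  let ?f = "\<lambda>x. b i0 * x + a * x\<^sup>2"
  have Y0: "Y \<ge> 8" "Y > 0"
    using H w mult_le_mono[of 8 H 1 w] by (auto simp: Y)
  have b0: "64 * \<bar>b i0\<bar> \<le> int w"
    using member_le_sum[of i0 "{..<\<nu>}" "\<lambda>l. \<bar>b l\<bar>"] i0 wb by simp
  have wY: "8 * int w \<le> int Y" using H by (simp add: Y mult_right_mono)
  have b0Y: "512 * \<bar>b i0\<bar> \<le> int Y" using b0 wY by linarith
  define U where "U = (\<lambda>u. \<Sum>l\<in>?I. ?g l (u l))"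
  have U: "16 * \<bar>U u\<bar> \<le> a * (int Y)\<^sup>2" if u: "\<forall>l\<in>?I. u l \<in> {int w..<int w + int w}" for u
  proof -
    have t: "0 \<le> u l" "u l \<le> 2 * int w" if "l \<in> ?I" for l using u that by force+
    have "\<bar>U u\<bar> \<le> (\<Sum>l\<in>?I. \<bar>?g l (u l)\<bar>)" unfolding U_def by (rule sum_abs)
    also have "\<dots> \<le> (\<Sum>l\<in>?I. \<bar>b l\<bar> * (2 * int w) + \<bar>A l\<bar> * (2 * int w)\<^sup>2)"
    proof (intro sum_mono)
      fix l assume l: "l \<in> ?I"
      have "\<bar>?g l (u l)\<bar> \<le> \<bar>b l\<bar> * \<bar>u l\<bar> + \<bar>A l\<bar> * (u l)\<^sup>2"
        by (rule order_trans[OF abs_triangle_ineq]) (simp add: abs_mult)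
      also have "\<dots> \<le> \<bar>b l\<bar> * (2 * int w) + \<bar>A l\<bar> * (2 * int w)\<^sup>2"
        using t[OF l] by (intro add_mono mult_left_mono power_mono) auto
      finally show "\<bar>?g l (u l)\<bar> \<le> \<bar>b l\<bar> * (2 * int w) + \<bar>A l\<bar> * (2 * int w)\<^sup>2" .
    qed
    also have "\<dots> \<le> (\<Sum>l<\<nu>. \<bar>b l\<bar> * (2 * int w) + \<bar>A l\<bar> * (2 * int w)\<^sup>2)"
      by (intro sum_mono2) auto
    also have "\<dots> = (\<Sum>l<\<nu>. \<bar>b l\<bar>) * (2 * int w) + (\<Sum>l<\<nu>. \<bar>A l\<bar>) * (2 * int w)\<^sup>2"
      by (simp add: sum.distrib sum_distrib_right)
    finally have "32 * \<bar>U u\<bar> \<le> (64 * (\<Sum>l<\<nu>. \<bar>b l\<bar>)) * int w + (128 * (\<Sum>l<\<nu>. \<bar>A l\<bar>)) * (int w)\<^sup>2"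
      by (simp add: power2_eq_square algebra_simps)
    also have "\<dots> \<le> int w * int w + (int H)\<^sup>2 * (int w)\<^sup>2"
      using wb HA by (intro add_mono mult_right_mono) auto
    also have "\<dots> \<le> 2 * (int Y)\<^sup>2"
    proof -
      have "int w * int w \<le> int Y * int Y" using wY by (intro mult_mono) auto
      then show ?thesis by (simp add: Y power2_eq_square algebra_simps)
    qed
    also have "\<dots> \<le> 2 * (a * (int Y)\<^sup>2)"
      using a mult_right_mono[of 1 a "(int Y)\<^sup>2"] by simp
    finally show ?thesis by simp
  qed
  \<comment> \<open>In coordinate \<open>i0\<close> a unit step changes the value by at most
    \<open>3 * a * Y\<close>, so \<open>s0\<close> steps change it by at most
    \<open>J * D\<close>.\<close>
  define s0 where "s0 = nat \<lfloor>real (J * D) / (3 * a * Y)\<rfloor>"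
  have s0r: "real s0 \<le> real (J * D) / (3 * a * Y)" "real (J * D) / (3 * a * Y) - 1 \<le> real s0"
  proof -
    have "real (J * D) / (3 * a * Y) \<ge> 0" using a by simp
    then have "real s0 = of_int \<lfloor>real (J * D) / (3 * a * Y)\<rfloor>" by (simp add: s0_def)
    then show "real s0 \<le> real (J * D) / (3 * a * Y)" "real (J * D) / (3 * a * Y) - 1 \<le> real s0" by linarith+
  qed
  have s0J: "int s0 * (3 * a * int Y) \<le> int (J * D)"
  proof -
    have "real s0 * (3 * a * Y) \<le> real (J * D)"
      using s0r(1) a Y0 by (simp add: pos_le_divide_eq)
    then have "real_of_int (int s0 * (3 * a * int Y)) \<le> real_of_int (int (J * D))" by simp
    then show ?thesis by (simp only: of_int_le_iff)
  qed
  have s0Y: "6 * int s0 \<le> int Y"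
  proof -
    have "int s0 * (3 * 1 * int Y) \<le> int s0 * (3 * a * int Y)"
      using a by (intro mult_left_mono mult_right_mono) auto
    also note s0J
    finally have "2 * (int s0 * (3 * int Y)) \<le> 2 * int (J * D)" unfolding mult_1_right by (rule mult_left_mono) simp
    also have "\<dots> \<le> int Y * int Y"
      using J(2) by (simp add: power2_eq_square flip: of_nat_mult)
    finally have "(6 * int s0) * int Y \<le> int Y * int Y" by (simp add: algebra_simps)
    then show ?thesis using Y0 by simp
  qed
  have mono: "?f x \<le> ?f y" if "\<bar>b i0\<bar> \<le> x" "x \<le> y" for x y
  proof -
    have "?f y - ?f x = (y - x) * (b i0 + a * (y + x))" by (rule quad_diff_factor)
    also have "\<dots> \<ge> 0"
    proof (rule mult_nonneg_nonneg)
      have "1 * (y + x) \<le> a * (y + x)" using that a by (intro mult_right_mono) auto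
      moreover have "- x \<le> b i0" "0 \<le> x" using that by linarith+
      then have "0 \<le> b i0 + (y + x)" using that by linarith
      ultimately show "0 \<le> b i0 + a * (y + x)" by simp
    qed (use that in simp)
    finally show ?thesis by simp
  qed
  \<comment> \<open>The target \<open>m - U u\<close> lies between 5/16 and 11/16 of
    \<open>a * Y^2\<close>, whereas the polynomial in \<open>t\<close> is about a quarter of it at
    \<open>t = Y / 2\<close> (an integer, as \<open>H\<close> is even) and about all of it at
    \<open>t = Y\<close>. So a last \<open>t\<close> not above the target exists in between, and by
    monotonicity the block ending there stays below the target.\<close>
  have top: "\<exists>ts. 2 * ts \<ge> int Y \<and> ts < int Y \<and> (\<forall>t. ts + 1 - int s0 \<le> t \<and> t \<le> ts \<longrightarrow>
       ?f t + U u \<le> m \<and> m < ?f t + U u + int (J * D))"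
    if u: "\<forall>l\<in>?I. u l \<in> {int w..<int w + int w}" for u
  proof -
    define m' where "m' = m - U u"
    define Q where "Q = a * (int Y)\<^sup>2"
    have m': "5 * Q \<le> 16 * m'" "16 * m' \<le> 11 * Q"
      using U[OF u] m by (auto simp: m'_def Q_def)
    define h where "h = int Y div 2"
    have h: "2 * h = int Y" using H by (simp add: h_def Y)
    have bY: "512 * (\<bar>b i0\<bar> * int Y) \<le> Q"
    proof -
      have "(512 * \<bar>b i0\<bar>) * int Y \<le> int Y * int Y" using b0Y by (intro mult_right_mono) auto
      also have "\<dots> \<le> a * (int Y * int Y)" using a mult_right_mono[of 1 a "int Y * int Y"] by simp
      finally show ?thesis by (simp add: Q_def power2_eq_square algebra_simps)
    qed
    have Q0: "Q > 0" using a Y0 by (simp add: Q_def)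
    have gh: "?f h \<le> m'"
    proof -
      have "4 * ?f h = 2 * (b i0 * int Y) + Q"
        unfolding Q_def h[symmetric] by (simp add: power2_eq_square algebra_simps)
      moreover have "b i0 * int Y \<le> \<bar>b i0\<bar> * int Y" by (intro mult_right_mono) auto
      moreover have "x \<le> m'" if "4 * x = 2 * y + Q" "y \<le> z" "512 * z \<le> Q" for x y z
        using that m' Q0 by linarith
      ultimately show ?thesis using bY by blast
    qed
    have gY: "\<not> ?f (int Y) \<le> m'"
    proof -
      have "?f (int Y) = b i0 * int Y + Q" by (simp add: Q_def)
      moreover have "- (\<bar>b i0\<bar> * int Y) \<le> b i0 * int Y"
        using mult_right_mono[of "- \<bar>b i0\<bar>" "b i0" "int Y"] by simp
      ultimately show ?thesis using m' bY Q0 by linarith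
    qed
    define T where "T = {t\<in>{h..int Y}. ?f t \<le> m'}"
    have finT: "finite T" unfolding T_def by (rule finite_subset[of _ "{h..int Y}"]) auto
    have "h \<in> T" using gh h Y0 by (simp add: T_def)
    define ts where "ts = Max T"
    have ts: "ts \<in> T" "\<And>t. t \<in> T \<Longrightarrow> t \<le> ts"
      unfolding ts_def by (rule Max_in[OF finT], use \<open>h \<in> T\<close> in blast) (rule Max_ge[OF finT])
    have ts1: "h \<le> ts" "ts \<le> int Y" "?f ts \<le> m'" using ts(1) by (auto simp: T_def)
    have "ts \<noteq> int Y" using ts1(3) gY by blast
    then have tsY: "ts < int Y" using ts1 by simp
    have nx: "m' < ?f (ts + 1)"
    proof (rule ccontr)
      assume "\<not> m' < ?f (ts + 1)"
      then have "ts + 1 \<in> T" using ts1 tsY by (simp add: T_def)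
      from ts(2)[OF this] show False by simp
    qed
    have "?f t \<le> m' \<and> m' < ?f t + int (J * D)" if t: "ts + 1 - int s0 \<le> t" "t \<le> ts" for t
    proof
      have bt: "\<bar>b i0\<bar> \<le> t" using t ts1 h s0Y b0Y by linarith
      show "?f t \<le> m'" using mono[OF bt t(2)] ts1(3) by linarith
      have "?f (ts + 1) - ?f t = (ts + 1 - t) * (b i0 + a * (ts + 1 + t))" by (rule quad_diff_factor)
      also have "\<dots> \<le> int s0 * (3 * a * int Y)"
      proof (rule mult_mono)
        have "a * (ts + 1 + t) \<le> a * (2 * int Y)" using a t tsY by (intro mult_left_mono) auto
        moreover have "b i0 \<le> a * int Y" using b0Y a mult_right_mono[of 1 a "int Y"] by linarith
        ultimately show "b i0 + a * (ts + 1 + t) \<le> 3 * a * int Y" by (simp add: algebra_simps)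
        have "1 * (ts + 1 + t) \<le> a * (ts + 1 + t)" using a ts1 h bt by (intro mult_right_mono) auto
        moreover have "- t \<le> b i0" using bt by linarith
        then have "0 \<le> b i0 + (ts + 1 + t)" using ts1(1) h by linarith
        ultimately show "0 \<le> b i0 + a * (ts + 1 + t)" by simp
      qed (use t in auto)
      finally show "m' < ?f t + int (J * D)" using nx s0J by linarith
    qed
    then show ?thesis
      using h ts1 tsY by (intro exI[of _ ts]) (auto simp: m'_def algebra_simps)
  qed
  define TS where "TS = (\<lambda>u. SOME ts. 2 * ts \<ge> int Y \<and> ts < int Y \<and> (\<forall>t. ts + 1 - int s0 \<le> t \<and> t \<le> ts \<longrightarrow>
       ?f t + U u \<le> m \<and> m < ?f t + U u + int (J * D)))"
  define Us where "Us = (\<lambda>r. (\<Pi>\<^sub>E l\<in>?I. {x\<in>{int w..<int w + int w}. int D dvd x - r l}))"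
  define Xs where "Xs = (\<lambda>r u. {x\<in>{TS u + 1 - int s0..<TS u + 1 - int s0 + int s0}. int D dvd x - r i0})"
  have TS: "2 * TS u \<ge> int Y" "TS u < int Y"
    "\<And>t. TS u + 1 - int s0 \<le> t \<Longrightarrow> t \<le> TS u \<Longrightarrow> ?f t + U u \<le> m \<and> m < ?f t + U u + int (J * D)"
    if "u \<in> Us r" for u r
  proof -
    have "\<forall>l\<in>?I. u l \<in> {int w..<int w + int w}"
      using PiE_mem[OF \<open>u \<in> Us r\<close>[unfolded Us_def]] by blast
    from someI_ex[OF top[OF this]]
    show "2 * TS u \<ge> int Y" "TS u < int Y"
      "\<And>t. TS u + 1 - int s0 \<le> t \<Longrightarrow> t \<le> TS u \<Longrightarrow> ?f t + U u \<le> m \<and> m < ?f t + U u + int (J * D)"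
      unfolding TS_def by blast+
  qed
  have finUs: "finite (Us r)" for r
    unfolding Us_def by (intro finite_PiE) (auto intro: finite_subset[of _ "{int w..<int w + int w}"])
  have finXs: "finite (Xs r u)" for r u
    unfolding Xs_def by (rule finite_subset[of _ "{TS u + 1 - int s0..<TS u + 1 - int s0 + int s0}"]) auto
  have cU: "(w / (2 * D)) ^ (\<nu> - 1) \<le> real (card (Us r))" for r
  proof -
    have "(w / (2 * D)) ^ (\<nu> - 1) = (\<Prod>l\<in>?I. w / (2 * D))" using i0 by simp
    also have "\<dots> \<le> (\<Prod>l\<in>?I. real (card {x\<in>{int w..<int w + int w}. int D dvd x - r l}))"
    proof (intro prod_mono conjI)
      fix l
      have "w / (2 * D) \<le> real w / real_of_int (int D) - 1"
      proof -
        have "2 * real D \<le> real w" using w(2) by linarith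
        then show ?thesis using D by (simp add: field_simps)
      qed
      also have "\<dots> \<le> real (card {x\<in>{int w..<int w + int w}. int D dvd x - r l})"
        using D by (intro card_residue_class_ge) simp
      finally show "w / (2 * D) \<le> real (card {x\<in>{int w..<int w + int w}. int D dvd x - r l})" .
    qed simp
    also have "\<dots> = real (card (Us r))"
      unfolding Us_def by (simp add: card_PiE)
    finally show ?thesis .
  qed
  have cX: "J / (12 * a * Y) \<le> real (card (Xs r u))" for r u
  proof -
    \<comment> \<open>Before rounding the block has length \<open>4 * q * D\<close>. The floor and
      the count in a residue class each lose 1, and \<open>q >= 1\<close> absorbs both.\<close>
    define q where "q = real J / (12 * a * Y)"
    have aY: "real_of_int a * real Y > 0" using a Y0 by simp
    have "real_of_int (12 * a * int Y) \<le> real_of_int (int J)" using J(1) by (simp only: of_int_le_iff)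
    then have q: "q \<ge> 1" using aY by (simp add: q_def)
    have D1: "real D \<ge> 1" using D by simp
    have e: "real (J * D) / (3 * a * Y) = 4 * q * D" by (simp add: q_def)
    have "4 * q * D - 1 \<le> real s0" using s0r(2) e by simp
    moreover have "1 \<le> q * D" using mult_mono[of 1 q 1 "real D"] q D1 by simp
    ultimately have "3 * q * D \<le> real s0" by linarith
    then have "3 * q - 1 \<le> real s0 / real_of_int (int D) - 1" using D by (simp add: field_simps)
    also have "\<dots> \<le> real (card (Xs r u))"
      unfolding Xs_def using D by (intro card_residue_class_ge) simp
    finally show ?thesis using q by (simp add: q_def)
  qed
  define Dom where "Dom = (SIGMA r:sols_mod \<nu> b A (int D) m. SIGMA u:Us r. Xs r u)"
  have cDom: "real (card (sols_mod \<nu> b A (int D) m)) * ((w / (2 * D)) ^ (\<nu> - 1) * (J / (12 * a * Y))) \<le> real (card Dom)"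
  proof -
    have "real (card (sols_mod \<nu> b A (int D) m)) * ((w / (2 * D)) ^ (\<nu> - 1) * (J / (12 * a * Y)))
       = (\<Sum>r\<in>sols_mod \<nu> b A (int D) m. (w / (2 * D)) ^ (\<nu> - 1) * (J / (12 * a * Y)))" by simp
    also have "\<dots> \<le> (\<Sum>r\<in>sols_mod \<nu> b A (int D) m. real (card (Us r)) * (J / (12 * a * Y)))"
      using cU a by (intro sum_mono mult_right_mono) auto
    also have "\<dots> = (\<Sum>r\<in>sols_mod \<nu> b A (int D) m. \<Sum>u\<in>Us r. J / (12 * a * Y))" by simp
    also have "\<dots> \<le> (\<Sum>r\<in>sols_mod \<nu> b A (int D) m. \<Sum>u\<in>Us r. real (card (Xs r u)))"
      using cX by (intro sum_mono) auto
    also have "\<dots> = real (card Dom)" unfolding Dom_def using finUs finXs by simp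
    finally show ?thesis .
  qed
  \<comment> \<open>The solution \<open>r\<close> need not be stored in the image: it is recovered
    from the point by reduction modulo \<open>D\<close>.\<close>
  define \<Phi> where "\<Phi> = (\<lambda>(r::nat\<Rightarrow>int, u::nat\<Rightarrow>int, x::int). \<lambda>l\<in>{..<\<nu>}. if l = i0 then x else u l)"
  have \<Phi>i: "\<Phi> (r,u,x) i0 = x" for r u x using i0 by (simp add: \<Phi>_def)
  have \<Phi>l: "\<Phi> (r,u,x) l = u l" if "l \<in> ?I" for r u x l using that by (simp add: \<Phi>_def)
  have res: "int D dvd \<Phi> (r,u,x) l - r l" if "(r,u,x) \<in> Dom" "l < \<nu>" for r u x l
  proof (cases "l = i0")
    case True
    then show ?thesis using that \<Phi>i by (simp add: Dom_def Xs_def)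
  next
    case False
    then have l: "l \<in> ?I" using that by simp
    have "u \<in> Us r" using that by (simp add: Dom_def)
    then have "u \<in> (\<Pi>\<^sub>E l\<in>?I. {x\<in>{int w..<int w + int w}. int D dvd x - r l})" by (simp only: Us_def)
    from PiE_mem[OF this l] show ?thesis unfolding \<Phi>l[OF l] by simp
  qed
  define Ts where "Ts = \<Phi> ` Dom"
  have "inj_on \<Phi> Dom"
  proof (rule inj_onI)
    fix p q assume pq: "p \<in> Dom" "q \<in> Dom" "\<Phi> p = \<Phi> q"
    obtain r u x r' u' x' where e: "p = (r,u,x)" "q = (r',u',x')" by (metis prod_cases3)
    have "x = x'" using fun_cong[OF pq(3), of i0] unfolding e \<Phi>i .
    moreover have "u = u'"
    proof (rule extensionalityI)
      show "u \<in> extensional ?I" "u' \<in> extensional ?I"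
        using pq by (simp_all add: e Dom_def Us_def PiE_iff)
      fix l assume l: "l \<in> ?I"
      show "u l = u' l" using fun_cong[OF pq(3), of l] unfolding e \<Phi>l[OF l] .
    qed
    moreover have "r = r'"
    proof (rule PiE_ext)
      show E: "r \<in> {..<\<nu>} \<rightarrow>\<^sub>E {0..<int D}" "r' \<in> {..<\<nu>} \<rightarrow>\<^sub>E {0..<int D}"
        using pq by (simp_all add: e Dom_def sols_mod_def)
      fix l assume l: "l \<in> {..<\<nu>}"
      have "int D dvd \<Phi> p l - r l" "int D dvd \<Phi> p l - r' l"
        using res[of r u x l] res[of r' u' x' l] pq l by (simp_all add: e)
      then have "int D dvd (\<Phi> p l - r' l) - (\<Phi> p l - r l)" by (rule dvd_diff[rotated])
      then have "r l mod int D = r' l mod int D" by (simp add: mod_eq_dvd_iff)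
      then show "r l = r' l" using PiE_mem[OF E(1) l] PiE_mem[OF E(2) l] by simp
    qed
    ultimately show "p = q" using e by simp
  qed
  then have cTs: "card Ts = card Dom" by (simp add: Ts_def card_image)
  have Ts: "t l \<in> {int w..<int Y}" "\<exists>i<J. diag_quad \<nu> b A t = m - int (i * D)"
    if t: "t \<in> Ts" and l: "l < \<nu>" for t l
  proof -
    obtain r u x where e: "t = \<Phi> (r,u,x)" and dom: "(r,u,x) \<in> Dom"
      using t by (auto simp: Ts_def)
    have r: "r \<in> sols_mod \<nu> b A (int D) m" and u: "u \<in> Us r" and x: "x \<in> Xs r u"
      using dom by (simp_all add: Dom_def)
    have xr: "TS u + 1 - int s0 \<le> x" "x \<le> TS u" using x by (simp_all add: Xs_def)
    show "t l \<in> {int w..<int Y}"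
    proof (cases "l = i0")
      case True
      have "2 * int w \<le> int Y - 2 * int s0" using wY s0Y by linarith
      then show ?thesis unfolding True e \<Phi>i using xr TS(1,2)[OF u] by simp
    next
      case False
      then have l': "l \<in> ?I" using l by simp
      have "u l \<in> {int w..<int w + int w}"
        using PiE_mem[OF u[unfolded Us_def] l'] by simp
      then show ?thesis unfolding e \<Phi>l[OF l'] using wY by simp
    qed
    have G: "diag_quad \<nu> b A t = ?f x + U u"
      unfolding diag_quad_remove[OF i0] U_def e \<Phi>i a(1) using \<Phi>l by simp
    have bnd: "diag_quad \<nu> b A t \<le> m" "m < diag_quad \<nu> b A t + int (J * D)"
      using TS(3)[OF u xr] unfolding G by auto
    have "int D dvd diag_quad \<nu> b A t - diag_quad \<nu> b A r"
      unfolding diag_quad_def by (rule diag_quad_cong_mod) (use res[OF dom] in \<open>simp add: e\<close>)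
    moreover have "int D dvd diag_quad \<nu> b A r - m" using r by (simp add: sols_mod_def)
    ultimately have "int D dvd (diag_quad \<nu> b A t - diag_quad \<nu> b A r) + (diag_quad \<nu> b A r - m)" by (rule dvd_add)
    then have "int D dvd m - diag_quad \<nu> b A t" by (simp add: dvd_diff_commute)
    then obtain c where c: "m - diag_quad \<nu> b A t = int D * c" by (elim dvdE)
    have "0 \<le> int D * c" "int D * c < int D * int J" using bnd c by (auto simp: algebra_simps)
    then have "0 \<le> c" "c < int J" using D by (auto simp: zero_le_mult_iff)
    then show "\<exists>i<J. diag_quad \<nu> b A t = m - int (i * D)"
      using c by (intro exI[of _ "nat c"]) (auto simp: algebra_simps)
  qed
  have TsE: "t \<in> extensional {..<\<nu>}" if "t \<in> Ts" for t
    using that by (auto simp: Ts_def \<Phi>_def)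
  define Ps where "Ps = ({..<\<nu>} \<rightarrow>\<^sub>E {0..<int w})"
  have cPs: "card Ps = w ^ \<nu>" by (simp add: Ps_def card_PiE)
  define R where "R = (\<lambda>i. {z\<in>pair_box \<nu> Y. pair_quad \<nu> b A z = m - int (i * D)})"
  define \<Psi> where "\<Psi> = (\<lambda>(t::nat\<Rightarrow>int, x::nat\<Rightarrow>int). \<lambda>l\<in>{..<\<nu>}. (x l, t l - x l))"
  have \<Psi>: "\<Psi> (t,x) l = (x l, t l - x l)" if "l < \<nu>" for t x l using that by (simp add: \<Psi>_def)
  have finR: "finite (R i)" for i
    unfolding R_def by (rule finite_subset[OF _ finite_pair_box]) auto
  have "inj_on \<Psi> (Ts \<times> Ps)"
  proof (rule inj_onI)
    fix p q assume pq: "p \<in> Ts \<times> Ps" "q \<in> Ts \<times> Ps" "\<Psi> p = \<Psi> q"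
    obtain t x t' x' where e: "p = (t,x)" "q = (t',x')" by force
    have eq: "x l = x' l" "t l = t' l" if "l < \<nu>" for l
      using fun_cong[OF pq(3), of l] unfolding e \<Psi>[OF that] by auto
    have "x = x'"
      by (rule PiE_ext[of x "{..<\<nu>}" "\<lambda>_. {0..<int w}"]) (use pq eq in \<open>auto simp: e Ps_def\<close>)
    moreover have "t = t'"
      by (rule extensionalityI[OF TsE TsE]) (use pq eq in \<open>auto simp: e\<close>)
    ultimately show "p = q" using e by simp
  qed
  moreover have "\<Psi> ` (Ts \<times> Ps) \<subseteq> (\<Union>i<J. R i)"
  proof (rule image_subsetI)
    fix p assume p: "p \<in> Ts \<times> Ps"
    obtain t x where e: "p = (t,x)" by force
    have t: "t \<in> Ts" and x: "x \<in> {..<\<nu>} \<rightarrow>\<^sub>E {0..<int w}" using p by (simp_all add: e Ps_def)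
    have "\<Psi> p \<in> pair_box \<nu> Y"
      unfolding pair_box_def
    proof (rule PiE_I)
      fix l assume l: "l \<in> {..<\<nu>}"
      have "x l \<in> {0..<int w}" by (rule PiE_mem[OF x l])
      moreover have "t l \<in> {int w..<int Y}" using Ts(1)[OF t] l by simp
      ultimately show "\<Psi> p l \<in> {0..<int Y} \<times> {0..<int Y}"
        using \<Psi>[of l t x] l wY by (simp add: e)
    qed (simp add: \<Psi>_def e)
    moreover have "pair_quad \<nu> b A (\<Psi> p) = diag_quad \<nu> b A t"
      unfolding pair_quad_def diag_quad_def by (intro sum.cong refl) (simp add: e \<Psi>)
    ultimately show "\<Psi> p \<in> (\<Union>i<J. R i)"
      using Ts(2)[OF t i0] by (auto simp: R_def)
  qed
  ultimately have "card (Ts \<times> Ps) \<le> card (\<Union>i<J. R i)"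
    using finR by (intro card_inj_on_le) auto
  also have "\<dots> \<le> (\<Sum>i<J. card (R i))" by (rule card_UN_le) simp
  finally have "card Ts * w ^ \<nu> \<le> (\<Sum>i<J. card (R i))"
    by (simp add: card_cartesian_product cPs)
  then have "real (card Ts * w ^ \<nu>) \<le> real (\<Sum>i<J. card (R i))" by (simp only: of_nat_le_iff)
  then have 1: "real (card Dom) * real w ^ \<nu> \<le> (\<Sum>i<J. real (card (R i)))" by (simp add: cTs)
  have "real (card (sols_mod \<nu> b A (int D) m)) * (real w ^ \<nu> * (w / (2 * D)) ^ (\<nu> - 1) * (J / (12 * a * Y)))
     = (real (card (sols_mod \<nu> b A (int D) m)) * ((w / (2 * D)) ^ (\<nu> - 1) * (J / (12 * a * Y)))) * real w ^ \<nu>"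
    by (simp add: mult_ac)
  also have "\<dots> \<le> real (card Dom) * real w ^ \<nu>"
    using cDom by (intro mult_right_mono) auto
  finally show ?thesis using 1 by (simp add: rep_count_def R_def)
qed

text \<open>Only the positive elements of the set matter.\<close>

definition null_density :: "int set \<Rightarrow> bool" where
  "null_density E \<longleftrightarrow> (\<forall>\<epsilon>>0. \<exists>N0. \<forall>N\<ge>N0. real (card (E \<inter> {1..int N})) \<le> \<epsilon> * real N)"

text \<open>The upper quarter of \<open>[1, N]\<close> fits into a single range
  \<open>[3/8, 5/8] * a * (H * w)^2\<close>. Passing from \<open>N\<close> to
  \<open>3 * N div 4\<close> then covers everything, and the errors form a geometric series.\<close>

lemma null_density_from_intervals:
  fixes E :: "int set" and a :: int and H :: nat
  assumes a: "a > 0" and H: "H > 0"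
    and ivl: "\<And>\<epsilon>. \<epsilon> > 0 \<Longrightarrow> \<exists>w0. \<forall>w\<ge>w0.
       real (card {m\<in>E. 3 * a * (int (H * w))\<^sup>2 \<le> 8 * m \<and> 8 * m \<le> 5 * a * (int (H * w))\<^sup>2}) \<le> \<epsilon> * (real w)\<^sup>2"
  shows "null_density E"
  unfolding null_density_def
proof (intro allI impI)
  fix \<epsilon> :: real assume \<epsilon>: "\<epsilon> > 0"
  define e where "e = \<epsilon> / 16"
  have e0: "e > 0" using \<epsilon> by (simp add: e_def)
  define q where "q = a * (int H)\<^sup>2"
  have q1: "q \<ge> 1" using a H by (simp add: q_def int_one_le_iff_zero_less)
  obtain w0 where w0: "\<And>w. w \<ge> w0 \<Longrightarrow>
      real (card {m\<in>E. 3 * a * (int (H * w))\<^sup>2 \<le> 8 * m \<and> 8 * m \<le> 5 * a * (int (H * w))\<^sup>2}) \<le> e * (real w)\<^sup>2"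
    using ivl[OF e0] by blast
  define W where "W = max w0 10"
  define N1 where "N1 = nat (5 * q * (int W)\<^sup>2) + 1"
  have step: "real (card (E \<inter> {m. 3 * int N < 4 * m \<and> m \<le> int N})) \<le> 2 * e * N" if N: "N \<ge> N1" for N
  proof -
    \<comment> \<open>The least \<open>w\<close> whose range reaches \<open>N\<close>. By minimality
      and \<open>4 * w^2 <= 5 * (w - 1)^2\<close>, valid for \<open>w >= 10\<close>, the lower end
      of the range stays below \<open>3 * N / 4\<close>.\<close>
    define w where "w = (LEAST w::nat. 8 * int N \<le> 5 * q * (int w)\<^sup>2)"
    have "8 * int N \<le> 5 * q * (int (8 * N))\<^sup>2"
    proof -
      have "int (8 * N) * 1 \<le> int (8 * N) * int (8 * N)" by (cases "N = 0") (auto intro: mult_left_mono)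
      also have "\<dots> \<le> (5 * q) * (int (8 * N) * int (8 * N))"
        using q1 mult_right_mono[of 1 "5 * q" "int (8 * N) * int (8 * N)"] by simp
      finally show ?thesis by (simp add: power2_eq_square mult.assoc)
    qed
    then have w: "8 * int N \<le> 5 * q * (int w)\<^sup>2" unfolding w_def by (rule LeastI)
    have wW: "w > W"
    proof (rule ccontr)
      assume "\<not> w > W"
      then have "5 * q * (int w)\<^sup>2 \<le> 5 * q * (int W)\<^sup>2" using q1 by (intro mult_left_mono power_mono) auto
      then have "8 * int N \<le> 5 * q * (int W)\<^sup>2" using w by linarith
      moreover have "int N \<ge> 5 * q * (int W)\<^sup>2 + 1" using N q1 by (simp add: N1_def)
      ultimately show False by linarith
    qed
    then have w10: "w \<ge> 10" "w \<ge> w0" by (auto simp: W_def)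
    have "\<not> 8 * int N \<le> 5 * q * (int (w - 1))\<^sup>2"
      unfolding w_def by (rule not_less_Least) (use w10 in \<open>simp add: w_def[symmetric]\<close>)
    then have wm: "5 * q * (int w - 1)\<^sup>2 < 8 * int N" using w10 by (simp add: of_nat_diff)
    have sq: "4 * (int w)\<^sup>2 \<le> 5 * (int w - 1)\<^sup>2"
    proof -
      have "0 \<le> int w * (int w - 10)" using w10 by simp
      then show ?thesis by (simp add: power2_eq_square algebra_simps)
    qed
    have sub: "E \<inter> {m. 3 * int N < 4 * m \<and> m \<le> int N} \<subseteq>
       {m\<in>E. 3 * a * (int (H * w))\<^sup>2 \<le> 8 * m \<and> 8 * m \<le> 5 * a * (int (H * w))\<^sup>2}" (is "_ \<subseteq> ?R")
    proof
      fix m assume m: "m \<in> E \<inter> {m. 3 * int N < 4 * m \<and> m \<le> int N}"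
      have eq: "a * (int (H * w))\<^sup>2 = q * (int w)\<^sup>2" by (simp add: q_def power_mult_distrib)
      have "q * (4 * (int w)\<^sup>2) \<le> q * (5 * (int w - 1)\<^sup>2)" using sq q1 by (intro mult_left_mono) auto
      then have "4 * (q * (int w)\<^sup>2) < 8 * int N" using wm by (simp add: mult_ac)
      then have "3 * (a * (int (H * w))\<^sup>2) \<le> 8 * m" using m unfolding eq by simp
      moreover have "8 * m \<le> 5 * (a * (int (H * w))\<^sup>2)" using m w unfolding eq by (simp add: mult_ac)
      ultimately show "m \<in> ?R" using m by (simp add: mult_ac)
    qed
    have finR: "finite ?R"
      by (rule finite_subset[of _ "{0..5 * a * (int (H * w))\<^sup>2}"]) (use a in \<open>auto intro: order_trans[rotated]\<close>)
    have "real (card (E \<inter> {m. 3 * int N < 4 * m \<and> m \<le> int N})) \<le> real (card ?R)"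
      using card_mono[OF finR sub] by simp
    also have "\<dots> \<le> e * (real w)\<^sup>2" using w0 w10 by blast
    also have "\<dots> \<le> e * (2 * N)"
    proof (intro mult_left_mono)
      have "5 * (int w - 1)\<^sup>2 \<le> 5 * q * (int w - 1)\<^sup>2"
        using q1 mult_right_mono[of 5 "5 * q" "(int w - 1)\<^sup>2"] by simp
      then have "4 * (int w)\<^sup>2 \<le> 8 * int N" using sq wm by linarith
      then have "(int w)\<^sup>2 \<le> 2 * int N" by simp
      then have "real_of_int ((int w)\<^sup>2) \<le> real_of_int (2 * int N)" by (simp only: of_int_le_iff)
      then show "(real w)\<^sup>2 \<le> real (2 * N)" by simp
    qed (use e0 in simp)
    finally show ?thesis by simp
  qed
  \<comment> \<open>The 8 is the fixed point of \<open>c = 3/4 * c + 2\<close>; \<open>N1\<close>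
    takes care of the start.\<close>
  have main: "real (card (E \<inter> {1..int N})) \<le> N1 + 8 * e * N" for N
  proof (induction N rule: less_induct)
    case (less N)
    show ?case
    proof (cases "N < N1")
      case True
      have "card (E \<inter> {1..int N}) \<le> card {1..int N}" by (intro card_mono) auto
      then have "real (card (E \<inter> {1..int N})) \<le> N1" using True by simp
      then show ?thesis using e0 by (simp add: add_increasing2)
    next
      case False
      then have N: "N \<ge> N1" "N > 0" by (auto simp: N1_def)
      define N' where "N' = 3 * N div 4"
      have N': "N' < N" "4 * N' \<le> 3 * N" using N by (auto simp: N'_def)
      have "E \<inter> {1..int N} \<subseteq> (E \<inter> {1..int N'}) \<union> (E \<inter> {m. 3 * int N < 4 * m \<and> m \<le> int N})"
      proof
        fix m assume m: "m \<in> E \<inter> {1..int N}"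
        show "m \<in> (E \<inter> {1..int N'}) \<union> (E \<inter> {m. 3 * int N < 4 * m \<and> m \<le> int N})"
        proof (cases "m \<le> int N'")
          case False
          then have "int (3 * N) div 4 < m" by (simp add: N'_def zdiv_int)
          then have "3 * int N < 4 * m" by simp
          then show ?thesis using m by simp
        qed (use m in simp)
      qed
      moreover have "finite (E \<inter> {m. 3 * int N < 4 * m \<and> m \<le> int N})"
        by (rule finite_subset[of _ "{0..int N}"]) auto
      ultimately have "card (E \<inter> {1..int N}) \<le> card ((E \<inter> {1..int N'}) \<union> (E \<inter> {m. 3 * int N < 4 * m \<and> m \<le> int N}))"
        by (intro card_mono) auto
      also have "\<dots> \<le> card (E \<inter> {1..int N'}) + card (E \<inter> {m. 3 * int N < 4 * m \<and> m \<le> int N})"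
        by (rule card_Un_le)
      finally have "real (card (E \<inter> {1..int N})) \<le> real (card (E \<inter> {1..int N'})) + real (card (E \<inter> {m. 3 * int N < 4 * m \<and> m \<le> int N}))"
        by linarith
      also have "\<dots> \<le> (N1 + 8 * e * N') + 2 * e * N"
        by (intro add_mono less.IH N' step N)
      also have "\<dots> \<le> N1 + 8 * e * N"
      proof -
        have "real (4 * N') \<le> real (3 * N)" using N'(2) by (simp only: of_nat_le_iff)
        then have "2 * e * real (4 * N') \<le> 2 * e * real (3 * N)" using e0 by (intro mult_left_mono) auto
        then show ?thesis by simp
      qed
      finally show ?thesis .
    qed
  qed
  show "\<exists>N0. \<forall>N\<ge>N0. real (card (E \<inter> {1..int N})) \<le> \<epsilon> * real N"
  proof (intro exI allI impI)
    fix N assume "N \<ge> nat \<lceil>2 * N1 / \<epsilon>\<rceil>"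
    then have "real N \<ge> 2 * N1 / \<epsilon>" by linarith
    then have "real N1 \<le> \<epsilon> / 2 * N" using \<epsilon> by (simp add: field_simps)
    then show "real (card (E \<inter> {1..int N})) \<le> \<epsilon> * real N" using main[of N] by (simp add: e_def)
  qed
qed

section \<open>Almost all values of a diagonal polynomial\<close>

lemma prod_le_prod_subset:
  fixes f :: "'a \<Rightarrow> real"
  assumes "finite T" "S \<subseteq> T" "\<And>x. x \<in> T \<Longrightarrow> 0 \<le> f x \<and> f x \<le> 1"
  shows "prod f T \<le> prod f S"
proof -
  have "prod f T = prod f (T - S) * prod f S" using assms by (intro prod.subset_diff)
  also have "\<dots> \<le> 1 * prod f S"
    using assms by (intro mult_right_mono prod_le_1 prod_nonneg) auto
  finally show ?thesis by simp
qed

text \<open>Only primes of \<open>D\<close> between 7 and \<open>P\<close> that do not divide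
  \<open>k\<close> contribute a factor below 1, and adjoining the remaining primes of that range can
  only decrease the product.\<close>

lemma prod_local_factor_ge:
  fixes D P :: nat and k :: int
  assumes D: "D > 0" and pf: "\<And>p. prime p \<Longrightarrow> p dvd D \<Longrightarrow> int p dvd k \<or> (7 \<le> p \<and> p \<le> P)"
  shows "sieve_product P \<le> (\<Prod>p\<in>prime_factors D. local_factor k p)"
proof -
  define T where "T = {p. prime p \<and> 7 \<le> p \<and> p \<le> P}"
  have finT: "finite T" unfolding T_def by (rule finite_subset[of _ "{..P}"]) auto
  define S where "S = {p\<in>prime_factors D. \<not> int p dvd k}"
  have ST: "S \<subseteq> T" using pf by (auto simp: S_def T_def prime_factors_dvd)
  have "sieve_product P = (\<Prod>p\<in>T. 1 - 5 / real p)" by (simp add: sieve_product_def T_def)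
  also have "\<dots> \<le> (\<Prod>p\<in>S. 1 - 5 / real p)"
    using finT ST by (intro prod_le_prod_subset) (auto simp: T_def field_simps)
  also have "\<dots> = (\<Prod>p\<in>prime_factors D. local_factor k p)"
    by (rule prod.mono_neutral_cong_left) (auto simp: S_def local_factor_def)
  finally show ?thesis .
qed

text \<open>At an exceptional \<open>m\<close> the count is 0, so the variance picks up the square
  of the average, which is at least \<open>c2 * \<sigma> * w^(2n)\<close>. The powers of
  \<open>D\<close> cancel between the number of solutions modulo \<open>D\<close> and the density of
  their residue classes. Hence \<open>c2\<close> depends neither on \<open>D\<close> nor on
  \<open>P\<close>, and \<open>P\<close> can be chosen after it.\<close>

theorem diag_quad_almost_all:
  fixes b A :: "nat \<Rightarrow> int" and k :: int and \<nu> i0 :: nat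
  assumes \<nu>: "\<nu> \<ge> 3" and i0: "i0 < \<nu>" "A i0 > 0"
    and A0: "\<And>i. i < \<nu> \<Longrightarrow> A i \<noteq> 0"
    and kA: "\<And>i. i < \<nu> \<Longrightarrow> k dvd A i"
    and good: "\<And>p. prime p \<Longrightarrow> \<not> int p dvd k \<Longrightarrow> p \<ge> 7 \<and> (\<forall>i<\<nu>. \<not> int p dvd A i)"
    and bad: "\<And>p. prime p \<Longrightarrow> int p dvd k \<Longrightarrow> \<exists>i<\<nu>. \<not> int p dvd b i"
  shows "null_density (- range (diag_quad \<nu> b A))"
proof -
  define a where "a = A i0"
  have a: "a > 0" "real_of_int a > 0" using i0 by (auto simp: a_def)
  define SA where "SA = (\<Sum>l<\<nu>. \<bar>A l\<bar>)"
  have SA0: "SA \<ge> 0" by (simp add: SA_def sum_nonneg)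
  define H where "H = 8 + 128 * nat SA"
  have H: "H \<ge> 8" "even H" "H > 0" by (auto simp: H_def)
  have HA: "128 * (\<Sum>l<\<nu>. \<bar>A l\<bar>) \<le> (int H)\<^sup>2"
  proof -
    have "128 * SA \<le> int H" using SA0 by (simp add: H_def)
    also have "int H * 1 \<le> int H * int H" using H by (intro mult_left_mono) auto
    finally show ?thesis by (simp add: SA_def power2_eq_square)
  qed
  define n where "n = \<nu> - 1"
  have n: "\<nu> = Suc n" "4 * \<nu> - 2 = 4 * n + 2" using \<nu> by (auto simp: n_def)
  define C1 where "C1 = 672 * 1600 ^ 3 * real_of_int (\<Sum>i<3. \<bar>A i\<bar>)"
  define c2 where "c2 = 1 / (2 ^ n * 12 * real_of_int a * real H)"
  \<comment> \<open>Chosen so that the comparison of variance and lower bound ends in exactly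
    \<open>\<epsilon> * w^2\<close>.\<close>
  define K where "K = 2 * C1 * real H ^ (4 * n + 2) / c2\<^sup>2"
  have c2: "c2 > 0" using a H by (simp add: c2_def)
  have "\<bar>A 0\<bar> \<le> (\<Sum>i<3. \<bar>A i\<bar>)" by (rule member_le_sum) auto
  then have "(\<Sum>i<3. \<bar>A i\<bar>) > 0" using A0[of 0] \<nu> by linarith
  then have "real_of_int (\<Sum>i<3. \<bar>A i\<bar>) > 0" by (simp only: of_int_0_less_iff)
  then have C1: "C1 > 0" unfolding C1_def by (intro mult_pos_pos) auto
  have K: "K > 0" using C1 c2 H by (simp add: K_def)
  show ?thesis
  proof (rule null_density_from_intervals[OF a(1) H(3)])
    fix \<epsilon> :: real assume \<epsilon>: "\<epsilon> > 0"
    then have "\<epsilon> / K > 0" using K by simp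
    then obtain P where P: "P \<ge> 2" "1 / real P \<le> \<epsilon> / K * (sieve_product P)\<^sup>2"
      by (rule sieve_product_slow_decay)
    define \<sigma> where "\<sigma> = sieve_product P"
    have \<sigma>: "\<sigma> > 0" by (simp add: \<sigma>_def sieve_product_pos)
    \<comment> \<open>Weyl differencing approximates \<open>2 * A i * \<alpha>\<close> by fractions,
      so \<open>D\<close> must contain \<open>2 * A i\<close> beside the factorial. All primes of
      \<open>AA\<close> divide \<open>k\<close>, hence they cost nothing in the local
      product.\<close>
    define AA where "AA = 2 * (\<bar>A 0\<bar> * \<bar>A 1\<bar> * \<bar>A 2\<bar>)"
    have AA: "AA > 0" using A0[of 0] A0[of 1] A0[of 2] \<nu> by (simp add: AA_def)
    define D where "D = nat AA * fact P"
    have D: "D > 0" using AA by (simp add: D_def)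
    have Di: "int D = AA * fact P" using AA by (simp add: D_def)
    have dvdD: "2 * A i * fact P dvd int D" if "i < 3" for i
    proof -
      have "A i dvd \<bar>A 0\<bar> * \<bar>A 1\<bar> * \<bar>A 2\<bar>"
        using that by (auto simp: less_Suc_eq numeral_3_eq_3 numeral_2_eq_2 intro: dvd_mult dvd_mult2)
      then have "2 * A i dvd AA" unfolding AA_def by (intro mult_dvd_mono) auto
      then show ?thesis unfolding Di by (intro mult_dvd_mono) auto
    qed
    have pfD: "int p dvd k \<or> (7 \<le> p \<and> p \<le> P)" if p: "prime p" "p dvd D" for p
    proof (rule ccontr)
      assume *: "\<not> (int p dvd k \<or> (7 \<le> p \<and> p \<le> P))"
      then have g: "p \<ge> 7" "\<And>i. i < \<nu> \<Longrightarrow> \<not> int p dvd A i" using good p by auto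
      have "p > P" using * g by simp
      have pi: "prime (int p)" using p by simp
      have "\<not> p dvd fact P" using p \<open>p > P\<close> by (simp add: prime_dvd_fact_iff)
      then have "p dvd nat AA" using p by (simp add: D_def prime_dvd_mult_iff)
      then have "int p dvd AA" using AA by (metis int_dvd_int_iff int_nat_eq less_imp_le)
      then have "int p dvd 2 \<or> int p dvd A 0 \<or> int p dvd A 1 \<or> int p dvd A 2"
        unfolding AA_def prime_dvd_mult_iff[OF pi] by auto
      moreover have "\<not> int p dvd 2" using g zdvd_imp_le[of "int p" 2] by auto
      ultimately show False using g(2)[of 0] g(2)[of 1] g(2)[of 2] \<nu> by auto
    qed
    define w0 where "w0 = Suc (max (nat (64 * (\<Sum>l<\<nu>. \<bar>b l\<bar>))) (max (2 * D) (nat (12 * a) * (P * D))))"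
    show "\<exists>w0. \<forall>w\<ge>w0. real (card {m\<in>- range (diag_quad \<nu> b A). 3 * a * (int (H * w))\<^sup>2 \<le> 8 * m \<and>
       8 * m \<le> 5 * a * (int (H * w))\<^sup>2}) \<le> \<epsilon> * (real w)\<^sup>2"
    proof (intro exI allI impI)
      fix w assume "w \<ge> w0"
      then have w: "w \<ge> 1" "w \<ge> 2 * D" "nat (12 * a) * (P * D) \<le> w" "nat (64 * (\<Sum>l<\<nu>. \<bar>b l\<bar>)) \<le> w"
        by (auto simp: w0_def)
      have wb: "64 * (\<Sum>l<\<nu>. \<bar>b l\<bar>) \<le> int w" using w(4) by linarith
      have wr: "real w > 0" using w by simp
      define Y where "Y = H * w"
      have Y: "Y \<ge> 1" "w \<le> Y" using H w by (auto simp: Y_def)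
      define J where "J = Y\<^sup>2 div (P * D)"
      have PD: "P * D > 0" using P D by simp
      have JPD: "J * (P * D) \<le> Y\<^sup>2" by (simp add: J_def)
      have aYJ: "nat (12 * a) * Y \<le> J"
      proof -
        have "nat (12 * a) * Y * (P * D) = (nat (12 * a) * (P * D)) * Y" by (simp add: mult_ac)
        also have "\<dots> \<le> Y * Y" using w(3) Y by (intro mult_le_mono1) simp
        finally show ?thesis unfolding J_def using PD by (simp add: less_eq_div_iff_mult_less_eq power2_eq_square)
      qed
      then have aYJ': "12 * a * int Y \<le> int J"
      proof -
        have "int (nat (12 * a) * Y) \<le> int J" using aYJ by (simp only: of_nat_le_iff)
        then show ?thesis using a by simp
      qed
      have "nat (12 * a) * Y \<ge> 1 * 1" using a Y by (intro mult_le_mono) auto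
      then have J1: "J \<ge> 1" using aYJ by linarith
      have J2: "2 * J * D \<le> Y\<^sup>2"
      proof -
        have "2 * J * D \<le> P * J * D" using P by simp
        also have "\<dots> = J * (P * D)" by simp
        also note JPD
        finally show ?thesis .
      qed
      have \<delta>: "real (J * D) \<le> 1 / real P * real (Y\<^sup>2)"
      proof -
        have "real (J * (P * D)) \<le> real (Y\<^sup>2)" using JPD by (simp only: of_nat_le_iff)
        then show ?thesis using P by (simp add: field_simps)
      qed
      define F where "F = {m\<in>- range (diag_quad \<nu> b A). 3 * a * (int (H * w))\<^sup>2 \<le> 8 * m \<and> 8 * m \<le> 5 * a * (int (H * w))\<^sup>2}"
      have finF: "finite F"
        unfolding F_def by (rule finite_subset[of _ "{0..5 * a * (int (H * w))\<^sup>2}"]) (use a in \<open>auto intro: order_trans[rotated]\<close>)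
      let ?r = "rep_count \<nu> b A Y"
      define \<rho> where "\<rho> = (\<lambda>m. (\<Sum>i<J. real (?r (m - int (i * D)))) / J)"
      have low: "(c2 * \<sigma> * real w ^ (2 * n))\<^sup>2 \<le> (real (?r m) - \<rho> m)\<^sup>2" if m: "m \<in> F" for m
      proof -
        have "{z \<in> pair_box \<nu> Y. pair_quad \<nu> b A z = m} = {}"
          using m by (auto simp: F_def pair_quad_def)
        then have r0: "?r m = 0" by (simp add: rep_count_def)
        have mI: "3 * a * (int Y)\<^sup>2 \<le> 8 * m" "8 * m \<le> 5 * a * (int Y)\<^sup>2" using m by (auto simp: F_def Y_def)
        have L: "real (card (sols_mod \<nu> b A (int D) m)) * (real w ^ \<nu> * (w / (2 * D)) ^ (\<nu> - 1) * (J / (12 * a * Y)))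
           \<le> (\<Sum>i<J. real (?r (m - int (i * D))))"
          by (rule rep_count_avg_lower[OF i0(1) a_def a(1) H(1,2) HA wb w(1,2) D Y_def aYJ' J2 mI])
        have S: "real D ^ n * \<sigma> \<le> real (card (sols_mod \<nu> b A (int D) m))"
        proof -
          have "real D ^ n * \<sigma> \<le> real D ^ n * (\<Prod>p\<in>prime_factors D. local_factor k p)"
            unfolding \<sigma>_def using D pfD by (intro mult_left_mono prod_local_factor_ge) auto
          also have "\<dots> \<le> real (card (sols_mod \<nu> b A (int D) m))"
            unfolding n_def by (rule card_sols_mod_ge[OF \<nu> kA good bad D])
          finally show ?thesis .
        qed
        have "(real D ^ n * \<sigma>) * (real w ^ \<nu> * (w / (2 * D)) ^ n * (J / (12 * a * Y)))
          \<le> real (card (sols_mod \<nu> b A (int D) m)) * (real w ^ \<nu> * (w / (2 * D)) ^ n * (J / (12 * a * Y)))"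
          using S a by (intro mult_right_mono) auto
        also have "\<dots> \<le> (\<Sum>i<J. real (?r (m - int (i * D))))" using L by (simp only: n_def)
        finally have "(real D ^ n * \<sigma>) * (real w ^ \<nu> * (w / (2 * D)) ^ n * (J / (12 * a * Y))) / J \<le> \<rho> m"
          unfolding \<rho>_def by (intro divide_right_mono) auto
        moreover have "(real D ^ n * \<sigma>) * (real w ^ \<nu> * (w / (2 * D)) ^ n * (J / (12 * a * Y))) / J = c2 * \<sigma> * real w ^ (2 * n)"
        proof -
          have "(real D ^ n * \<sigma>) * (real w ^ \<nu> * (w / (2 * D)) ^ n * (J / (12 * a * Y))) / J
             = (real D ^ n * (w / (2 * D)) ^ n) * \<sigma> * (real w ^ \<nu> / (12 * a * Y))"
            using J1 by (simp add: mult_ac)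
          also have "real D ^ n * (w / (2 * D)) ^ n = (real w / 2) ^ n"
            using D by (simp flip: power_mult_distrib)
          also have "real w ^ \<nu> / (12 * a * Y) = real w ^ n / (12 * a * H)"
            using wr by (simp add: n(1) Y_def)
          also have "(real w / 2) ^ n * \<sigma> * (real w ^ n / (12 * a * H)) = c2 * \<sigma> * (real w ^ n * real w ^ n)"
            unfolding c2_def power_divide by (simp add: mult_ac)
          also have "real w ^ n * real w ^ n = real w ^ (2 * n)" by (simp add: mult_2 power_add)
          finally show ?thesis .
        qed
        ultimately have "c2 * \<sigma> * real w ^ (2 * n) \<le> \<rho> m" by simp
        moreover have "0 \<le> c2 * \<sigma> * real w ^ (2 * n)" using c2 \<sigma> by simp
        ultimately show ?thesis unfolding r0 by (simp add: power_mono)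
      qed
      have "real (card F) * (c2 * \<sigma> * real w ^ (2 * n))\<^sup>2 = (\<Sum>m\<in>F. (c2 * \<sigma> * real w ^ (2 * n))\<^sup>2)" by simp
      also have "\<dots> \<le> (\<Sum>m\<in>F. (real (?r m) - \<rho> m)\<^sup>2)" by (intro sum_mono low)
      also have "\<dots> \<le> 672 * 1600 ^ 3 * (\<Sum>i<3. \<bar>A i\<bar>) * real Y ^ (4 * \<nu> - 2) * (1 / real P + 1 / P)"
        unfolding \<rho>_def
        by (rule rep_count_variance[OF \<nu> _ Y(1) _ J1 D dvdD \<delta> _ finF]) (use A0 \<nu> P in auto)
      also have "\<dots> = C1 * real Y ^ (4 * n + 2) * (2 * (1 / P))" by (simp add: C1_def n(2))
      also have "\<dots> \<le> C1 * real Y ^ (4 * n + 2) * (2 * (\<epsilon> / K * \<sigma>\<^sup>2))"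
        using P(2) C1 unfolding \<sigma>_def by (intro mult_left_mono) auto
      also have "\<dots> = (c2 * \<sigma> * real w ^ (2 * n))\<^sup>2 * (\<epsilon> * (real w)\<^sup>2)"
      proof -
        have "C1 * real Y ^ (4 * n + 2) * (2 * (\<epsilon> / K * \<sigma>\<^sup>2)) = (2 * C1 * real H ^ (4 * n + 2) / K) * (real w ^ (4 * n + 2) * (\<epsilon> * \<sigma>\<^sup>2))"
          by (simp add: Y_def power_mult_distrib)
        also have "2 * C1 * real H ^ (4 * n + 2) / K = c2\<^sup>2"
          using C1 H c2 by (simp add: K_def)
        also have "real w ^ (4 * n + 2) = (real w ^ (2 * n))\<^sup>2 * (real w)\<^sup>2"
          by (simp flip: power_mult power_add)
        finally show ?thesis by (simp add: power_mult_distrib mult_ac)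
      qed
      finally have "(c2 * \<sigma> * real w ^ (2 * n))\<^sup>2 * real (card F) \<le> (c2 * \<sigma> * real w ^ (2 * n))\<^sup>2 * (\<epsilon> * (real w)\<^sup>2)"
        by (simp add: mult.commute)
      moreover have "(c2 * \<sigma> * real w ^ (2 * n))\<^sup>2 > 0" using c2 \<sigma> wr by simp
      ultimately have "real (card F) \<le> \<epsilon> * (real w)\<^sup>2" by (simp only: mult_le_cancel_left_pos)
      then show "real (card {m\<in>- range (diag_quad \<nu> b A). 3 * a * (int (H * w))\<^sup>2 \<le> 8 * m \<and>
         8 * m \<le> 5 * a * (int (H * w))\<^sup>2}) \<le> \<epsilon> * (real w)\<^sup>2" by (simp only: F_def)
    qed
  qed
qed

section \<open>Densities\<close>

text \<open>A point of \<open>[1, N]\<close> in the image comes from \<open>[1, N + |c|]\<close> or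
  from \<open>[-|c|, 0]\<close>, and the latter has bounded size.\<close>

lemma null_density_affine_image:
  fixes c q :: int
  assumes E: "null_density E" and q: "q > 0"
  shows "null_density ((\<lambda>m. c + q * m) ` E)"
  unfolding null_density_def
proof (intro allI impI)
  fix \<epsilon> :: real assume \<epsilon>: "\<epsilon> > 0"
  obtain N0 where N0: "\<And>N. N \<ge> N0 \<Longrightarrow> real (card (E \<inter> {1..int N})) \<le> \<epsilon> / 4 * real N"
    using E \<epsilon> unfolding null_density_def by (meson zero_less_divide_iff zero_less_numeral)
  define C where "C = nat \<bar>c\<bar>"
  show "\<exists>N0. \<forall>N\<ge>N0. real (card ((\<lambda>m. c + q * m) ` E \<inter> {1..int N})) \<le> \<epsilon> * real N"
  proof (intro exI allI impI)
    fix N assume "N \<ge> max N0 (max C (nat \<lceil>2 * (C + 1) / \<epsilon>\<rceil>))"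
    then have N: "N \<ge> N0" "N \<ge> C" "real N \<ge> 2 * (C + 1) / \<epsilon>" by linarith+
    have "(\<lambda>m. c + q * m) ` E \<inter> {1..int N} \<subseteq> (\<lambda>m. c + q * m) ` ((E \<inter> {1..int (N + C)}) \<union> {- int C..0})"
    proof
      fix x assume x: "x \<in> (\<lambda>m. c + q * m) ` E \<inter> {1..int N}"
      then obtain m where m: "m \<in> E" "x = c + q * m" "1 \<le> c + q * m" "c + q * m \<le> int N" by auto
      have "m \<in> (E \<inter> {1..int (N + C)}) \<union> {- int C..0}"
      proof (cases "m \<ge> 1")
        case True
        then have "1 * m \<le> q * m" using q by (intro mult_right_mono) auto
        then have "m \<le> int (N + C)" using m(4) by (simp add: C_def)
        then show ?thesis using True m by simp
      next
        case False
        then have "q * m \<le> 1 * m" using q by (intro mult_right_mono_neg) auto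
        then have "- int C \<le> m" using m(3) by (simp add: C_def)
        then show ?thesis using False by simp
      qed
      then show "x \<in> (\<lambda>m. c + q * m) ` ((E \<inter> {1..int (N + C)}) \<union> {- int C..0})" using m(2) by blast
    qed
    then have "card ((\<lambda>m. c + q * m) ` E \<inter> {1..int N}) \<le> card ((\<lambda>m. c + q * m) ` ((E \<inter> {1..int (N + C)}) \<union> {- int C..0}))"
      by (intro card_mono) auto
    also have "\<dots> \<le> card ((E \<inter> {1..int (N + C)}) \<union> {- int C..0})" by (intro card_image_le) auto
    also have "\<dots> \<le> card (E \<inter> {1..int (N + C)}) + card {- int C..0}" by (rule card_Un_le)
    finally have "real (card ((\<lambda>m. c + q * m) ` E \<inter> {1..int N})) \<le> real (card (E \<inter> {1..int (N + C)})) + (C + 1)"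
      by simp
    also have "\<dots> \<le> \<epsilon> / 4 * real (N + C) + (C + 1)" using N0[of "N + C"] N by simp
    also have "\<dots> \<le> \<epsilon> / 4 * real (N + N) + \<epsilon> / 2 * N"
    proof (intro add_mono mult_left_mono)
      show "real (C + 1) \<le> \<epsilon> / 2 * N" using N(3) \<epsilon> by (simp add: field_simps)
    qed (use N \<epsilon> in auto)
    finally show "real (card ((\<lambda>m. c + q * m) ` E \<inter> {1..int N})) \<le> \<epsilon> * real N" by (simp add: algebra_simps)
  qed
qed

lemma null_density_subset:
  assumes "null_density E" "F \<inter> {0<..} \<subseteq> E"
  shows "null_density F"
  unfolding null_density_def
proof (intro allI impI)
  fix \<epsilon> :: real assume "\<epsilon> > 0"
  then obtain N0 where N0: "\<And>N. N \<ge> N0 \<Longrightarrow> real (card (E \<inter> {1..int N})) \<le> \<epsilon> * real N"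
    using assms(1) unfolding null_density_def by blast
  show "\<exists>N0. \<forall>N\<ge>N0. real (card (F \<inter> {1..int N})) \<le> \<epsilon> * real N"
  proof (intro exI allI impI)
    fix N assume "N \<ge> N0"
    have "card (F \<inter> {1..int N}) \<le> card (E \<inter> {1..int N})"
      using assms(2) by (intro card_mono) (auto simp: subset_iff)
    then show "real (card (F \<inter> {1..int N})) \<le> \<epsilon> * real N" using N0[OF \<open>N \<ge> N0\<close>] by linarith
  qed
qed

lemma card_residues_bounds:
  fixes q :: nat and A :: "int set"
  assumes q: "q > 0" and A: "A \<subseteq> {0..<int q}"
  shows "real (card A) / q * N - q \<le> real (card {x\<in>{1..int N}. x mod int q \<in> A})"
    and "real (card {x\<in>{1..int N}. x mod int q \<in> A}) \<le> real (card A) / q * N + q"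
proof -
  have finA: "finite A" using A finite_subset by blast
  have cA: "card A \<le> q" using card_mono[OF _ A] by simp
  define C where "C = (\<lambda>r. {x\<in>{1..<1 + int N}. int q dvd x - r})"
  have finC: "finite (C r)" for r unfolding C_def by (rule finite_subset[of _ "{1..<1 + int N}"]) auto
  have U: "{x\<in>{1..int N}. x mod int q \<in> A} = (\<Union>r\<in>A. C r)"
  proof (intro set_eqI iffI)
    fix x assume "x \<in> {x\<in>{1..int N}. x mod int q \<in> A}"
    then have x: "1 \<le> x" "x \<le> int N" "x mod int q \<in> A" by auto
    then have "x \<in> C (x mod int q)" by (simp add: C_def minus_mod_eq_mult_div)
    then show "x \<in> (\<Union>r\<in>A. C r)" using x(3) by blast
  next
    fix x assume "x \<in> (\<Union>r\<in>A. C r)"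
    then obtain r where r: "r \<in> A" "x \<in> C r" by blast
    then have "x mod int q = r mod int q" by (simp add: C_def mod_eq_dvd_iff)
    then have "x mod int q = r" using r(1) A by auto
    then show "x \<in> {x\<in>{1..int N}. x mod int q \<in> A}" using r by (auto simp: C_def)
  qed
  have "C r \<inter> C s = {}" if "r \<in> A" "s \<in> A" "r \<noteq> s" for r s
  proof (rule ccontr)
    assume "C r \<inter> C s \<noteq> {}"
    then obtain x where "int q dvd x - r" "int q dvd x - s" by (auto simp: C_def)
    then have "r mod int q = s mod int q" by (metis mod_eq_dvd_iff)
    moreover have "r mod int q = r" "s mod int q = s" using that A by auto
    ultimately show False using that by simp
  qed
  then have eq: "card {x\<in>{1..int N}. x mod int q \<in> A} = (\<Sum>r\<in>A. card (C r))"
    unfolding U using finA finC by (intro card_UN_disjoint) auto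
  have lo: "real N / real q - 1 \<le> real (card (C r))" for r
    using card_residue_class_ge[of "int q" N 1 r] q unfolding C_def by simp
  have hi: "real (card (C r)) \<le> real N / real q + 1" for r
  proof -
    have "real (card (C r)) \<le> real_of_int (1 + int N - 1) / real_of_int (int q) + 1"
    proof (rule card_cong_interval_le)
      show "C r \<subseteq> {1..<1 + int N}" by (auto simp: C_def)
      fix x y assume "x \<in> C r" "y \<in> C r"
      then have "int q dvd x - r" "int q dvd y - r" by (simp_all add: C_def)
      from dvd_diff[OF this] have "int q dvd (x - r) - (y - r)" .
      then show "int q dvd x - y" by simp
    qed (use q in auto)
    then show ?thesis by simp
  qed
  have "real (card A) / q * N - q \<le> real (card A) * (real N / q - 1)"
    using cA by (simp add: algebra_simps)
  also have "\<dots> = (\<Sum>r\<in>A. real N / q - 1)" by simp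
  also have "\<dots> \<le> (\<Sum>r\<in>A. real (card (C r)))" by (intro sum_mono lo)
  finally show "real (card A) / q * N - q \<le> real (card {x\<in>{1..int N}. x mod int q \<in> A})"
    unfolding eq of_nat_sum .
  have "(\<Sum>r\<in>A. real (card (C r))) \<le> (\<Sum>r\<in>A. real N / q + 1)" by (intro sum_mono hi)
  also have "\<dots> = real (card A) * (real N / q + 1)" by simp
  also have "\<dots> \<le> real (card A) / q * N + q" using cA by (simp add: algebra_simps)
  finally show "real (card {x\<in>{1..int N}. x mod int q \<in> A}) \<le> real (card A) / q * N + q"
    unfolding eq of_nat_sum .
qed

text \<open>For every accuracy the counting ratio is eventually trapped near
  \<open>card A / q\<close>, so the ratios are Cauchy although the limit is not identified. The
  single class \<open>r0\<close>, filled up to a null set, keeps the limit positive.\<close>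

lemma density_of_almost_periodic:
  fixes S :: "int set"
  assumes approx: "\<And>\<epsilon>. \<epsilon> > 0 \<Longrightarrow> \<exists>(q::nat) A Bd. q > 0 \<and> A \<subseteq> {0..<int q} \<and>
       (\<forall>x\<in>S. x > 0 \<longrightarrow> x mod int q \<in> A \<or> x \<in> Bd) \<and>
       (\<forall>r\<in>A. null_density {x. x mod int q = r \<and> x \<notin> S}) \<and>
       (\<exists>N0. \<forall>N\<ge>N0. real (card (Bd \<inter> {1..int N})) \<le> \<epsilon> * real N)"
    and cls: "q0 > 0" "r0 \<in> {0..<int q0}" "null_density {x. x mod int q0 = r0 \<and> x \<notin> S}"
  shows "\<exists>\<delta>>0. (\<lambda>N. real (card (S \<inter> {1..int N})) / real N) \<longlonglongrightarrow> \<delta>"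
proof -
  define F where "F = (\<lambda>N. real (card (S \<inter> {1..int N})) / real N)"
  have low: "\<exists>N0. \<forall>N\<ge>N0. real (card A) / q - \<epsilon> \<le> F N"
    if q: "q > 0" and A: "A \<subseteq> {0..<int q}" and null: "\<forall>r\<in>A. null_density {x. x mod int q = r \<and> x \<notin> S}" and \<epsilon>: "\<epsilon> > 0"
    for q :: nat and A and \<epsilon> :: real
  proof -
    have finA: "finite A" using A finite_subset by blast
    have cA: "card A \<le> q" using card_mono[OF _ A] by simp
    define E where "E = (\<lambda>r. {x. x mod int q = r \<and> x \<notin> S})"
    have "\<forall>r\<in>A. \<exists>N0. \<forall>N\<ge>N0. real (card (E r \<inter> {1..int N})) \<le> \<epsilon> / (2 * q) * real N"
    proof
      fix r assume "r \<in> A"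
      then have "null_density (E r)" using null by (simp add: E_def)
      moreover have "\<epsilon> / (2 * q) > 0" using \<epsilon> q by simp
      ultimately show "\<exists>N0. \<forall>N\<ge>N0. real (card (E r \<inter> {1..int N})) \<le> \<epsilon> / (2 * q) * real N"
        unfolding null_density_def by blast
    qed
    then obtain N1 where N1: "\<And>r N. r \<in> A \<Longrightarrow> N \<ge> N1 r \<Longrightarrow> real (card (E r \<inter> {1..int N})) \<le> \<epsilon> / (2 * q) * real N"
      by metis
    show ?thesis
    proof (intro exI allI impI)
      fix N assume "N \<ge> Suc (max (\<Sum>r\<in>A. N1 r) (nat \<lceil>2 * q / \<epsilon>\<rceil>))"
      then have N: "N \<ge> (\<Sum>r\<in>A. N1 r)" "real N \<ge> 2 * q / \<epsilon>" "N > 0" by linarith+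
      have "{x\<in>{1..int N}. x mod int q \<in> A} \<subseteq> (S \<inter> {1..int N}) \<union> (\<Union>r\<in>A. E r \<inter> {1..int N})"
        by (auto simp: E_def)
      then have "card {x\<in>{1..int N}. x mod int q \<in> A} \<le> card ((S \<inter> {1..int N}) \<union> (\<Union>r\<in>A. E r \<inter> {1..int N}))"
        using finA by (intro card_mono) auto
      also have "\<dots> \<le> card (S \<inter> {1..int N}) + card (\<Union>r\<in>A. E r \<inter> {1..int N})" by (rule card_Un_le)
      also have "\<dots> \<le> card (S \<inter> {1..int N}) + (\<Sum>r\<in>A. card (E r \<inter> {1..int N}))"
        using finA by (intro add_left_mono card_UN_le)
      finally have "real (card {x\<in>{1..int N}. x mod int q \<in> A}) \<le> real (card (S \<inter> {1..int N})) + (\<Sum>r\<in>A. real (card (E r \<inter> {1..int N})))"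
        by (simp flip: of_nat_sum of_nat_add)
      moreover have "(\<Sum>r\<in>A. real (card (E r \<inter> {1..int N}))) \<le> (\<Sum>r\<in>A. \<epsilon> / (2 * q) * real N)"
        using finA N member_le_sum[of _ A N1] by (intro sum_mono N1) (auto intro: order_trans)
      moreover have "(\<Sum>r\<in>A. \<epsilon> / (2 * q) * real N) \<le> \<epsilon> / 2 * N"
      proof -
        have "real (card A) * (\<epsilon> / (2 * q) * real N) \<le> real q * (\<epsilon> / (2 * q) * real N)"
          using cA \<epsilon> by (intro mult_right_mono) auto
        then show ?thesis using q by simp
      qed
      moreover have "real q \<le> \<epsilon> / 2 * N" using N(2) \<epsilon> by (simp add: field_simps)
      ultimately have "real (card A) / q * N - \<epsilon> * N \<le> real (card (S \<inter> {1..int N}))"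
        using card_residues_bounds(1)[OF q A, of N] by linarith
      then show "real (card A) / q - \<epsilon> \<le> F N"
        using N(3) unfolding F_def by (simp add: pos_le_divide_eq left_diff_distrib)
    qed
  qed
  have near: "\<exists>a N0. \<forall>N\<ge>N0. \<bar>F N - a\<bar> \<le> \<epsilon>" if \<epsilon>: "\<epsilon> > 0" for \<epsilon> :: real
  proof -
    obtain q A Bd where q: "(q::nat) > 0" and A: "A \<subseteq> {0..<int q}"
      and cov: "\<forall>x\<in>S. x > 0 \<longrightarrow> x mod int q \<in> A \<or> x \<in> Bd"
      and null: "\<forall>r\<in>A. null_density {x. x mod int q = r \<and> x \<notin> S}"
      and Bd: "\<exists>N0. \<forall>N\<ge>N0. real (card (Bd \<inter> {1..int N})) \<le> \<epsilon> / 2 * real N"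
      using approx[of "\<epsilon> / 2"] \<epsilon> by auto
    obtain N1 where N1: "\<And>N. N \<ge> N1 \<Longrightarrow> real (card (Bd \<inter> {1..int N})) \<le> \<epsilon> / 2 * real N" using Bd by blast
    obtain N2 where N2: "\<And>N. N \<ge> N2 \<Longrightarrow> real (card A) / q - \<epsilon> \<le> F N" using low[OF q A null \<epsilon>] by blast
    show ?thesis
    proof (intro exI allI impI)
      fix N assume "N \<ge> Suc (max N1 (max N2 (nat \<lceil>2 * q / \<epsilon>\<rceil>)))"
      then have N: "N \<ge> N1" "N \<ge> N2" "real N \<ge> 2 * q / \<epsilon>" "N > 0" by linarith+
      have "S \<inter> {1..int N} \<subseteq> {x\<in>{1..int N}. x mod int q \<in> A} \<union> (Bd \<inter> {1..int N})"
        using cov by force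
      then have "card (S \<inter> {1..int N}) \<le> card ({x\<in>{1..int N}. x mod int q \<in> A} \<union> (Bd \<inter> {1..int N}))"
        by (intro card_mono) (auto intro: finite_subset[of _ "{1..int N}"])
      also have "\<dots> \<le> card {x\<in>{1..int N}. x mod int q \<in> A} + card (Bd \<inter> {1..int N})" by (rule card_Un_le)
      finally have "real (card (S \<inter> {1..int N})) \<le> real (card {x\<in>{1..int N}. x mod int q \<in> A}) + real (card (Bd \<inter> {1..int N}))"
        by linarith
      moreover have "real q \<le> \<epsilon> / 2 * N" using N(3) \<epsilon> by (simp add: field_simps)
      ultimately have "real (card (S \<inter> {1..int N})) \<le> real (card A) / q * N + \<epsilon> * N"
        using card_residues_bounds(2)[OF q A, of N] N1[OF N(1)] by linarith
      then have "F N \<le> real (card A) / q + \<epsilon>"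
        using N(4) unfolding F_def by (simp add: pos_divide_le_eq distrib_right)
      then show "\<bar>F N - real (card A) / q\<bar> \<le> \<epsilon>" using N2[OF N(2)] by (simp add: abs_le_iff)
    qed
  qed
  have "Cauchy F"
  proof (rule metric_CauchyI)
    fix \<epsilon> :: real assume "\<epsilon> > 0"
    then obtain a N0 where *: "\<And>N. N \<ge> N0 \<Longrightarrow> \<bar>F N - a\<bar> \<le> \<epsilon> / 4" using near[of "\<epsilon> / 4"] by auto
    show "\<exists>M. \<forall>m\<ge>M. \<forall>n\<ge>M. dist (F m) (F n) < \<epsilon>"
    proof (intro exI allI impI)
      fix m n assume "m \<ge> N0" "n \<ge> N0"
      from *[OF this(1)] *[OF this(2)] show "dist (F m) (F n) < \<epsilon>"
        using \<open>\<epsilon> > 0\<close> unfolding dist_real_def by linarith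
    qed
  qed
  then obtain \<delta> where \<delta>: "F \<longlonglongrightarrow> \<delta>" using Cauchy_convergent convergent_def by blast
  \<comment> \<open>Half of the density of the class \<open>r0\<close> pays for its exceptional set
    and the boundary effects.\<close>
  have "\<exists>N0. \<forall>N\<ge>N0. 1 / real q0 - 1 / (2 * real q0) \<le> F N"
    using low[of q0 "{r0}" "1 / (2 * real q0)"] cls by simp
  then have "1 / real q0 - 1 / (2 * real q0) \<le> \<delta>"
    using LIMSEQ_le_const[OF \<delta>] by blast
  moreover have "1 / real q0 - 1 / (2 * real q0) > 0" using cls(1) by simp
  ultimately have "\<delta> > 0" by linarith
  then show ?thesis using \<delta> unfolding F_def by blast
qed

section \<open>Integral solutions of homogeneous linear systems\<close>

lemma homogeneous_system_nontrivial:
  fixes a :: "nat \<Rightarrow> nat \<Rightarrow> int"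
  assumes "finite I" "k < card I"
  shows "\<exists>x. (\<forall>j. j \<notin> I \<longrightarrow> x j = 0) \<and> (\<exists>j\<in>I. x j \<noteq> 0) \<and> (\<forall>e<k. (\<Sum>j\<in>I. a e j * x j) = 0)"
  using assms
proof (induction k arbitrary: I a)
  case 0
  then obtain i where "i \<in> I" by fastforce
  then show ?case by (intro exI[of _ "\<lambda>j. if j = i then 1 else 0"]) auto
next
  case (Suc k)
  show ?case
  proof (cases "\<forall>j\<in>I. a k j = 0")
    case True
    obtain x where x: "\<forall>j. j \<notin> I \<longrightarrow> x j = 0" "\<exists>j\<in>I. x j \<noteq> 0" "\<forall>e<k. (\<Sum>j\<in>I. a e j * x j) = 0"
      using Suc.IH[of I a] Suc.prems by auto
    moreover have "(\<Sum>j\<in>I. a k j * x j) = 0" using True by simp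
    ultimately show ?thesis by (intro exI[of _ x]) (auto simp: less_Suc_eq)
  next
    case False
    then obtain j0 where j0: "j0 \<in> I" "a k j0 \<noteq> 0" by blast
    let ?I = "I - {j0}"
    have "k < card ?I" "finite ?I" using Suc.prems j0 by auto
    \<comment> \<open>Gaussian elimination without division: row \<open>k\<close> eliminates column
      \<open>j0\<close> by cross-multiplication. Back substitution then scales \<open>y\<close> by
      the pivot \<open>a k j0\<close>, so the solution stays integral.\<close>
    then obtain y where y: "\<forall>j. j \<notin> ?I \<longrightarrow> y j = 0" "\<exists>j\<in>?I. y j \<noteq> 0"
      "\<forall>e<k. (\<Sum>j\<in>?I. (a k j0 * a e j - a e j0 * a k j) * y j) = 0"
      using Suc.IH[of ?I "\<lambda>e j. a k j0 * a e j - a e j0 * a k j"] by blast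
    define s where "s = (\<Sum>j\<in>?I. a k j * y j)"
    define x where "x = (\<lambda>j. if j = j0 then - s else a k j0 * y j)"
    have sum: "(\<Sum>j\<in>I. a e j * x j) = a k j0 * (\<Sum>j\<in>?I. a e j * y j) - a e j0 * s" for e
    proof -
      have "(\<Sum>j\<in>I. a e j * x j) = a e j0 * x j0 + (\<Sum>j\<in>?I. a e j * x j)"
        using Suc.prems j0 by (intro sum.remove)
      also have "(\<Sum>j\<in>?I. a e j * x j) = (\<Sum>j\<in>?I. a k j0 * (a e j * y j))"
        by (intro sum.cong) (auto simp: x_def)
      also have "\<dots> = a k j0 * (\<Sum>j\<in>?I. a e j * y j)" by (simp only: sum_distrib_left)
      finally show ?thesis by (simp add: x_def)
    qed
    have "(\<Sum>j\<in>I. a e j * x j) = 0" if "e < Suc k" for e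
    proof (cases "e = k")
      case True
      then show ?thesis unfolding sum by (simp add: s_def)
    next
      case False
      then have "(\<Sum>j\<in>?I. (a k j0 * a e j - a e j0 * a k j) * y j) = 0" using y(3) that by simp
      then show ?thesis
        unfolding sum s_def by (simp add: sum_distrib_left sum_subtractf[symmetric] left_diff_distrib mult.assoc)
    qed
    moreover have "\<exists>j\<in>I. x j \<noteq> 0" using y(2) j0 by (auto simp: x_def)
    moreover have "\<forall>j. j \<notin> I \<longrightarrow> x j = 0" using y(1) j0 by (auto simp: x_def)
    ultimately show ?thesis by blast
  qed
qed

section \<open>Quadratic forms over the integers\<close>

text \<open>The axioms are stable under negating \<open>Q\<close> and \<open>B\<close>, so results
  on positive values also yield those on negative values.\<close>

locale int_quadratic_space =
  fixes n :: nat and Q :: "(nat \<Rightarrow> int) \<Rightarrow> int" and B :: "(nat \<Rightarrow> int) \<Rightarrow> (nat \<Rightarrow> int) \<Rightarrow> int"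
  assumes dim: "n \<ge> 3"
    and B_add: "B (\<lambda>i. x i + y i) z = B x z + B y z"
    and B_scale: "B (\<lambda>i. c * x i) y = c * B x y"
    and B_sym: "B x y = B y x"
    and Q_add: "Q (\<lambda>i. x i + y i) = Q x + Q y + B x y"
    and Q_scale: "Q (\<lambda>i. c * x i) = c\<^sup>2 * Q x"
    and nondeg: "x \<in> int_lattice n \<Longrightarrow> (\<And>y. y \<in> int_lattice n \<Longrightarrow> B x y = 0) \<Longrightarrow> x = (\<lambda>_. 0)"
begin

abbreviation "V \<equiv> int_lattice n"

definition orthogonal_family :: "nat \<Rightarrow> (nat \<Rightarrow> nat \<Rightarrow> int) \<Rightarrow> bool" where
  "orthogonal_family \<nu> d \<longleftrightarrow> (\<forall>i<\<nu>. d i \<in> V \<and> Q (d i) \<noteq> 0) \<and>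
     (\<forall>i<\<nu>. \<forall>j<\<nu>. i \<noteq> j \<longrightarrow> B (d i) (d j) = 0)"

lemma V_add: "x \<in> V \<Longrightarrow> y \<in> V \<Longrightarrow> (\<lambda>i. x i + y i) \<in> V"
  by (simp add: int_lattice_def)

lemma V_scale: "x \<in> V \<Longrightarrow> (\<lambda>i. c * x i) \<in> V"
  by (simp add: int_lattice_def)

lemma V_sum: "(\<And>i. i \<in> I \<Longrightarrow> d i \<in> V) \<Longrightarrow> (\<lambda>j. \<Sum>i\<in>I. c i * d i j) \<in> V"
  by (simp add: int_lattice_def)

lemma B_zero: "B (\<lambda>_. 0) y = 0"
  using B_scale[of 0 "\<lambda>_. 0" y] by simp

lemma Q_zero: "Q (\<lambda>_. 0) = 0"
  using Q_scale[of 0 "\<lambda>_. 0"] by simp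

lemma B_self: "B x x = 2 * Q x"
proof -
  have "Q (\<lambda>i. x i + x i) = 4 * Q x" using Q_scale[of 2 x] by (simp only: mult_2) simp
  then show ?thesis using Q_add[of x x] by linarith
qed

lemma B_sum: "B (\<lambda>j. \<Sum>i\<in>I. c i * d i j) y = (\<Sum>i\<in>I. c i * B (d i) y)"
proof (induction I rule: infinite_finite_induct)
  case (insert i I)
  have "B (\<lambda>j. \<Sum>l\<in>insert i I. c l * d l j) y = B (\<lambda>j. c i * d i j + (\<Sum>l\<in>I. c l * d l j)) y"
    using insert.hyps by simp
  also have "\<dots> = c i * B (d i) y + (\<Sum>l\<in>I. c l * B (d l) y)"
    by (simp only: B_add B_scale insert.IH)
  finally show ?case using insert.hyps by simp
qed (simp_all add: B_zero)

lemma Q_orthogonal_sum: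
  assumes "\<And>i j. i \<in> I \<Longrightarrow> j \<in> I \<Longrightarrow> i \<noteq> j \<Longrightarrow> B (d i) (d j) = 0"
  shows "Q (\<lambda>j. \<Sum>i\<in>I. c i * d i j) = (\<Sum>i\<in>I. (c i)\<^sup>2 * Q (d i))"
  using assms
proof (induction I rule: infinite_finite_induct)
  case (insert i I)
  have "Q (\<lambda>j. \<Sum>l\<in>insert i I. c l * d l j) = Q (\<lambda>j. c i * d i j + (\<Sum>l\<in>I. c l * d l j))"
    using insert.hyps by simp
  also have "\<dots> = (c i)\<^sup>2 * Q (d i) + (\<Sum>l\<in>I. (c l)\<^sup>2 * Q (d l)) + B (\<lambda>j. c i * d i j) (\<lambda>j. \<Sum>l\<in>I. c l * d l j)"
    using insert by (simp add: Q_add Q_scale)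
  also have "B (\<lambda>j. c i * d i j) (\<lambda>j. \<Sum>l\<in>I. c l * d l j) = c i * (\<Sum>l\<in>I. c l * B (d l) (d i))"
    by (simp only: B_scale B_sym[of "d i"] B_sum)
  also have "(\<Sum>l\<in>I. c l * B (d l) (d i)) = 0"
    using insert by (intro sum.neutral) auto
  finally show ?case using insert.hyps by simp
qed (simp_all add: Q_zero)

lemma B_expand:
  assumes "x \<in> V"
  shows "B x y = (\<Sum>j<n. B (\<lambda>i. if i = j then 1 else 0) y * x j)"
proof -
  have "x = (\<lambda>i. \<Sum>j<n. x j * (if i = j then 1 else 0))"
    using assms by (auto simp: int_lattice_def if_distrib[of "\<lambda>z. _ * z"] cong: if_cong)
  then have "B x y = B (\<lambda>i. \<Sum>j<n. x j * (if i = j then 1 else 0)) y" by simp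
  also have "\<dots> = (\<Sum>j<n. x j * B (\<lambda>i. if i = j then 1 else 0) y)" by (rule B_sum)
  finally show ?thesis by (simp add: mult.commute)
qed

text \<open>More than \<open>n\<close> vectors satisfy a nontrivial linear relation, and pairing it
  with \<open>d i\<close> isolates \<open>2 * c i * Q (d i)\<close>.\<close>

lemma orthogonal_family_size:
  assumes "orthogonal_family \<nu> d"
  shows "\<nu> \<le> n"
proof (rule ccontr)
  assume "\<not> \<nu> \<le> n"
  then obtain c where c: "\<exists>j\<in>{..<\<nu>}. c j \<noteq> 0" "\<forall>e<n. (\<Sum>j<\<nu>. d j e * c j) = 0"
    using homogeneous_system_nontrivial[of "{..<\<nu>}" n "\<lambda>e j. d j e"] by auto
  then obtain i where i: "i < \<nu>" "c i \<noteq> 0" by auto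
  have "(\<lambda>j. \<Sum>l<\<nu>. c l * d l j) = (\<lambda>_. 0)"
  proof
    fix j
    show "(\<Sum>l<\<nu>. c l * d l j) = 0"
    proof (cases "j < n")
      case True
      then show ?thesis using c(2) by (simp add: mult.commute)
    next
      case False
      then show ?thesis using assms by (simp add: orthogonal_family_def int_lattice_def)
    qed
  qed
  then have "0 = B (\<lambda>j. \<Sum>l<\<nu>. c l * d l j) (d i)" by (simp add: B_zero)
  also have "\<dots> = (\<Sum>l<\<nu>. c l * B (d l) (d i))" by (rule B_sum)
  also have "\<dots> = c i * B (d i) (d i) + (\<Sum>l\<in>{..<\<nu>} - {i}. c l * B (d l) (d i))"
    using i by (intro sum.remove) auto
  also have "(\<Sum>l\<in>{..<\<nu>} - {i}. c l * B (d l) (d i)) = 0"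
    using assms i by (intro sum.neutral) (auto simp: orthogonal_family_def)
  finally show False using assms i by (auto simp: orthogonal_family_def B_self)
qed

text \<open>For an orthogonal family of maximal size, \<open>Q\<close> vanishes on the orthogonal
  complement, since any other vector there would extend the family. By polarisation \<open>B\<close>
  vanishes on the complement too, which therefore lies in the radical and is zero.\<close>

lemma orthogonal_basis:
  obtains \<nu> d N e where "\<nu> \<ge> 3" "orthogonal_family \<nu> d" "N \<noteq> 0"
    "\<And>v. v \<in> V \<Longrightarrow> (\<lambda>j. N * v j) = (\<lambda>j. \<Sum>i<\<nu>. (e i * B v (d i)) * d i j)"
proof -
  define T where "T = {\<mu>. \<exists>d. orthogonal_family \<mu> d}"
  have "finite T"
    by (rule finite_subset[of _ "{..n}"]) (use orthogonal_family_size in \<open>auto simp: T_def\<close>)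
  moreover have "0 \<in> T" by (simp add: T_def orthogonal_family_def)
  ultimately have "Max T \<in> T" "\<And>\<mu>. \<mu> \<in> T \<Longrightarrow> \<mu> \<le> Max T" by (auto intro: Max_in)
  then obtain \<nu> d where d: "orthogonal_family \<nu> d" and mx: "\<And>\<mu> d'. orthogonal_family \<mu> d' \<Longrightarrow> \<mu> \<le> \<nu>"
    unfolding T_def by blast
  have dV: "d i \<in> V" "Q (d i) \<noteq> 0" if "i < \<nu>" for i using d that by (auto simp: orthogonal_family_def)
  have dO: "B (d i) (d j) = 0" if "i < \<nu>" "j < \<nu>" "i \<noteq> j" for i j
    using d that by (auto simp: orthogonal_family_def)
  have iso: "Q x = 0" if x: "x \<in> V" "\<And>i. i < \<nu> \<Longrightarrow> B x (d i) = 0" for x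
  proof (rule ccontr)
    assume "Q x \<noteq> 0"
    then have "orthogonal_family (Suc \<nu>) (d(\<nu> := x))"
      using d x by (auto simp: orthogonal_family_def less_Suc_eq B_sym[of "d _" x])
    from mx[OF this] show False by simp
  qed
  \<comment> \<open>The orthogonal projection has coefficients
    \<open>B v (d i) / (2 * Q (d i))\<close>. Multiplication by \<open>N\<close> clears these
    denominators and turns the coefficient into \<open>e i * B v (d i)\<close>.\<close>
  define N where "N = (\<Prod>i<\<nu>. 2 * Q (d i))"
  define e where "e = (\<lambda>i. \<Prod>j\<in>{..<\<nu>} - {i}. 2 * Q (d j))"
  have Ne: "N = 2 * Q (d i) * e i" if "i < \<nu>" for i
    unfolding N_def e_def using that by (intro prod.remove) auto
  have N0: "N \<noteq> 0" unfolding N_def using dV by simp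
  define pr where "pr = (\<lambda>v j. \<Sum>i<\<nu>. (e i * B v (d i)) * d i j)"
  define perp where "perp = (\<lambda>v j. N * v j + (- 1) * pr v j)"
  have prV: "pr v \<in> V" for v unfolding pr_def using dV by (intro V_sum) auto
  have perpV: "perp v \<in> V" if "v \<in> V" for v
    unfolding perp_def using that prV by (intro V_add V_scale) auto
  have Bpr: "B (pr v) (d j) = N * B v (d j)" if j: "j < \<nu>" for v j
  proof -
    have "B (pr v) (d j) = (\<Sum>i<\<nu>. (e i * B v (d i)) * B (d i) (d j))"
      unfolding pr_def by (rule B_sum)
    also have "\<dots> = (e j * B v (d j)) * B (d j) (d j) + (\<Sum>i\<in>{..<\<nu>} - {j}. (e i * B v (d i)) * B (d i) (d j))"
      using j by (intro sum.remove) auto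
    also have "(\<Sum>i\<in>{..<\<nu>} - {j}. (e i * B v (d i)) * B (d i) (d j)) = 0"
      using dO j by (intro sum.neutral) auto
    finally show ?thesis using Ne[OF j] by (simp add: B_self mult_ac)
  qed
  have Bperp: "B (perp v) (d j) = 0" if "j < \<nu>" for v j
    unfolding perp_def by (simp only: B_add B_scale Bpr[OF that])
  have perp0: "perp v = (\<lambda>_. 0)" if v: "v \<in> V" for v
  proof (rule nondeg[OF perpV[OF v]])
    fix w assume w: "w \<in> V"
    have "Q (\<lambda>i. perp v i + perp w i) = 0"
      using perpV v w Bperp by (intro iso V_add) (auto simp: B_add)
    moreover have "Q (perp v) = 0" "Q (perp w) = 0" using perpV v w Bperp by (auto intro!: iso)
    ultimately have vw: "B (perp w) (perp v) = 0" using Q_add[of "perp v" "perp w"] B_sym by simp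
    have "B (pr w) (perp v) = (\<Sum>i<\<nu>. (e i * B w (d i)) * B (d i) (perp v))"
      unfolding pr_def by (rule B_sum)
    also have "\<dots> = 0" using Bperp by (intro sum.neutral) (auto simp: B_sym[of "d _"])
    finally have "B (pr w) (perp v) = 0" .
    moreover have "B (perp w) (perp v) = N * B w (perp v) + (- 1) * B (pr w) (perp v)"
      unfolding fun_cong[OF perp_def, of w] by (simp only: B_add B_scale)
    ultimately have "N * B w (perp v) = 0" using vw by simp
    then show "B (perp v) w = 0" using N0 B_sym by simp
  qed
  have rep: "(\<lambda>j. N * v j) = (\<lambda>j. \<Sum>i<\<nu>. (e i * B v (d i)) * d i j)" if v: "v \<in> V" for v
  proof
    fix j
    show "N * v j = (\<Sum>i<\<nu>. (e i * B v (d i)) * d i j)"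
      using fun_cong[OF perp0[OF v], of j] by (simp add: perp_def pr_def)
  qed
  \<comment> \<open>A family of fewer than three vectors would leave, by counting equations, a
    nonzero vector orthogonal to all of it, whose expansion in the family is zero.\<close>
  have "\<nu> \<ge> 3"
  proof (rule ccontr)
    assume "\<not> \<nu> \<ge> 3"
    then have "\<nu> < card {..<n}" using dim by simp
    then obtain x where x: "\<forall>j. j \<notin> {..<n} \<longrightarrow> x j = 0" "\<exists>j\<in>{..<n}. x j \<noteq> 0"
      "\<forall>l<\<nu>. (\<Sum>j<n. B (\<lambda>i. if i = j then 1 else 0) (d l) * x j) = 0"
      using homogeneous_system_nontrivial[of "{..<n}" \<nu> "\<lambda>l j. B (\<lambda>i. if i = j then 1 else 0) (d l)"] by blast
    have xV: "x \<in> V" using x(1) by (simp add: int_lattice_def)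
    have "B x (d l) = 0" if "l < \<nu>" for l using x(3) B_expand[OF xV] that by simp
    then have "(\<Sum>i<\<nu>. (e i * B x (d i)) * d i j) = 0" for j by (intro sum.neutral) auto
    then have "N * x j = 0" for j using fun_cong[OF rep[OF xV], of j] by simp
    then show False using x(2) N0 by auto
  qed
  then show thesis using d N0 rep by (intro that[of \<nu> d N e])
qed

text \<open>The exponent \<open>K\<close> is chosen twice. Large relative to one fixed vector, it
  yields a class that is filled up to a null set, hence positivity; large relative to \<epsilon>, it
  makes the excluded values rare, hence convergence.\<close>

lemma values_density:
  assumes pos: "\<exists>v\<in>V. Q v > 0"
  shows "\<exists>\<delta>>0. (\<lambda>m. real (card ((Q ` V - {0}) \<inter> {1..int m})) / real m) \<longlonglongrightarrow> \<delta>"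
proof -
  obtain \<nu> d N e where \<nu>: "\<nu> \<ge> 3" and d: "orthogonal_family \<nu> d" and N: "N \<noteq> 0"
    and rep: "\<And>v. v \<in> V \<Longrightarrow> (\<lambda>j. N * v j) = (\<lambda>j. \<Sum>i<\<nu>. (e i * B v (d i)) * d i j)"
    using orthogonal_basis by blast
  define S where "S = Q ` V - {0}"
  have dV: "d i \<in> V" "Q (d i) \<noteq> 0" if "i < \<nu>" for i using d that by (auto simp: orthogonal_family_def)
  have dO: "B (d i) (d j) = 0" if "i < \<nu>" "j < \<nu>" "i \<noteq> j" for i j
    using d that by (auto simp: orthogonal_family_def)
  have Q_lc: "Q (\<lambda>j. \<Sum>i<\<nu>. c i * d i j) = (\<Sum>i<\<nu>. (c i)\<^sup>2 * Q (d i))" for c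
    using dO by (intro Q_orthogonal_sum) auto
  have NQ: "N\<^sup>2 * Q v = (\<Sum>i<\<nu>. (e i * B v (d i))\<^sup>2 * Q (d i))" if "v \<in> V" for v
    using Q_scale[of N v] Q_lc rep[OF that] by simp
  obtain i0 where i0: "i0 < \<nu>" "Q (d i0) > 0"
  proof -
    obtain v where v: "v \<in> V" "Q v > 0" using pos by blast
    have "\<exists>i<\<nu>. Q (d i) > 0"
    proof (rule ccontr)
      assume "\<not> (\<exists>i<\<nu>. Q (d i) > 0)"
      then have "(\<Sum>i<\<nu>. (e i * B v (d i))\<^sup>2 * Q (d i)) \<le> 0"
        by (intro sum_nonpos mult_nonneg_nonpos) (auto simp: not_less[symmetric])
      moreover have "N\<^sup>2 * Q v > 0" using N v by simp
      ultimately show False using NQ[OF v(1)] by simp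
    qed
    then show thesis using that by blast
  qed
  \<comment> \<open>The factor 30 leaves only primes from 7 on outside \<open>R0\<close>, and the
    factors \<open>Q (d i)\<close> collect the primes at which a diagonal coefficient
    degenerates.\<close>
  define R0 where "R0 = 30 * \<bar>N\<bar> * (\<Prod>i<\<nu>. \<bar>Q (d i)\<bar>)"
  have R0: "R0 > 0" unfolding R0_def using N dV by (intro mult_pos_pos prod_pos) auto
  have R0Q: "Q (d i) dvd R0" if "i < \<nu>" for i
  proof -
    have "\<bar>Q (d i)\<bar> dvd (\<Prod>i<\<nu>. \<bar>Q (d i)\<bar>)" using that by (intro dvd_prodI) auto
    then show ?thesis unfolding R0_def by simp
  qed
  \<comment> \<open>With \<open>M = R0 ^ K\<close>, the nice vectors are those whose class mod \<open>M\<close> has no local obstruction.\<close>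
  define g where "g = (\<lambda>K v. Gcd (insert (R0 ^ K) ((\<lambda>i. B v (d i)) ` {..<\<nu>})))"
  define nice where "nice = (\<lambda>K v. \<forall>p. prime p \<longrightarrow> int p dvd R0 \<longrightarrow> int p dvd R0 ^ K div g K v)"
  have gM: "g K v dvd R0 ^ K" for K v unfolding g_def by (rule Gcd_dvd) simp
  have gB: "g K v dvd B v (d i)" if "i < \<nu>" for K v i unfolding g_def by (rule Gcd_dvd) (use that in simp)
  have g0: "g K v > 0" for K v
  proof -
    have "g K v \<noteq> 0" using gM[of K v] R0 by auto
    moreover have "g K v \<ge> 0" by (simp add: g_def)
    ultimately show ?thesis by simp
  qed
  have Mgk: "R0 ^ K = g K v * (R0 ^ K div g K v)" for K v using gM[of K v] by simp
  have cls: "null_density {x. g K v * R0 ^ K dvd x - Q v \<and> x \<notin> S}" if v: "v \<in> V" and nv: "nice K v" for K v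
  proof -
    define M where "M = R0 ^ K"
    define k where "k = M div g K v"
    define \<beta> where "\<beta> = (\<lambda>i. B v (d i) div g K v)"
    define A where "A = (\<lambda>i. k * Q (d i))"
    have M: "M > 0" "M = g K v * k" using R0 Mgk[of K v] by (auto simp: M_def k_def)
    have k: "k > 0" using M g0[of K v] by (simp add: zero_less_mult_iff)
    have b: "B v (d i) = g K v * \<beta> i" if "i < \<nu>" for i using gB[OF that] by (simp add: \<beta>_def)
    have "null_density (- range (diag_quad \<nu> \<beta> A))"
    proof (rule diag_quad_almost_all[where k = k and ?i0.0 = i0])
      fix p :: nat assume p: "prime p" "\<not> int p dvd k"
      then have pR: "\<not> int p dvd R0" using nv by (auto simp: nice_def k_def M_def)
      have "\<not> p dvd 30" using pR unfolding R0_def by (metis dvd_mult2 int_dvd_int_iff of_nat_numeral)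
      then have p235: "p \<noteq> 2" "p \<noteq> 3" "p \<noteq> 5" by auto
      have "p \<ge> 7"
      proof (rule ccontr)
        assume "\<not> p \<ge> 7"
        then have "p \<in> {0,1,4,6}" using p235 by auto
        moreover have "\<not> prime (4::nat)" "\<not> prime (6::nat)"
          using prime_product[of 2 2] prime_product[of 2 3] by auto
        ultimately show False using p(1) by auto
      qed
      moreover have "\<not> int p dvd A i" if "i < \<nu>" for i
      proof
        assume "int p dvd A i"
        moreover have "prime (int p)" using p by simp
        ultimately have "int p dvd Q (d i)" using p(2) unfolding A_def by (simp add: prime_dvd_mult_iff)
        then show False using R0Q[OF that] pR dvd_trans by blast
      qed
      ultimately show "p \<ge> 7 \<and> (\<forall>i<\<nu>. \<not> int p dvd A i)" by blast
    next
      fix p :: nat assume p: "prime p" "int p dvd k"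
      show "\<exists>i<\<nu>. \<not> int p dvd \<beta> i"
      proof (rule ccontr)
        assume "\<not> (\<exists>i<\<nu>. \<not> int p dvd \<beta> i)"
        then have all: "int p dvd \<beta> i" if "i < \<nu>" for i using that by blast
        \<comment> \<open>A prime of \<open>k\<close> dividing every \<open>\<beta> i\<close> could
          be absorbed into the greatest common divisor, contradicting its maximality.\<close>
        have "g K v * int p dvd Gcd (insert (R0 ^ K) ((\<lambda>i. B v (d i)) ` {..<\<nu>}))"
        proof (rule Gcd_greatest)
          fix x assume "x \<in> insert (R0 ^ K) ((\<lambda>i. B v (d i)) ` {..<\<nu>})"
          then consider "x = M" | i where "i < \<nu>" "x = B v (d i)" by (auto simp: M_def)
          then show "g K v * int p dvd x"
          proof cases
            case 1
            then show ?thesis using p(2) unfolding 1 M(2) by (intro mult_dvd_mono) auto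
          next
            case 2
            then show ?thesis unfolding 2(2) b[OF 2(1)] using all by (intro mult_dvd_mono) auto
          qed
        qed
        also have "\<dots> = g K v * 1" by (simp add: g_def)
        finally have "int p dvd 1" unfolding dvd_mult_cancel_left using g0[of K v] by simp
        then show False using p(1) by simp
      qed
    qed (use \<nu> i0 k dV in \<open>auto simp: A_def\<close>)
    then have "null_density ((\<lambda>m. Q v + (g K v * M) * m) ` (- range (diag_quad \<nu> \<beta> A)))"
      using g0 M by (intro null_density_affine_image) auto
    then show ?thesis
    proof (rule null_density_subset, intro subsetI)
      fix x assume x: "x \<in> {x. g K v * R0 ^ K dvd x - Q v \<and> x \<notin> S} \<inter> {0<..}"
      then obtain m where m: "x - Q v = g K v * M * m" by (auto simp: M_def elim: dvdE)
      \<comment> \<open>If \<open>m\<close> were a value at \<open>t\<close>, then moving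
        \<open>v\<close> by \<open>M * t i\<close> along each \<open>d i\<close> would represent
        \<open>x\<close>.\<close>
      have "m \<notin> range (diag_quad \<nu> \<beta> A)"
      proof
        assume "m \<in> range (diag_quad \<nu> \<beta> A)"
        then obtain t where t: "m = diag_quad \<nu> \<beta> A t" by blast
        define u where "u = (\<lambda>j. \<Sum>i<\<nu>. (M * t i) * d i j)"
        have "Q (\<lambda>j. v j + u j) = Q v + Q u + B u v" by (simp add: Q_add B_sym)
        also have "Q u = (\<Sum>i<\<nu>. (M * t i)\<^sup>2 * Q (d i))" unfolding u_def by (rule Q_lc)
        also have "B u v = (\<Sum>i<\<nu>. (M * t i) * B (d i) v)" unfolding u_def by (rule B_sum)
        also have "Q v + (\<Sum>i<\<nu>. (M * t i)\<^sup>2 * Q (d i)) + (\<Sum>i<\<nu>. (M * t i) * B (d i) v)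
            = Q v + (\<Sum>i<\<nu>. g K v * M * (\<beta> i * t i + A i * (t i)\<^sup>2))"
        proof -
          have "(\<Sum>i<\<nu>. (M * t i)\<^sup>2 * Q (d i)) + (\<Sum>i<\<nu>. (M * t i) * B (d i) v)
             = (\<Sum>i<\<nu>. g K v * M * (\<beta> i * t i + A i * (t i)\<^sup>2))"
            unfolding sum.distrib[symmetric]
          proof (rule sum.cong)
            fix i assume "i \<in> {..<\<nu>}"
            then have "B (d i) v = g K v * \<beta> i" using b B_sym by simp
            moreover have "(M * t i)\<^sup>2 * Q (d i) = g K v * M * (A i * (t i)\<^sup>2)"
              by (subst (1) power2_eq_square, subst (1) M(2)) (simp add: A_def power2_eq_square mult_ac)
            ultimately show "(M * t i)\<^sup>2 * Q (d i) + M * t i * B (d i) v = g K v * M * (\<beta> i * t i + A i * (t i)\<^sup>2)"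
              by (simp add: algebra_simps)
          qed simp
          then show ?thesis by simp
        qed
        also have "\<dots> = x" using m t by (simp add: diag_quad_def sum_distrib_left)
        finally have "Q (\<lambda>j. v j + u j) = x" .
        moreover have "(\<lambda>j. v j + u j) \<in> V"
          unfolding u_def using v dV by (intro V_add V_sum) auto
        ultimately have "x \<in> S" using x by (auto simp: S_def)
        then show False using x by simp
      qed
      then show "x \<in> (\<lambda>m. Q v + (g K v * M) * m) ` (- range (diag_quad \<nu> \<beta> A))"
        using m by (intro image_eqI[of _ _ m]) auto
    qed
  qed
  \<comment> \<open>The modulus \<open>g K v * R0 ^ K\<close> varies with \<open>v\<close>, but it
    always divides \<open>R0 ^ K * R0 ^ K\<close>, which therefore serves all nice vectors at
    once.\<close>
  have cls': "null_density {x. x mod (R0 ^ K * R0 ^ K) = r \<and> x \<notin> S}"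
    if v: "v \<in> V" "nice K v" and r: "g K v * R0 ^ K dvd r - Q v" for K v r
  proof (rule null_density_subset[OF cls[OF v]], intro subsetI)
    fix x assume x: "x \<in> {x. x mod (R0 ^ K * R0 ^ K) = r \<and> x \<notin> S} \<inter> {0<..}"
    then have "r = x mod (R0 ^ K * R0 ^ K)" by simp
    then have "R0 ^ K * R0 ^ K dvd x - r" by (simp only: minus_mod_eq_mult_div dvd_triv_left)
    with mult_dvd_mono[OF gM dvd_refl] have "g K v * R0 ^ K dvd x - r" by (rule dvd_trans)
    from dvd_add[OF this r] have "g K v * R0 ^ K dvd x - Q v" by simp
    then show "x \<in> {x. g K v * R0 ^ K dvd x - Q v \<and> x \<notin> S}" using x by simp
  qed
  define Pr where "Pr = {p. prime p \<and> int p dvd R0}"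
  have finPr: "finite Pr"
  proof (rule finite_subset)
    show "Pr \<subseteq> {..nat R0}"
    proof
      fix p assume "p \<in> Pr"
      then have "int p \<le> R0" using R0 by (intro zdvd_imp_le) (auto simp: Pr_def)
      then show "p \<in> {..nat R0}" by simp
    qed
  qed simp
  \<comment> \<open>If \<open>p\<close> does not divide \<open>R0 ^ K div g K v\<close>, then the
    full power \<open>p^K\<close> divides \<open>g K v\<close>, hence every
    \<open>B v (d i)\<close>, and \<open>N^2 * Q v\<close> is a combination of the squares of these
    numbers.\<close>
  have notnice: "\<exists>p\<in>Pr. int p ^ (2 * K) dvd N\<^sup>2 * Q v" if v: "v \<in> V" "\<not> nice K v" for K v
  proof -
    obtain p where p: "prime p" "int p dvd R0" "\<not> int p dvd R0 ^ K div g K v" using v by (auto simp: nice_def)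
    have "coprime (int p ^ K) (R0 ^ K div g K v)"
      using p by (simp add: coprime_power_left_iff prime_imp_coprime)
    moreover have "int p ^ K dvd g K v * (R0 ^ K div g K v)"
      unfolding Mgk[symmetric] using p by (intro dvd_power_same)
    ultimately have pg: "int p ^ K dvd g K v" by (simp add: coprime_dvd_mult_left_iff)
    have "int p ^ (2 * K) dvd N\<^sup>2 * Q v"
      unfolding NQ[OF v(1)]
    proof (rule dvd_sum)
      fix i assume "i \<in> {..<\<nu>}"
      then have "int p ^ K dvd e i * B v (d i)" using pg gB[of i K v] by (intro dvd_mult) (auto intro: dvd_trans)
      then have "(int p ^ K)\<^sup>2 dvd (e i * B v (d i))\<^sup>2" by (intro dvd_power_same)
      then show "int p ^ (2 * K) dvd (e i * B v (d i))\<^sup>2 * Q (d i)"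
        by (intro dvd_mult2) (simp add: power_mult[symmetric] mult.commute)
    qed
    then show ?thesis using p by (auto simp: Pr_def)
  qed
  have p4: "(4::int) ^ K \<le> int p ^ (2 * K)" if "p \<in> Pr" for p K
  proof -
    have "2 \<le> p" using that by (auto simp: Pr_def prime_ge_2_nat)
    then have "(2::int)\<^sup>2 ^ K \<le> (int p)\<^sup>2 ^ K" by (intro power_mono) auto
    then show ?thesis by (simp add: power_mult)
  qed
  obtain q0 :: nat and r0 where cls0: "q0 > 0" "r0 \<in> {0..<int q0}" "null_density {x. x mod int q0 = r0 \<and> x \<notin> S}"
  proof -
    obtain v where v: "v \<in> V" "Q v > 0" using pos by blast
    \<comment> \<open>The vector \<open>v\<close> is nice as soon as \<open>4^K\<close> exceeds
      \<open>N^2 * Q v\<close>, and this number itself is a sufficient exponent.\<close>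
    define K where "K = nat (N\<^sup>2 * Q v)"
    have "nice K v"
    proof (rule ccontr)
      assume "\<not> nice K v"
      then obtain p where p: "p \<in> Pr" "int p ^ (2 * K) dvd N\<^sup>2 * Q v" using notnice v by blast
      have NQ0: "N\<^sup>2 * Q v > 0" using N v by simp
      then have "int p ^ (2 * K) \<le> N\<^sup>2 * Q v" using p(2) by (intro zdvd_imp_le)
      then have "4 ^ K \<le> N\<^sup>2 * Q v" using p4[OF p(1), of K] by linarith
      then have "(4::int) ^ K \<le> int K" using NQ0 by (simp add: K_def)
      moreover have "int K < 2 ^ K" using less_exp[of K] by (metis of_nat_less_iff of_nat_numeral of_nat_power)
      moreover have "(2::int) ^ K \<le> 4 ^ K" by (intro power_mono) auto
      ultimately show False by linarith
    qed
    define M where "M = R0 ^ K * R0 ^ K"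
    have M: "M > 0" using R0 by (simp add: M_def)
    have "g K v * R0 ^ K dvd M" unfolding M_def using gM by (intro mult_dvd_mono) auto
    moreover have "M dvd Q v mod M - Q v" by (simp add: mod_eq_dvd_iff[symmetric])
    ultimately have "g K v * R0 ^ K dvd Q v mod M - Q v" using dvd_trans by blast
    from cls'[OF v(1) \<open>nice K v\<close> this]
    have "null_density {x. x mod int (nat M) = Q v mod M \<and> x \<notin> S}" using M by (simp add: M_def)
    then show thesis using M by (intro that[of "nat M" "Q v mod M"]) auto
  qed
  have "\<exists>\<delta>>0. (\<lambda>m. real (card (S \<inter> {1..int m})) / real m) \<longlonglongrightarrow> \<delta>"
  proof (rule density_of_almost_periodic[OF _ cls0])
    fix \<epsilon> :: real assume \<epsilon>: "\<epsilon> > 0"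
    \<comment> \<open>Values of vectors that are not nice have density at most
      \<open>card Pr * N^2 / 4^K\<close>, which this choice makes smaller than \<epsilon>.\<close>
    obtain K where K: "real (card Pr) * real_of_int (N\<^sup>2) / \<epsilon> < 4 ^ K"
      using real_arch_pow[of 4] by auto
    define M where "M = R0 ^ K"
    have M: "M > 0" using R0 by (simp add: M_def)
    define q where "q = nat (M * M)"
    have q: "int q = M * M" "q > 0" using M by (auto simp: q_def)
    define A where "A = {r\<in>{0..<int q}. \<exists>v\<in>V. nice K v \<and> g K v * M dvd r - Q v}"
    define Bd where "Bd = (\<Union>p\<in>Pr. {x. int p ^ (2 * K) dvd N\<^sup>2 * x})"
    have "x mod int q \<in> A \<or> x \<in> Bd" if x: "x \<in> S" for x
    proof -
      obtain v where v: "v \<in> V" "x = Q v" using x by (auto simp: S_def)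
      show ?thesis
      proof (cases "nice K v")
        case True
        have "g K v * M dvd M * M" using gM[of K v] unfolding M_def by (intro mult_dvd_mono) auto
        moreover have "M * M dvd x mod int q - x" unfolding q(1) by (simp add: mod_eq_dvd_iff[symmetric])
        ultimately have "g K v * M dvd x mod int q - Q v" using v(2) dvd_trans by blast
        then have "x mod int q \<in> A" using True v q(2) by (auto simp: A_def)
        then show ?thesis by simp
      next
        case False
        then show ?thesis using notnice[OF v(1)] v(2) by (auto simp: Bd_def)
      qed
    qed
    moreover have "null_density {x. x mod int q = r \<and> x \<notin> S}" if "r \<in> A" for r
      using that cls'[of _ K r] unfolding A_def q(1) M_def by blast
    moreover have "real (card (Bd \<inter> {1..int m})) \<le> \<epsilon> * real m" for m
    proof -
      have one: "real (card ({x. int p ^ (2 * K) dvd N\<^sup>2 * x} \<inter> {1..int m})) \<le> real_of_int (N\<^sup>2) * m / 4 ^ K" if p: "p \<in> Pr" for p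
      proof -
        define t where "t = int p ^ (2 * K)"
        have t0: "t > 0" using p unfolding t_def by (intro zero_less_power) (auto simp: Pr_def prime_gt_0_nat)
        \<comment> \<open>Distinct \<open>x\<close> give distinct positive multiples
          \<open>N^2 * x\<close> of \<open>t\<close> up to \<open>N^2 * m\<close>, so there are at
          most \<open>N^2 * m / t\<close> of them.\<close>
        have "inj_on (\<lambda>x. N\<^sup>2 * x div t) ({x. t dvd N\<^sup>2 * x} \<inter> {1..int m})"
        proof (rule inj_onI)
          fix x y assume xy: "x \<in> {x. t dvd N\<^sup>2 * x} \<inter> {1..int m}" "y \<in> {x. t dvd N\<^sup>2 * x} \<inter> {1..int m}"
            "N\<^sup>2 * x div t = N\<^sup>2 * y div t"
          then have "N\<^sup>2 * x = N\<^sup>2 * y" using dvd_div_eq_iff by (metis (no_types, lifting) IntD1 dvd_div_mult_self mem_Collect_eq)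
          then show "x = y" using N by simp
        qed
        moreover have "(\<lambda>x. N\<^sup>2 * x div t) ` ({x. t dvd N\<^sup>2 * x} \<inter> {1..int m}) \<subseteq> {1..N\<^sup>2 * int m div t}"
        proof (rule image_subsetI)
          fix x assume x: "x \<in> {x. t dvd N\<^sup>2 * x} \<inter> {1..int m}"
          then obtain s where s: "N\<^sup>2 * x = t * s" by auto
          have "N\<^sup>2 * x > 0" using x N by simp
          then have "s > 0" using s t0 by (simp add: zero_less_mult_iff)
          moreover have "N\<^sup>2 * x div t = s" using s t0 by simp
          moreover have "N\<^sup>2 * x div t \<le> N\<^sup>2 * int m div t"
            using x t0 by (intro zdiv_mono1 mult_left_mono) auto
          ultimately show "N\<^sup>2 * x div t \<in> {1..N\<^sup>2 * int m div t}" by simp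
        qed
        ultimately have "card ({x. t dvd N\<^sup>2 * x} \<inter> {1..int m}) \<le> card {1..N\<^sup>2 * int m div t}"
          by (intro card_inj_on_le) auto
        moreover have "N\<^sup>2 * int m div t \<ge> 0" using t0 by (simp add: pos_imp_zdiv_nonneg_iff)
        ultimately have "real (card ({x. t dvd N\<^sup>2 * x} \<inter> {1..int m})) \<le> real_of_int (N\<^sup>2 * int m div t)" by simp
        also have "\<dots> \<le> real_of_int (N\<^sup>2 * int m) / real_of_int t" by (rule real_of_int_div4)
        also have "\<dots> \<le> real_of_int (N\<^sup>2 * int m) / 4 ^ K"
        proof (intro divide_left_mono)
          have "real_of_int (4 ^ K) \<le> real_of_int t" unfolding t_def using p4[OF p, of K] by (simp only: of_int_le_iff)
          then show "4 ^ K \<le> real_of_int t" by simp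
        qed (use t0 in auto)
        finally show ?thesis by (simp add: t_def)
      qed
      have "Bd \<inter> {1..int m} = (\<Union>p\<in>Pr. {x. int p ^ (2 * K) dvd N\<^sup>2 * x} \<inter> {1..int m})" by (auto simp: Bd_def)
      then have "card (Bd \<inter> {1..int m}) \<le> (\<Sum>p\<in>Pr. card ({x. int p ^ (2 * K) dvd N\<^sup>2 * x} \<inter> {1..int m}))"
        using card_UN_le[OF finPr] by metis
      then have "real (card (Bd \<inter> {1..int m})) \<le> (\<Sum>p\<in>Pr. real (card ({x. int p ^ (2 * K) dvd N\<^sup>2 * x} \<inter> {1..int m})))"
        by (simp flip: of_nat_sum)
      also have "\<dots> \<le> (\<Sum>p\<in>Pr. real_of_int (N\<^sup>2) * m / 4 ^ K)" by (intro sum_mono one)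
      also have "\<dots> = (real (card Pr) * real_of_int (N\<^sup>2) / 4 ^ K) * m" by simp
      also have "\<dots> \<le> \<epsilon> * m"
        using K \<epsilon> by (intro mult_right_mono) (auto simp: field_simps)
      finally show ?thesis .
    qed
    ultimately show "\<exists>(q::nat) A Bd. q > 0 \<and> A \<subseteq> {0..<int q} \<and>
       (\<forall>x\<in>S. x > 0 \<longrightarrow> x mod int q \<in> A \<or> x \<in> Bd) \<and>
       (\<forall>r\<in>A. null_density {x. x mod int q = r \<and> x \<notin> S}) \<and>
       (\<exists>N0. \<forall>N\<ge>N0. real (card (Bd \<inter> {1..int N})) \<le> \<epsilon> * real N)"
      using q(2) by (intro exI[of _ q] exI[of _ A] exI[of _ Bd]) (auto simp: A_def)
  qed
  then show ?thesis by (simp add: S_def)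
qed

end

section \<open>Integral forms as quadratic spaces\<close>

lemma degree_two_monomial:
  assumes "Poly_Mapping.keys m \<subseteq> {..<n}" "(\<Sum>i\<in>Poly_Mapping.keys m. Poly_Mapping.lookup m i) = 2"
  shows "\<exists>i j. \<forall>x::nat \<Rightarrow> int. (\<Prod>l\<in>Poly_Mapping.keys m. x l ^ Poly_Mapping.lookup m l) = x i * x j"
proof -
  let ?K = "Poly_Mapping.keys m" and ?m = "Poly_Mapping.lookup m"
  have fin: "finite ?K" by simp
  have pos: "?m l \<ge> 1" if "l \<in> ?K" for l using that by (simp add: in_keys_iff Suc_le_eq)
  obtain i where i: "i \<in> ?K" using assms(2) by fastforce
  have s: "?m i + (\<Sum>l\<in>?K - {i}. ?m l) = 2" using assms(2) i by (simp add: sum.remove)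
  show ?thesis
  proof (cases "?K - {i} = {}")
    case True
    then have "?K = {i}" using i by blast
    then show ?thesis using s by (intro exI[of _ i]) (simp add: power2_eq_square)
  next
    case False
    then obtain j where j: "j \<in> ?K" "j \<noteq> i" by blast
    have s2: "(\<Sum>l\<in>?K - {i}. ?m l) = ?m j + (\<Sum>l\<in>?K - {i} - {j}. ?m l)"
      using j by (intro sum.remove) auto
    then have "?m i = 1" "?m j = 1" "(\<Sum>l\<in>?K - {i} - {j}. ?m l) = 0"
      using s pos[OF i] pos[OF j(1)] by linarith+
    moreover have "?K - {i} - {j} = {}"
    proof (rule ccontr)
      assume "?K - {i} - {j} \<noteq> {}"
      then obtain l where "l \<in> ?K - {i} - {j}" by blast
      then show False using calculation(3) pos[of l] by auto
    qed
    then have "?K = {i, j}" using i j by blast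
    ultimately show ?thesis using j by (intro exI[of _ i] exI[of _ j]) simp
  qed
qed

text \<open>Writing each monomial as a product of two coordinates makes the polar form bilinear term
  by term.\<close>

lemma quadratic_form_expand:
  assumes "quadratic_form n f"
  obtains a b where "\<And>x. mpoly_eval f x = (\<Sum>m\<in>Poly_Mapping.keys f. Poly_Mapping.lookup f m * (x (a m) * x (b m)))"
proof -
  have "\<forall>m\<in>Poly_Mapping.keys f. \<exists>i j. \<forall>x::nat \<Rightarrow> int. (\<Prod>l\<in>Poly_Mapping.keys m. x l ^ Poly_Mapping.lookup m l) = x i * x j"
    using assms degree_two_monomial unfolding quadratic_form_def by blast
  then obtain a b where "\<forall>m\<in>Poly_Mapping.keys f. \<forall>x::nat \<Rightarrow> int. (\<Prod>l\<in>Poly_Mapping.keys m. x l ^ Poly_Mapping.lookup m l) = x (a m) * x (b m)"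
    by metis
  then show thesis
    by (intro that[of a b]) (simp add: mpoly_eval_def)
qed

lemma quadratic_space_of_form:
  assumes "n \<ge> 3" "quadratic_form n f" "nondegenerate n f"
  shows "int_quadratic_space n (mpoly_eval f) (polar_form f)"
proof -
  obtain a b where Q: "\<And>x. mpoly_eval f x = (\<Sum>m\<in>Poly_Mapping.keys f. Poly_Mapping.lookup f m * (x (a m) * x (b m)))"
    using quadratic_form_expand[OF assms(2)] by blast
  have B: "polar_form f x y = (\<Sum>m\<in>Poly_Mapping.keys f. Poly_Mapping.lookup f m * (x (a m) * y (b m) + y (a m) * x (b m)))" for x y
    unfolding polar_form_def Q sum_subtractf[symmetric] by (intro sum.cong) (simp_all add: algebra_simps)
  show ?thesis
  proof
    show "polar_form f (\<lambda>i. x i + y i) z = polar_form f x z + polar_form f y z" for x y z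
      unfolding B sum.distrib[symmetric] by (intro sum.cong) (simp_all add: algebra_simps)
    show "polar_form f (\<lambda>i. c * x i) y = c * polar_form f x y" for c x y
      unfolding B sum_distrib_left by (intro sum.cong) (simp_all add: algebra_simps)
    show "polar_form f x y = polar_form f y x" for x y
      unfolding B by (intro sum.cong) simp_all
    show "mpoly_eval f (\<lambda>i. x i + y i) = mpoly_eval f x + mpoly_eval f y + polar_form f x y" for x y
      by (simp add: polar_form_def)
    show "mpoly_eval f (\<lambda>i. c * x i) = c\<^sup>2 * mpoly_eval f x" for c x
      unfolding Q sum_distrib_left by (intro sum.cong) (simp_all add: power2_eq_square)
  qed (use assms in \<open>auto simp: nondegenerate_def\<close>)
qed

lemma (in int_quadratic_space) negated: "int_quadratic_space n (\<lambda>x. - Q x) (\<lambda>x y. - B x y)"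
proof
  show "- B x y = - B y x" for x y by (simp add: B_sym)
qed (use dim nondeg in \<open>auto simp: B_add B_scale Q_add Q_scale\<close>)

theorem theorem1p7:
  fixes n :: nat and f :: int_mpoly
  assumes "n \<ge> 3" and "quadratic_form n f" and "nondegenerate n f"
  shows "\<exists>\<delta>. has_density (represented n f) \<delta> \<and> \<delta> > 0"
proof -
  interpret int_quadratic_space n "mpoly_eval f" "polar_form f"
    by (rule quadratic_space_of_form[OF assms])
  \<comment> \<open>The negated space supplies the density of the negative values.\<close>
  interpret neg: int_quadratic_space n "\<lambda>x. - mpoly_eval f x" "\<lambda>x y. - polar_form f x y"
    by (rule negated)
  define S where "S = represented n f"
  have S0: "0 \<notin> S" by (simp add: S_def represented_def)
  have Sp: "\<exists>\<delta>>0. (\<lambda>N. real (card (S \<inter> {1..int N})) / real N) \<longlonglongrightarrow> \<delta>" if x: "x \<in> S" "x > 0" for x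
  proof -
    have "\<exists>v\<in>V. mpoly_eval f v > 0" using x by (auto simp: S_def represented_def)
    from values_density[OF this] show ?thesis by (simp add: S_def represented_def)
  qed
  have neg_card: "card ((\<lambda>x. - x) ` S \<inter> {1..int N}) = card (S \<inter> {- int N..-1})" for N
  proof -
    have "(\<lambda>x. - x) ` S \<inter> {1..int N} = (\<lambda>x. - x) ` (S \<inter> {- int N..-1})" by force
    then show ?thesis by (simp add: card_image)
  qed
  have Sn: "\<exists>\<delta>>0. (\<lambda>N. real (card (S \<inter> {- int N..-1})) / real N) \<longlonglongrightarrow> \<delta>" if x: "x \<in> S" "x < 0" for x
  proof -
    have "\<exists>v\<in>V. - mpoly_eval f v > 0" using x by (auto simp: S_def represented_def)
    moreover have "(\<lambda>x. - mpoly_eval f x) ` V - {0} = (\<lambda>x. - x) ` S"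
      by (force simp: S_def represented_def)
    ultimately show ?thesis using neg.values_density by (simp add: neg_card)
  qed
  \<comment> \<open>If the form had no nonzero value, its polar form would vanish on the lattice and
    the first basis vector would lie in the radical.\<close>
  have "S \<noteq> {}"
  proof
    assume "S = {}"
    then have z: "mpoly_eval f v = 0" if "v \<in> V" for v using that by (auto simp: S_def represented_def)
    define u where "u = (\<lambda>i::nat. if i = 0 then 1 else 0 :: int)"
    have uV: "u \<in> V" using assms(1) by (auto simp: u_def int_lattice_def)
    have "u = (\<lambda>_. 0)"
    proof (rule nondeg[OF uV])
      fix y assume "y \<in> V"
      then show "polar_form f u y = 0" using z uV V_add by (simp add: polar_form_def)
    qed
    from fun_cong[OF this, of 0] show False by (simp add: u_def)
  qed
  then obtain x where x: "x \<in> S" "x \<noteq> 0" using S0 by auto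
  consider "positive_set S" | "\<not> positive_set S" "negative_set S" | "\<not> positive_set S" "\<not> negative_set S" by blast
  then have "\<exists>\<delta>. has_density S \<delta> \<and> \<delta> > 0"
  proof cases
    case 1
    then have "x > 0" using x by (force simp: positive_set_def)
    then show ?thesis using Sp[OF x(1)] 1 by (auto simp: has_density_def)
  next
    case 2
    then have "x < 0" using x by (force simp: negative_set_def)
    then show ?thesis using Sn[OF x(1)] 2 by (auto simp: has_density_def)
  next
    case 3
    obtain \<delta>1 where \<delta>1: "\<delta>1 > 0" "(\<lambda>N. real (card (S \<inter> {1..int N})) / real N) \<longlonglongrightarrow> \<delta>1"
      using 3 Sp by (auto simp: negative_set_def)
    obtain \<delta>2 where \<delta>2: "\<delta>2 > 0" "(\<lambda>N. real (card (S \<inter> {- int N..-1})) / real N) \<longlonglongrightarrow> \<delta>2"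
      using 3 Sn by (auto simp: positive_set_def)
    \<comment> \<open>As 0 is excluded, the symmetric interval splits exactly into its positive and
      negative halves, and division by \<open>2 * N\<close> averages the two densities.\<close>
    have "card (S \<inter> {- int N..int N}) = card (S \<inter> {1..int N}) + card (S \<inter> {- int N..-1})" for N
    proof -
      have "S \<inter> {- int N..int N} = (S \<inter> {1..int N}) \<union> (S \<inter> {- int N..-1})"
      proof (intro set_eqI iffI)
        fix y assume y: "y \<in> S \<inter> {- int N..int N}"
        then have "y \<noteq> 0" using S0 by auto
        then show "y \<in> (S \<inter> {1..int N}) \<union> (S \<inter> {- int N..-1})" using y by auto
      qed auto
      then show ?thesis by (simp add: card_Un_disjoint Int_Un_distrib disjoint_iff)
    qed
    then have "(\<lambda>N. real (card (S \<inter> {- int N..int N})) / (2 * real N)) =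
       (\<lambda>N. (real (card (S \<inter> {1..int N})) / real N + real (card (S \<inter> {- int N..-1})) / real N) / 2)"
      by (simp add: add_divide_distrib mult.commute)
    moreover have "(\<lambda>N. (real (card (S \<inter> {1..int N})) / real N + real (card (S \<inter> {- int N..-1})) / real N) / 2) \<longlonglongrightarrow> (\<delta>1 + \<delta>2) / 2"
      by (intro tendsto_intros \<delta>1 \<delta>2) simp
    ultimately have "has_density S ((\<delta>1 + \<delta>2) / 2)" using 3 by (simp add: has_density_def)
    then show ?thesis using \<delta>1 \<delta>2 by (intro exI[of _ "(\<delta>1 + \<delta>2) / 2"]) simp
  qed
  then show ?thesis by (simp only: S_def)
qed

end
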